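(* Let $\mathcal{K}(x)=e^{-|x|}/2$ and $d>0$. Let $f:\mathbb{R}\to\mathbb{R}$ be smooth and assume there is $a\in(0,1)$ such that $f(0)=f(a)=f(1)=0$, $f<0$ on $(0,a)$, $f>0$ on $(a,1)$, $f'(0)<0$, $f'(1)<0$, $f'(a)>0$ and $\int_0^1 f(u)\,\mathrm{d}u>0$. Let $g(u):=u-\frac{f(u)}{d}$ and assume that there exist $0<\beta<\gamma<1$ such that $g'>0$ on $[0,\beta)\cup(\gamma,1]$, $g'<0$ on $(\beta,\gamma)$ and $g'(\beta)=g'(\gamma)=0$. With $\mathcal{G}_\pm$ and $v_m$ as defined in the context, assume $\mathcal{G}_-(g(\beta))>0$. Then there always exists a smooth, even, positive ground state $U_s:\mathbb{R}\to[0,g_-^{-1}(v_m)]$, given by $U_s(x)=g_-^{-1}(V_s(x))$ for all $x\in\mathbb{R}$, where $V_s$ is the unique positive homoclinic orbit to the origin (even in $x$) of $V-V''=g_-^{-1}(V)$. Furthermore: (i) if $g(\gamma)>0$ and $\mathcal{G}_-(g(\gamma))\ge0$, then there is no other ground state; (ii) if $g(\gamma)\le0$, or if $g(\gamma)>0$ and $\mathcal{G}_-(g(\gamma))<0$, then there is a one-parameter family of discontinuous ground states $U$ (the functions $U_{v_0}$, $v_0\in\mathcal{D}$, described in the context) which are even, positive, with precisely two points of jump discontinuity and smooth otherwise, and there is no other ground state (besides $U_s$ and this family).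
   Context: A ground state is a bounded function $U\in L^2(\mathbb{R})$, possibly discontinuous, with $0=d(-U+\mathcal{K}*U)+f(U)$ on $\mathbb{R}$, $U(\pm\infty)=0$ and $U>0$ on $\mathbb{R}$; by convention only even ground states are considered. $g_-^{-1}$ denotes the inverse of $g$ restricted to $[0,\beta]$ (defined on $[0,g(\beta)]$) and $g_+^{-1}$ the inverse of $g$ restricted to $[\gamma,1]$ (defined on $[g(\gamma),1]$). Set $$\mathcal{G}_-(V):=-\tfrac12V^2+\int_0^Vg_-^{-1}(w)\,\mathrm{d}w,\quad V\in[0,g(\beta)],\qquad \mathcal{G}_+(V):=-\tfrac12V^2-\int_V^1g_+^{-1}(w)\,\mathrm{d}w,\quad V\in[g(\gamma),1].$$ When $\mathcal{G}_-(g(\beta))>0$, $v_m\in(0,g(\beta))$ denotes the number with $\mathcal{G}_-(v_m)=0$ and $\mathcal{G}_-(v)<0$ for all $v\in(0,v_m)$. The family: $\mathcal{D}=\{v_0>0:\ g(\gamma)\le v_0<v_m\}$. For $v_0\in\mathcal{D}$, $v_*>v_0$ is the number such that $\mathcal{G}_+(v_* )=\mathcal{G}_+(v_0)-\mathcal{G}_-(v_0)$ and $\mathcal{G}_+(v_0)-\mathcal{G}_-(v_0)-\mathcal{G}_+(v)>0$ for all $v\in(v_0,v_* )$, and $$x_0=\int_{v_0}^{v_*}\frac{\mathrm{d}v}{\sqrt{2(\mathcal{G}_+(v_0)-\mathcal{G}_-(v_0)-\mathcal{G}_+(v))}}>0.$$ $V_+$ is the even solution of $V-V''=g_+^{-1}(V)$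 on $[-x_0,x_0]$ with $\tfrac12(V_+')^2+\mathcal{G}_+(V_+)=\mathcal{G}_+(v_0)-\mathcal{G}_-(v_0)$, $V_+(0)=v_*$, $V_+(\pm x_0)=v_0$. $V_-$ is the even solution of $V-V''=g_-^{-1}(V)$ on $\{|x|\ge x_0\}$ with $\tfrac12(V_-')^2+\mathcal{G}_-(V_-)=0$, $V_-(\pm x_0)=v_0$, $V_-(\pm\infty)=0$, and $V_-'(\pm x_0)=V_+'(\pm x_0)=\mp\sqrt{-2\mathcal{G}_-(v_0)}$. Then $U_{v_0}(x)=g_-^{-1}(V_-(x))$ for $|x|>x_0$ and $U_{v_0}(x)=g_+^{-1}(V_+(x))$ for $|x|<x_0$.
   Formalization: "No other ground state" is proved, up to null sets, in (i) among ground states with U≤1 and in (ii) among those with values in [0,β]∪[γ,1] and at most two discontinuities; unrestricted it fails, since the decreasing branch of g, extra jumps or values above 1 can give further ground states. *)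

theory Defs
  imports "HOL-Analysis.Analysis"
begin

text \<open>Smoothness is only used on open sets, where iterating the two-sided derivative
  \<^const>\<open>deriv\<close> is the usual notion.\<close>

definition smooth_on_open :: "real set \<Rightarrow> (real \<Rightarrow> real) \<Rightarrow> bool" where
  "smooth_on_open S f \<longleftrightarrow> (\<forall>n. \<forall>x\<in>S. (deriv ^^ n) f differentiable (at x))"

definition even_fun :: "(real \<Rightarrow> real) \<Rightarrow> bool" where
  "even_fun u \<longleftrightarrow> (\<forall>x. u (- x) = u x)"

definition has_jump_at :: "(real \<Rightarrow> real) \<Rightarrow> real \<Rightarrow> bool" where
  "has_jump_at u p \<longleftrightarrow>
     (\<exists>l r. (u \<longlongrightarrow> l) (at_left p) \<and> (u \<longlongrightarrow> r) (at_right p) \<and> l \<noteq> r)"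

definition kernel :: "real \<Rightarrow> real" where
  "kernel x = exp (- \<bar>x\<bar>) / 2"

definition conv :: "(real \<Rightarrow> real) \<Rightarrow> (real \<Rightarrow> real) \<Rightarrow> real \<Rightarrow> real" where
  "conv k u x = (LINT y|lebesgue. k (x - y) * u y)"

text \<open>A ground state is a genuine function, and the equation is required at every point of
  the line.  Evenness is part of the notion by convention.\<close>

definition ground_state :: "(real \<Rightarrow> real) \<Rightarrow> real \<Rightarrow> (real \<Rightarrow> real) \<Rightarrow> bool" where
  "ground_state f d U \<longleftrightarrow>
     bounded (range U) \<and>
     U \<in> borel_measurable lebesgue \<and> integrable lebesgue (\<lambda>x. (U x)\<^sup>2) \<and>
     (\<forall>x. 0 = d * (- U x + conv kernel U x) + f (U x)) \<and>
     (U \<longlongrightarrow> 0) at_top \<and> (U \<longlongrightarrow> 0) at_bot \<and>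
     (\<forall>x. U x > 0) \<and> even_fun U"

text \<open>The branches \<open>g\<^sub>-\<^sup>-\<^sup>1\<close> and \<open>g\<^sub>+\<^sup>-\<^sup>1\<close>; they are meaningful only on
  \<open>{0..g \<beta>}\<close> and \<open>{g \<gamma>..1}\<close>, since \<open>g 0 = 0\<close> and \<open>g 1 = 1\<close>.\<close>

definition g_minus_inv :: "(real \<Rightarrow> real) \<Rightarrow> real \<Rightarrow> real \<Rightarrow> real" where
  "g_minus_inv g \<beta> = the_inv_into {0..\<beta>} g"

definition g_plus_inv :: "(real \<Rightarrow> real) \<Rightarrow> real \<Rightarrow> real \<Rightarrow> real" where
  "g_plus_inv g \<gamma> = the_inv_into {\<gamma>..1} g"

definition G_minus :: "(real \<Rightarrow> real) \<Rightarrow> real \<Rightarrow> real \<Rightarrow> real" where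
  "G_minus g \<beta> V = - V\<^sup>2 / 2 + integral {0..V} (g_minus_inv g \<beta>)"

definition G_plus :: "(real \<Rightarrow> real) \<Rightarrow> real \<Rightarrow> real \<Rightarrow> real" where
  "G_plus g \<gamma> V = - V\<^sup>2 / 2 - integral {V..1} (g_plus_inv g \<gamma>)"

definition v_m :: "(real \<Rightarrow> real) \<Rightarrow> real \<Rightarrow> real" where
  "v_m g \<beta> = (THE v. 0 < v \<and> v < g \<beta> \<and> G_minus g \<beta> v = 0 \<and>
                      (\<forall>w\<in>{0<..<v}. G_minus g \<beta> w < 0))"

text \<open>\<open>solves h S X V V'\<close>: on \<open>X\<close> the function \<open>V\<close> takes values in the domain \<open>S\<close> of \<open>h\<close> and solves
  \<open>V - V'' = h(V)\<close>, with first derivative \<open>V'\<close>; derivatives are one-sided at boundary points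
  of \<open>X\<close>.\<close>

definition solves ::
  "(real \<Rightarrow> real) \<Rightarrow> real set \<Rightarrow> real set \<Rightarrow> (real \<Rightarrow> real) \<Rightarrow> (real \<Rightarrow> real) \<Rightarrow> bool" where
  "solves h S X V V' \<longleftrightarrow> (\<forall>x\<in>X. V x \<in> S \<and>
     (V has_real_derivative V' x) (at x within X) \<and>
     (\<exists>V2. (V' has_real_derivative V2) (at x within X) \<and> V x - V2 = h (V x)))"

definition positive_homoclinic :: "(real \<Rightarrow> real) \<Rightarrow> real set \<Rightarrow> (real \<Rightarrow> real) \<Rightarrow> bool" where
  "positive_homoclinic h S V \<longleftrightarrow>
     (\<forall>x. V x > 0) \<and>
     (\<exists>V'. solves h S UNIV V V' \<and>
        (V \<longlongrightarrow> 0) at_top \<and> (V' \<longlongrightarrow> 0) at_top \<and> (V \<longlongrightarrow> 0) at_bot \<and> (V' \<longlongrightarrow> 0) at_bot)"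

definition jump_values :: "(real \<Rightarrow> real) \<Rightarrow> real \<Rightarrow> real \<Rightarrow> real set" where
  "jump_values g \<beta> \<gamma> = {v0. v0 > 0 \<and> g \<gamma> \<le> v0 \<and> v0 < v_m g \<beta>}"

definition inner_energy :: "(real \<Rightarrow> real) \<Rightarrow> real \<Rightarrow> real \<Rightarrow> real \<Rightarrow> real" where
  "inner_energy g \<beta> \<gamma> v0 = G_plus g \<gamma> v0 - G_minus g \<beta> v0"

definition is_v_star :: "(real \<Rightarrow> real) \<Rightarrow> real \<Rightarrow> real \<Rightarrow> real \<Rightarrow> real \<Rightarrow> bool" where
  "is_v_star g \<beta> \<gamma> v0 v \<longleftrightarrow>
     v0 < v \<and> v \<le> 1 \<and> G_plus g \<gamma> v = inner_energy g \<beta> \<gamma> v0 \<and>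
     (\<forall>w\<in>{v0<..<v}. inner_energy g \<beta> \<gamma> v0 - G_plus g \<gamma> w > 0)"

definition v_star :: "(real \<Rightarrow> real) \<Rightarrow> real \<Rightarrow> real \<Rightarrow> real \<Rightarrow> real" where
  "v_star g \<beta> \<gamma> v0 = (THE v. is_v_star g \<beta> \<gamma> v0 v)"

definition travel_integrand :: "(real \<Rightarrow> real) \<Rightarrow> real \<Rightarrow> real \<Rightarrow> real \<Rightarrow> real \<Rightarrow> real" where
  "travel_integrand g \<beta> \<gamma> v0 v = 1 / sqrt (2 * (inner_energy g \<beta> \<gamma> v0 - G_plus g \<gamma> v))"

definition jump_point :: "(real \<Rightarrow> real) \<Rightarrow> real \<Rightarrow> real \<Rightarrow> real \<Rightarrow> real" where
  "jump_point g \<beta> \<gamma> v0 = integral {v0..v_star g \<beta> \<gamma> v0} (travel_integrand g \<beta> \<gamma> v0)"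

text \<open>\<open>V\<^sub>+\<close> and \<open>V\<^sub>-\<close> live on \<open>{-x0..x0}\<close> and \<open>{x. x0 \<le> \<bar>x\<bar>}\<close>.  To make them definite functions on
  the line they are set to zero elsewhere; those values are never used.\<close>

definition is_V_plus :: "(real \<Rightarrow> real) \<Rightarrow> real \<Rightarrow> real \<Rightarrow> real \<Rightarrow> (real \<Rightarrow> real) \<Rightarrow> bool" where
  "is_V_plus g \<beta> \<gamma> v0 V \<longleftrightarrow> (let x0 = jump_point g \<beta> \<gamma> v0 in
     even_fun V \<and> (\<forall>x. x0 < \<bar>x\<bar> \<longrightarrow> V x = 0) \<and>
     V 0 = v_star g \<beta> \<gamma> v0 \<and> V x0 = v0 \<and> V (- x0) = v0 \<and>
     (\<exists>V'. solves (g_plus_inv g \<gamma>) {g \<gamma>..1} {-x0..x0} V V' \<and>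
        (\<forall>x\<in>{-x0..x0}. (V' x)\<^sup>2 / 2 + G_plus g \<gamma> (V x) = inner_energy g \<beta> \<gamma> v0) \<and>
        V' x0 = - sqrt (- 2 * G_minus g \<beta> v0) \<and> V' (- x0) = sqrt (- 2 * G_minus g \<beta> v0)))"

definition is_V_minus :: "(real \<Rightarrow> real) \<Rightarrow> real \<Rightarrow> real \<Rightarrow> real \<Rightarrow> (real \<Rightarrow> real) \<Rightarrow> bool" where
  "is_V_minus g \<beta> \<gamma> v0 V \<longleftrightarrow> (let x0 = jump_point g \<beta> \<gamma> v0 in
     even_fun V \<and> (\<forall>x. \<bar>x\<bar> < x0 \<longrightarrow> V x = 0) \<and>
     V x0 = v0 \<and> V (- x0) = v0 \<and> (V \<longlongrightarrow> 0) at_top \<and> (V \<longlongrightarrow> 0) at_bot \<and>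
     (\<exists>V'. solves (g_minus_inv g \<beta>) {0..g \<beta>} {x. x0 \<le> \<bar>x\<bar>} V V' \<and>
        (\<forall>x. x0 \<le> \<bar>x\<bar> \<longrightarrow> (V' x)\<^sup>2 / 2 + G_minus g \<beta> (V x) = 0) \<and>
        V' x0 = - sqrt (- 2 * G_minus g \<beta> v0) \<and> V' (- x0) = sqrt (- 2 * G_minus g \<beta> v0)))"

definition V_plus :: "(real \<Rightarrow> real) \<Rightarrow> real \<Rightarrow> real \<Rightarrow> real \<Rightarrow> real \<Rightarrow> real" where
  "V_plus g \<beta> \<gamma> v0 = (THE V. is_V_plus g \<beta> \<gamma> v0 V)"

definition V_minus :: "(real \<Rightarrow> real) \<Rightarrow> real \<Rightarrow> real \<Rightarrow> real \<Rightarrow> real \<Rightarrow> real" where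
  "V_minus g \<beta> \<gamma> v0 = (THE V. is_V_minus g \<beta> \<gamma> v0 V)"

text \<open>At the two jump points the function is given its outer one-sided limit.  Some choice is
  needed for the equation to make sense there; the inner limit would serve equally well.\<close>

definition U_jump :: "(real \<Rightarrow> real) \<Rightarrow> real \<Rightarrow> real \<Rightarrow> real \<Rightarrow> real \<Rightarrow> real" where
  "U_jump g \<beta> \<gamma> v0 x =
     (if \<bar>x\<bar> < jump_point g \<beta> \<gamma> v0 then g_plus_inv g \<gamma> (V_plus g \<beta> \<gamma> v0 x)
      else g_minus_inv g \<beta> (V_minus g \<beta> \<gamma> v0 x))"

text \<open>The class of competitors for the classification when jumps are possible.  Without these
  restrictions the classification fails: further even ground states arise by placing the inner
  part on the decreasing branch of \<open>g\<close> over \<open>[\<beta>, \<gamma>]\<close>; by switching back from the branch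
  \<open>g\<^sub>+\<^sup>-\<^sup>1\<close> to the branch \<open>g\<^sub>-\<^sup>-\<^sup>1\<close> before \<open>V\<close> reaches its maximum (four or more jumps); or by using
  values of \<open>U\<close> beyond 1, where nothing is assumed about \<open>f\<close>.\<close>

definition two_branch_profile :: "real \<Rightarrow> real \<Rightarrow> (real \<Rightarrow> real) \<Rightarrow> bool" where
  "two_branch_profile \<beta> \<gamma> U \<longleftrightarrow>
     range U \<subseteq> {0..\<beta>} \<union> {\<gamma>..1} \<and>
     (\<exists>P. finite P \<and> card P \<le> 2 \<and> (\<forall>x. x \<notin> P \<longrightarrow> isCont U x))"

end

theory Submission
  imports Defs
begin

text \<open>For a ground state \<open>U\<close> put \<open>V = K * U\<close>. The equation says \<open>g (U) = V\<close>, and \<open>V - V'' = U\<close>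
  because \<open>K\<close> is the Green function of \<open>1 - d\<^sup>2/dx\<^sup>2\<close>; so wherever \<open>U\<close> lies on one monotone
  branch \<open>h\<close> of the inverse of \<open>g\<close>, \<open>V\<close> solves the Newton equation \<open>V'' = V - h (V)\<close>. Every
  orbit is obtained, and identified, by inverting the travel time \<open>\<integral> dv / sqrt (F v)\<close>, where
  \<open>V'\<^sup>2 = F (V)\<close> is conservation of energy. This needs no Lipschitz condition, which fails at
  \<open>g \<gamma>\<close>. The energy on the minus branch vanishes by the decay at infinity, and matching
  \<open>V\<close> and \<open>V'\<close> at a jump fixes the energy of the inner orbit and hence the position of the jump.
  An inner orbit turns at a \<open>v\<^sub>* < 1\<close> because \<open>G\<^sub>- - G\<^sub>+\<close> decreases up to \<open>v\<^sub>m\<close>.\<close>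

subsection \<open>Smooth functions on open sets\<close>

text \<open>A ground state is only bounded and measurable, so \<open>V\<close> is a priori of class
  C^1 and no more. The equation \<open>V'' = V - U\<close> is therefore first obtained in integrated
  form, valid across jumps, and becomes pointwise only where \<open>U\<close> is continuous.
  \<open>potential_well\<close> is one abstract orbit used twice. On the minus branch its left end
  is the rest state 0, approached only in infinite time, so the orbit fills the line. On the plus
  branch the left end is an artificial level below \<open>v0\<close>, so that \<open>v0\<close> is
  passed at an interior time, which is the jump point. An unknown orbit \<open>W\<close> is
  identified through the travel time \<open>T\<close>: \<open>T (W x) - x\<close> is constant as
  long as \<open>W\<close> falls, and \<open>V (T v) = v\<close> recovers \<open>W\<close>. What
  remains in every uniqueness argument is to show that the orbit does not stop falling. On the minus
  branch this follows from zero energy and the infinite time needed to reach 0; on the plus branch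
  from concavity, since \<open>hp v > v\<close> for \<open>v < 1\<close>.\<close>

fun Ck :: "nat \<Rightarrow> real set \<Rightarrow> (real \<Rightarrow> real) \<Rightarrow> bool" where
  "Ck 0 S f \<longleftrightarrow> continuous_on S f"
| "Ck (Suc n) S f \<longleftrightarrow> (\<exists>f'. (\<forall>x\<in>S. (f has_real_derivative f' x) (at x)) \<and> Ck n S f')"

lemma Ck_continuous: "Ck n S f \<Longrightarrow> continuous_on S f"
  by (cases n) (auto intro!: continuous_at_imp_continuous_on intro: DERIV_isCont)

lemma Ck_Suc_imp: "Ck (Suc n) S f \<Longrightarrow> Ck n S f"
proof (induction n arbitrary: f)
  case 0 then show ?case using Ck_continuous[of "Suc 0" S f] by simp
next
  case (Suc n)
  from Suc.prems obtain f' where f': "\<forall>x\<in>S. (f has_real_derivative f' x) (at x)" "Ck (Suc n) S f'"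
    by auto
  have "Ck n S f'" using Suc.IH f'(2) by blast
  then show ?case using f'(1) by auto
qed

lemma Ck_const: "Ck n S (\<lambda>x. c)"
proof (induction n arbitrary: c)
  case (Suc n)
  show ?case using Suc[of 0] by (auto intro!: exI[of _ "\<lambda>_. 0"])
qed simp

lemma Ck_add: "Ck n S f \<Longrightarrow> Ck n S h \<Longrightarrow> Ck n S (\<lambda>x. f x + h x)"
proof (induction n arbitrary: f h)
  case (Suc n)
  from Suc.prems obtain f' h' where
    "\<forall>x\<in>S. (f has_real_derivative f' x) (at x)" "Ck n S f'"
    "\<forall>x\<in>S. (h has_real_derivative h' x) (at x)" "Ck n S h'" by auto
  then show ?case using Suc.IH[of f' h']
    by (auto intro!: exI[of _ "\<lambda>x. f' x + h' x"] DERIV_add)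
qed (auto intro: continuous_intros)

lemma Ck_mult: "Ck n S f \<Longrightarrow> Ck n S h \<Longrightarrow> Ck n S (\<lambda>x. f x * h x)"
proof (induction n arbitrary: f h)
  case (Suc n)
  from Suc.prems obtain f' h' where *:
    "\<forall>x\<in>S. (f has_real_derivative f' x) (at x)" "Ck n S f'"
    "\<forall>x\<in>S. (h has_real_derivative h' x) (at x)" "Ck n S h'" by auto
  have "Ck n S (\<lambda>x. f' x * h x + h' x * f x)"
    using * Suc.prems[THEN Ck_Suc_imp] by (intro Ck_add Suc.IH)
  then show ?case using *
    by (auto intro!: exI[of _ "\<lambda>x. f' x * h x + h' x * f x"] DERIV_mult)
qed (auto intro: continuous_intros)

lemma Ck_compose: "Ck n UNIV f \<Longrightarrow> Ck n S h \<Longrightarrow> Ck n S (\<lambda>x. f (h x))"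
proof (induction n arbitrary: f h)
  case 0
  then show ?case by (auto intro: continuous_on_compose2)
next
  case (Suc n)
  from Suc.prems obtain f' h' where *:
    "\<forall>x\<in>UNIV. (f has_real_derivative f' x) (at x)" "Ck n UNIV f'"
    "\<forall>x\<in>S. (h has_real_derivative h' x) (at x)" "Ck n S h'"
    unfolding Ck.simps by blast
  have "Ck n S (\<lambda>x. f' (h x) * h' x)"
    by (rule Ck_mult[OF Suc.IH[OF *(2) Suc.prems(2)[THEN Ck_Suc_imp]] *(4)])
  moreover have "\<forall>x\<in>S. ((\<lambda>x. f (h x)) has_real_derivative f' (h x) * h' x) (at x)"
    using * by (auto intro: DERIV_chain2)
  ultimately show ?case by (auto intro!: exI[of _ "\<lambda>x. f' (h x) * h' x"])
qed

lemma Ck_inverse: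
  "(\<And>x. x \<in> S \<Longrightarrow> h x \<noteq> 0) \<Longrightarrow> Ck n S h \<Longrightarrow> Ck n S (\<lambda>x. inverse (h x))"
proof (induction n arbitrary: h)
  case 0
  then show ?case by (auto intro: continuous_intros)
next
  case (Suc n)
  from Suc.prems(2) obtain h' where *: "\<forall>x\<in>S. (h has_real_derivative h' x) (at x)" "Ck n S h'" by auto
  have i: "Ck n S (\<lambda>x. inverse (h x))"
    by (rule Suc.IH[OF Suc.prems(1) Suc.prems(2)[THEN Ck_Suc_imp]])
  have "Ck n S (\<lambda>x. (-1) * (h' x * (inverse (h x) * inverse (h x))))"
    using * by (intro Ck_mult i Ck_const) auto
  moreover have "\<forall>x\<in>S. ((\<lambda>x. inverse (h x)) has_real_derivative
      (-1) * (h' x * (inverse (h x) * inverse (h x)))) (at x)"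
    using * Suc.prems by (auto intro!: derivative_eq_intros)
  ultimately show ?case
    by (auto intro!: exI[of _ "\<lambda>x. (-1) * (h' x * (inverse (h x) * inverse (h x)))"])
qed

text \<open>\<open>Ck\<close> carries derivatives as explicit witnesses, which suits the closure
  rules. A witness agrees with \<open>deriv f\<close> only on \<open>S\<close>, but \<open>S\<close>
  is open, so the agreement holds near each of its points and survives further
  differentiation.\<close>

lemma Ck_higher_deriv:
  assumes "open S" "\<And>n. Ck n S f"
  shows "smooth_on_open S f"
proof -
  have "\<forall>f. Ck (Suc n) S f \<longrightarrow> (\<forall>x\<in>S. (deriv ^^ n) f differentiable at x)" for n
  proof (induction n)
    case 0
    then show ?case by (auto simp: real_differentiable_def)
  next
    case (Suc n)
    show ?case
    proof (intro allI impI ballI)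
      fix f x assume "Ck (Suc (Suc n)) S f" and x: "x \<in> S"
      then obtain f' where f': "\<forall>x\<in>S. (f has_real_derivative f' x) (at x)" "Ck (Suc n) S f'"
        unfolding Ck.simps(2)[of "Suc n"] by blast
      have eq: "(deriv ^^ k) (deriv f) y = (deriv ^^ k) f' y" if "y \<in> S" for k y
        using that
      proof (induction k arbitrary: y)
        case 0 then show ?case using f' by (auto intro: DERIV_imp_deriv)
      next
        case (Suc k)
        have "eventually (\<lambda>z. z \<in> S) (nhds y)"
          using assms(1) Suc.prems by (rule eventually_nhds_in_open)
        then have "eventually (\<lambda>z. (deriv ^^ k) (deriv f) z = (deriv ^^ k) f' z) (nhds y)"
          by eventually_elim (rule Suc.IH)
        then show ?case by (simp add: deriv_cong_ev)
      qed
      have "(deriv ^^ n) f' differentiable at x" using Suc f'(2) x by blast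
      then obtain D where "((deriv ^^ n) f' has_real_derivative D) (at x)"
        by (auto simp: real_differentiable_def)
      then have "((deriv ^^ n) (deriv f) has_real_derivative D) (at x)"
        using assms(1) x eq by (auto intro: has_field_derivative_transform_within_open)
      then show "(deriv ^^ Suc n) f differentiable at x"
        by (auto simp: real_differentiable_def funpow_Suc_right simp del: funpow.simps)
    qed
  qed
  then show ?thesis using assms(2) unfolding smooth_on_open_def by blast
qed

lemma smooth_deriv: "smooth_on_open UNIV f \<Longrightarrow> (f has_real_derivative deriv f x) (at x)"
  unfolding smooth_on_open_def
  by (metis DERIV_deriv_iff_real_differentiable UNIV_I funpow_0)

lemma smooth_on_open_deriv: "smooth_on_open UNIV f \<Longrightarrow> smooth_on_open UNIV (deriv f)"
  unfolding smooth_on_open_def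
  by (metis UNIV_I comp_apply funpow_Suc_right)

lemma smooth_imp_Ck: "smooth_on_open UNIV f \<Longrightarrow> Ck n UNIV f"
proof (induction n arbitrary: f)
  case 0
  then show ?case
    using smooth_deriv[OF 0] by (auto intro!: continuous_at_imp_continuous_on intro: DERIV_isCont)
next
  case (Suc n)
  show ?case using smooth_deriv[OF Suc.prems] Suc.IH[OF smooth_on_open_deriv[OF Suc.prems]] by auto
qed

text \<open>Bootstrapping: each differentiation of \<open>(V, W, U)\<close> expresses the derivatives by smooth
  functions of \<open>(V, W, U)\<close> itself.\<close>

lemma smooth_bootstrap:
  fixes U V W g' :: "real \<Rightarrow> real"
  assumes "open S"
    and V: "\<And>x. x \<in> S \<Longrightarrow> (V has_real_derivative W x) (at x)"
    and W: "\<And>x. x \<in> S \<Longrightarrow> (W has_real_derivative V x - U x) (at x)"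
    and U: "\<And>x. x \<in> S \<Longrightarrow> (U has_real_derivative W x / g' (U x)) (at x)"
    and nz: "\<And>x. x \<in> S \<Longrightarrow> g' (U x) \<noteq> 0"
    and g': "\<And>n. Ck n UNIV g'"
  shows "smooth_on_open S U"
proof (rule Ck_higher_deriv[OF assms(1)])
  have "Ck n S V \<and> Ck n S W \<and> Ck n S U" for n
  proof (induction n)
    case 0
    show ?case using V W U by (auto intro!: continuous_at_imp_continuous_on intro: DERIV_isCont)
  next
    case (Suc n)
    have 1: "Ck n S (\<lambda>x. W x * inverse (g' (U x)))"
      using Suc nz by (intro Ck_mult Ck_inverse Ck_compose[OF g']) auto
    have 2: "Ck n S (\<lambda>x. V x + (-1) * U x)"
      using Suc by (intro Ck_add Ck_mult Ck_const) auto
    have "\<forall>x\<in>S. (U has_real_derivative W x * inverse (g' (U x))) (at x)"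
      using U by (simp add: divide_inverse)
    moreover have "\<forall>x\<in>S. (W has_real_derivative V x + (-1) * U x) (at x)" using W by simp
    moreover have "\<forall>x\<in>S. (V has_real_derivative W x) (at x)" using V by simp
    ultimately show ?case
      using 1 2 Suc unfolding Ck.simps(2)
      by (intro conjI exI[of _ W] exI[of _ "\<lambda>x. V x + (-1) * U x"]
          exI[of _ "\<lambda>x. W x * inverse (g' (U x))"]) auto
  qed
  then show "Ck n S U" for n by blast
qed

subsection \<open>Convolution with the exponential kernel\<close>

text \<open>For \<open>t >= x\<close> the kernel factors as \<open>exp x * exp (- t) / 2\<close>,
  for \<open>t <= x\<close> as \<open>exp (- x) * exp t / 2\<close>. Hence \<open>x\<close> enters
  the convolution only through an exponential factor and the endpoint of a half-line.\<close>

definition right_exp_integral :: "(real \<Rightarrow> real) \<Rightarrow> real \<Rightarrow> real" where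
  "right_exp_integral U x = integral {x..} (\<lambda>t. exp (- t) * U t)"

definition left_exp_integral :: "(real \<Rightarrow> real) \<Rightarrow> real \<Rightarrow> real" where
  "left_exp_integral U x = integral {..x} (\<lambda>t. exp t * U t)"

text \<open>The formal derivative of the split convolution. The endpoint contributions
  \<open>- U x\<close> and \<open>U x\<close> of the two halves cancel, so no point value of
  \<open>U\<close> occurs.\<close>

definition conv_deriv :: "(real \<Rightarrow> real) \<Rightarrow> real \<Rightarrow> real" where
  "conv_deriv U x = (exp x * right_exp_integral U x - exp (- x) * left_exp_integral U x) / 2"

lemma integrable_exp_minus_abs: "integrable lebesgue (\<lambda>t::real. exp (- \<bar>x - t\<bar>))"
proof -
  define h where "h = (\<lambda>t::real. indicator {0..} t * exp (- t))"
  have "(\<lambda>t::real. exp (-1 * t)) integrable_on {0..}"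
    using has_integral_exp_minus_to_infinity[of 1 0] by (auto simp: integrable_on_def)
  then have "(\<lambda>t::real. exp (- t)) absolutely_integrable_on {0..}"
    by (intro nonnegative_absolutely_integrable_1) auto
  then have h: "integrable lebesgue h"
    unfolding h_def set_integrable_def by simp
  have h': "integrable lebesgue (\<lambda>t. h (0 + (-1) * t))"
    by (subst lebesgue_integrable_real_affine_iff) (use h in auto)
  have "integrable lebesgue (\<lambda>t. h t + h (0 + (-1) * t))"
    using h h' by (rule Bochner_Integration.integrable_add)
  then have "integrable lebesgue (\<lambda>t::real. exp (- \<bar>t\<bar>))"
    by (rule Bochner_Integration.integrable_bound)
      (auto simp: h_def indicator_def intro!: measurable_completion)
  then have "integrable lebesgue (\<lambda>t::real. exp (- \<bar>x + (-1) * t\<bar>))"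
    by (subst lebesgue_integrable_real_affine_iff[where f = "\<lambda>t. exp (- \<bar>t\<bar>)"]) auto
  then show ?thesis by simp
qed

lemma derivative_zero_if_small:
  fixes B \<phi> :: "real \<Rightarrow> real"
  assumes "\<And>y. \<bar>B y - B x\<bar> \<le> \<bar>y - x\<bar> * \<phi> y" "(\<phi> \<longlongrightarrow> 0) (at x)"
  shows "(B has_real_derivative 0) (at x)"
  unfolding has_field_derivative_iff
proof (rule Lim_null_comparison[OF _ assms(2)])
  show "\<forall>\<^sub>F y in at x. norm ((B y - B x) / (y - x)) \<le> \<phi> y"
    unfolding eventually_at_filter
    using assms(1) by (auto simp: field_simps)
qed

text \<open>No continuity of \<open>U\<close> is built in, because the sources of interest jump; it
  is requested pointwise by the few lemmas that need it.\<close>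

locale bounded_source =
  fixes U :: "real \<Rightarrow> real" and M :: real
  assumes measU: "U \<in> borel_measurable lebesgue"
    and bndU: "\<And>t. \<bar>U t\<bar> \<le> M"
begin

lemma M_nonneg: "0 \<le> M" using bndU[of 0] by linarith

lemma integrable_kernel: "integrable lebesgue (\<lambda>t. exp (- \<bar>x - t\<bar>) * U t)"
proof (rule Bochner_Integration.integrable_bound)
  show "integrable lebesgue (\<lambda>t. exp (- \<bar>x - t\<bar>) * M)"
    using integrable_exp_minus_abs by (rule integrable_mult_left)
  show "(\<lambda>t. exp (- \<bar>x - t\<bar>) * U t) \<in> borel_measurable lebesgue"
    by (rule borel_measurable_times[OF measurable_completion measU]) auto
  show "AE t in lebesgue. norm (exp (- \<bar>x - t\<bar>) * U t) \<le> norm (exp (- \<bar>x - t\<bar>) * M)"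
    using bndU M_nonneg by (auto simp: abs_mult)
qed

lemma abs_int_kernel: "S \<in> sets lebesgue \<Longrightarrow> (\<lambda>t. exp (- \<bar>x - t\<bar>) * U t) absolutely_integrable_on S"
  using integrable_kernel[of x] unfolding set_integrable_def
  by (rule integrable_mult_indicator[rotated])

lemma right_abs_int: "(\<lambda>t. exp (- t) * U t) absolutely_integrable_on {x..}"
proof -
  have "(\<lambda>t. exp (- x) * (exp (- \<bar>x - t\<bar>) * U t)) absolutely_integrable_on {x..}"
    using abs_int_kernel[of "{x..}" x] by (intro set_integrable_mult_right) auto
  then show ?thesis
    by (rule set_integrable_cong[OF refl refl, THEN iffD1, rotated])
      (auto simp: mult.assoc[symmetric] exp_add[symmetric])
qed

lemma left_abs_int: "(\<lambda>t. exp t * U t) absolutely_integrable_on {..x}"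
proof -
  have "(\<lambda>t. exp x * (exp (- \<bar>x - t\<bar>) * U t)) absolutely_integrable_on {..x}"
    using abs_int_kernel[of "{..x}" x] by (intro set_integrable_mult_right) auto
  then show ?thesis
    by (rule set_integrable_cong[OF refl refl, THEN iffD1, rotated])
      (auto simp: mult.assoc[symmetric] exp_add[symmetric])
qed

lemma right_int: "(\<lambda>t. exp (- t) * U t) integrable_on {x..}"
  using right_abs_int by (rule absolutely_integrable_on_def[THEN iffD1, THEN conjunct1])

lemma left_int: "(\<lambda>t. exp t * U t) integrable_on {..x}"
  using left_abs_int by (rule absolutely_integrable_on_def[THEN iffD1, THEN conjunct1])

lemma integrable_weighted:
  assumes "continuous_on {x..y} w"
  shows "(\<lambda>t. w t * U t) integrable_on {x..y}"
proof -
  have "bounded (w ` {x..y})"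
    by (rule compact_imp_bounded[OF compact_continuous_image[OF assms compact_Icc]])
  then obtain B where "\<forall>z\<in>w ` {x..y}. norm z \<le> B" unfolding bounded_iff by blast
  then have B: "\<bar>w t\<bar> \<le> B" if "t \<in> {x..y}" for t using that by auto
  have "(\<lambda>t. w t * U t) absolutely_integrable_on {x..y}"
  proof (rule measurable_bounded_by_integrable_imp_absolutely_integrable)
    show "(\<lambda>t. w t * U t) \<in> borel_measurable (lebesgue_on {x..y})"
      using assms measU
      by (intro borel_measurable_times continuous_imp_measurable_on_sets_lebesgue
          measurable_restrict_space1) auto
    show "(\<lambda>t. B * M) integrable_on {x..y}" by auto
    show "norm (w t * U t) \<le> B * M" if "t \<in> {x..y}" for t
      using B[OF that] bndU[of t] by (auto simp: abs_mult intro!: mult_mono)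
  qed auto
  then show ?thesis by (rule absolutely_integrable_on_def[THEN iffD1, THEN conjunct1])
qed

lemma integrable_U: "U integrable_on {x..y}"
  using integrable_weighted[of x y "\<lambda>_. 1"] by simp

lemma right_diff:
  assumes "x \<le> y"
  shows "right_exp_integral U x - right_exp_integral U y = integral {x..y} (\<lambda>t. exp (- t) * U t)"
proof -
  have "{x..} = {x..y} \<union> {y..}" "{x..y} \<inter> {y..} = {y}" using assms by auto
  then have "right_exp_integral U x = integral {x..y} (\<lambda>t. exp (- t) * U t) + right_exp_integral U y"
    unfolding right_exp_integral_def
    using right_int
    by (auto intro!: integral_Un continuous_intros integrable_weighted)
  then show ?thesis by simp
qed

lemma left_diff:
  assumes "x \<le> y"
  shows "left_exp_integral U y - left_exp_integral U x = integral {x..y} (\<lambda>t. exp t * U t)"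
proof -
  have "{..y} = {..x} \<union> {x..y}" "{..x} \<inter> {x..y} = {x}" using assms by auto
  then have "left_exp_integral U y = left_exp_integral U x + integral {x..y} (\<lambda>t. exp t * U t)"
    unfolding left_exp_integral_def
    using left_int
    by (auto intro!: integral_Un continuous_intros integrable_weighted)
  then show ?thesis by simp
qed

lemma conv_eq:
  "conv kernel U x = (exp x * right_exp_integral U x + exp (- x) * left_exp_integral U x) / 2"
proof -
  let ?f = "\<lambda>t. exp (- \<bar>x - t\<bar>) * U t"
  have "conv kernel U x = (LINT t|lebesgue. ?f t / 2)"
    unfolding conv_def kernel_def by simp
  also have "\<dots> = (LINT t|lebesgue. ?f t) / 2"
    by (rule integral_divide_zero)
  also have "(LINT t|lebesgue. ?f t) = integral UNIV ?f"
    using integrable_kernel integral_lebesgue by metis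
  also have "UNIV = {x..} \<union> {..x}" by auto
  also have "integral \<dots> ?f = integral {x..} ?f + integral {..x} ?f"
  proof (rule integral_Un)
    have "{x..} \<inter> {..x} = {x}" by auto
    then show "negligible ({x..} \<inter> {..x})" by simp
  qed (auto intro!: absolutely_integrable_on_def[THEN iffD1, THEN conjunct1] abs_int_kernel)
  also have "integral {x..} ?f = integral {x..} (\<lambda>t. exp x * (exp (- t) * U t))"
    by (rule integral_cong) (auto simp: mult.assoc[symmetric] exp_add[symmetric])
  also have "integral {..x} ?f = integral {..x} (\<lambda>t. exp (- x) * (exp t * U t))"
    by (rule integral_cong) (auto simp: mult.assoc[symmetric] exp_add[symmetric])
  finally show ?thesis
    by (simp add: right_exp_integral_def left_exp_integral_def)
qed

text \<open>The difference of \<open>exp (l x) A x\<close> and the primitive \<open>N\<close> of \<open>U\<close> is differentiable at every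
  point, even though \<open>N\<close> need not be: the increments of the two differ by
  \<open>\<integral> (exp (l (y - t)) - 1) U t dt\<close>, which is of second order.\<close>

lemma exp_primitive_deriv:
  assumes l: "\<bar>l\<bar> = 1"
    and A: "\<And>x y. x \<le> y \<Longrightarrow> A y - A x = integral {x..y} (\<lambda>t. exp (- (l * t)) * U t)"
    and N: "\<And>x y. x \<le> y \<Longrightarrow> N y - N x = integral {x..y} U"
  shows "((\<lambda>x. exp (l * x) * A x - N x) has_real_derivative l * exp (l * x) * A x) (at x)"
proof -
  \<comment> \<open>Freezing \<open>A x\<close> takes out the term that differentiates only the
    exponential factor. What is left should have derivative zero at \<open>x\<close>.\<close>
  define B where "B = (\<lambda>y. exp (l * y) * A y - N y - exp (l * y) * A x)"
  \<comment> \<open>\<open>z\<close> may be either end of the interval: it is the moving point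
    \<open>y\<close>, which can lie on either side of the base point.\<close>
  have est: "\<bar>exp (l * z) * (A y' - A x') - (N y' - N x')\<bar> \<le> (y' - x') * (M * (exp (y' - x') - 1))"
    if "x' \<le> y'" "z \<in> {x'..y'}" for x' y' z
  proof -
    have i: "(\<lambda>t. (exp (l * (z - t)) - 1) * U t) integrable_on {x'..y'}"
      by (intro integrable_weighted continuous_intros)
    have "exp (l * z) * (A y' - A x') - (N y' - N x')
       = integral {x'..y'} (\<lambda>t. exp (l * z) * (exp (- (l * t)) * U t)) - integral {x'..y'} U"
      using A[OF that(1)] N[OF that(1)] by simp
    also have "\<dots> = integral {x'..y'} (\<lambda>t. exp (l * z) * (exp (- (l * t)) * U t) - U t)"
    proof (rule integral_diff[symmetric])
      have "(\<lambda>t. (exp (l * z) * exp (- (l * t))) * U t) integrable_on {x'..y'}"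
        by (intro integrable_weighted continuous_intros)
      then show "(\<lambda>t. exp (l * z) * (exp (- (l * t)) * U t)) integrable_on {x'..y'}"
        by (simp add: mult.assoc)
    qed (rule integrable_U)
    also have "\<dots> = integral {x'..y'} (\<lambda>t. (exp (l * (z - t)) - 1) * U t)"
      by (rule integral_cong) (simp add: algebra_simps exp_add[symmetric] exp_diff exp_minus field_simps)
    finally have eq: "exp (l * z) * (A y' - A x') - (N y' - N x') =
      integral {x'..y'} (\<lambda>t. (exp (l * (z - t)) - 1) * U t)" .
    have "norm (integral {x'..y'} (\<lambda>t. (exp (l * (z - t)) - 1) * U t))
        \<le> integral {x'..y'} (\<lambda>t. M * (exp (y' - x') - 1))"
    proof (rule integral_norm_bound_integral[OF i])
      fix t assume t: "t \<in> {x'..y'}"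
      have s: "\<bar>l * (z - t)\<bar> \<le> y' - x'" using t that l by (auto simp: abs_mult)
      have "\<bar>exp (l * (z - t)) - 1\<bar> \<le> exp \<bar>l * (z - t)\<bar> - 1"
      proof (cases "l * (z - t) \<ge> 0")
        case False
        define s where "s = - (l * (z - t))"
        \<comment> \<open>For a negative exponent, \<open>1 - exp (- s) <= exp s - 1\<close> is just
          \<open>cosh s >= 1\<close>.\<close>
        have "1 \<le> (exp s + exp (- s)) / 2"
          using cosh_real_ge_1[of s] unfolding cosh_def by simp
        then have "1 - exp (- s) \<le> exp s - 1" by simp
        moreover have "exp (- s) \<le> 1" using False by (simp add: s_def)
        ultimately show ?thesis using False by (simp add: s_def)
      qed simp
      also have "\<dots> \<le> exp (y' - x') - 1" using s by simp
      finally show "norm ((exp (l * (z - t)) - 1) * U t) \<le> M * (exp (y' - x') - 1)"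
        using bndU[of t] M_nonneg by (auto simp: abs_mult mult.commute intro!: mult_mono)
    qed auto
    also have "\<dots> = (y' - x') * (M * (exp (y' - x') - 1))" using that by simp
    finally show ?thesis using eq by simp
  qed
  have "(B has_real_derivative 0) (at x)"
  proof (rule derivative_zero_if_small)
    show "\<bar>B y - B x\<bar> \<le> \<bar>y - x\<bar> * (M * (exp \<bar>y - x\<bar> - 1))" for y
    proof (cases "x \<le> y")
      case True
      then show ?thesis using est[of x y y] by (simp add: B_def algebra_simps)
    next
      case False
      then show ?thesis using est[of y x y]
        by (simp add: B_def algebra_simps abs_minus_commute)
    qed
    have "((\<lambda>y. M * (exp \<bar>y - x\<bar> - 1)) \<longlongrightarrow> M * (exp \<bar>x - x\<bar> - 1)) (at x)"
      by (intro tendsto_intros)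
    then show "((\<lambda>y. M * (exp \<bar>y - x\<bar> - 1)) \<longlongrightarrow> 0) (at x)" by simp
  qed
  moreover have "((\<lambda>y. exp (l * y) * A x) has_real_derivative l * exp (l * x) * A x) (at x)"
    by (auto intro!: derivative_eq_intros)
  ultimately have "((\<lambda>y. B y + exp (l * y) * A x) has_real_derivative 0 + l * exp (l * x) * A x) (at x)"
    by (rule DERIV_add)
  then show ?thesis by (simp add: B_def)
qed

text \<open>The signed integral from 0. Two terms are used because an integral over a reversed
  interval is 0 rather than negated.\<close>

definition primitive :: "real \<Rightarrow> real" where
  "primitive x = integral {0..x} U - integral {x..0} U"

lemma primitive_diff:
  assumes "x \<le> y" shows "primitive y - primitive x = integral {x..y} U"
proof -
  have deg: "integral {s..t} U = 0" if "t \<le> s" for s t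
    using that by (cases "s = t") auto
  consider "0 \<le> x" | "y \<le> 0" | "x \<le> 0" "0 \<le> y" by linarith
  then show ?thesis
  proof cases
    case 1
    then show ?thesis
      using assms Henstock_Kurzweil_Integration.integral_combine[of 0 x y U] integrable_U
      by (simp add: primitive_def deg)
  next
    case 2
    then show ?thesis
      using assms Henstock_Kurzweil_Integration.integral_combine[of x y 0 U] integrable_U
      by (simp add: primitive_def deg)
  next
    case 3
    then show ?thesis
      using assms Henstock_Kurzweil_Integration.integral_combine[of x 0 y U] integrable_U
      by (simp add: primitive_def deg)
  qed
qed

lemma right_osc:
  "((\<lambda>x. - exp x * right_exp_integral U x - primitive x) has_real_derivative
     - exp x * right_exp_integral U x) (at x)"
  using exp_primitive_deriv[of 1 "\<lambda>x. - right_exp_integral U x" primitive x]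
  by (simp add: right_diff primitive_diff)

lemma left_osc:
  "((\<lambda>x. exp (- x) * left_exp_integral U x - primitive x) has_real_derivative
     - exp (- x) * left_exp_integral U x) (at x)"
  using exp_primitive_deriv[of "-1" "left_exp_integral U" primitive x]
  by (simp add: left_diff primitive_diff)

text \<open>Each half of the convolution is differentiable only after subtracting
  \<open>primitive\<close>; in the difference of the two corrected halves that correction
  cancels.\<close>

lemma conv_has_deriv: "(conv kernel U has_real_derivative conv_deriv U x) (at x)"
proof -
  have "((\<lambda>x. ((exp (- x) * left_exp_integral U x - primitive x) -
      (- exp x * right_exp_integral U x - primitive x)) / 2) has_real_derivative
      (- exp (- x) * left_exp_integral U x - (- exp x * right_exp_integral U x)) / 2) (at x)"
    by (intro DERIV_cdivide DERIV_diff left_osc right_osc)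
  then show ?thesis
    by (simp add: conv_eq[abs_def] conv_deriv_def algebra_simps)
qed

text \<open>Adding the corrected halves instead of subtracting them keeps the correction. The
  result, \<open>(V' + N)' = V\<close> with \<open>N\<close> the primitive of \<open>U\<close>, is
  \<open>V'' = V - U\<close> without any continuity of \<open>U\<close>.\<close>

lemma conv_deriv_plus_primitive:
  "((\<lambda>x. conv_deriv U x + primitive x) has_real_derivative conv kernel U x) (at x)"
proof -
  have "((\<lambda>x. - ((exp (- x) * left_exp_integral U x - primitive x) +
      (- exp x * right_exp_integral U x - primitive x)) / 2) has_real_derivative
      - (- exp (- x) * left_exp_integral U x + (- exp x * right_exp_integral U x)) / 2) (at x)"
    by (intro DERIV_cdivide DERIV_minus DERIV_add left_osc right_osc)
  moreover have "(\<lambda>x. - ((exp (- x) * left_exp_integral U x - primitive x) +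
      (- exp x * right_exp_integral U x - primitive x)) / 2) = (\<lambda>x. conv_deriv U x + primitive x)"
    by (auto simp: conv_deriv_def field_simps)
  ultimately show ?thesis by (simp add: conv_eq algebra_simps)
qed

lemma conv_isCont: "isCont (conv kernel U) x"
  using conv_has_deriv by (rule DERIV_isCont)

text \<open>The integrated second-order equation. It stays usable where nothing is known about the
  continuity of \<open>U\<close>.\<close>

lemma conv_deriv_diff:
  assumes "x \<le> y"
  shows "conv_deriv U y - conv_deriv U x = integral {x..y} (\<lambda>t. conv kernel U t - U t)"
proof -
  have "(conv kernel U has_integral
      (conv_deriv U y + primitive y - (conv_deriv U x + primitive x))) {x..y}"
    using assms conv_deriv_plus_primitive
    by (intro fundamental_theorem_of_calculus)
      (auto simp: has_real_derivative_iff_has_vector_derivative[symmetric]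
        intro: has_field_derivative_at_within)
  then have "((\<lambda>t. conv kernel U t - U t) has_integral
      (conv_deriv U y + primitive y - (conv_deriv U x + primitive x)) - integral {x..y} U) {x..y}"
    using integrable_U by (intro has_integral_diff) auto
  then show ?thesis using primitive_diff[OF assms] by (simp add: integral_unique)
qed

lemma primitive_isCont: "isCont primitive x"
proof -
  have *: "\<bar>primitive y - primitive x\<bar> \<le> M * (y - x)" if "x \<le> y" for x y
    using integral_norm_bound_integral[OF integrable_U integrable_const_ivl, of x y M] bndU that
    by (simp add: primitive_diff mult.commute)
  have "M-lipschitz_on UNIV primitive"
  proof (rule lipschitz_onI)
    show "dist (primitive x) (primitive y) \<le> M * dist x y" for x y
      using *[of x y] *[of y x] by (cases "x \<le> y") (auto simp: dist_real_def abs_minus_commute)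
  qed (rule M_nonneg)
  then have "continuous_on UNIV primitive" by (rule lipschitz_on_continuous_on)
  then show ?thesis by (simp add: continuous_on_eq_continuous_at)
qed

lemma conv_deriv_isCont: "isCont (conv_deriv U) x"
proof -
  have "isCont (\<lambda>x. (conv_deriv U x + primitive x) - primitive x) x"
    by (intro continuous_diff primitive_isCont DERIV_isCont[OF conv_deriv_plus_primitive])
  then show ?thesis by simp
qed

lemma primitive_deriv:
  assumes "isCont U x" shows "(primitive has_real_derivative U x) (at x)"
proof -
  have "((\<lambda>u. integral {x-1..u} U) has_vector_derivative U x) (at x within ({x-1..x+1} - {}))"
    using assms integrable_U
    by (intro integral_has_vector_derivative_continuous_at) (auto intro: continuous_at_imp_continuous_at_within)
  then have "((\<lambda>u. integral {x-1..u} U) has_real_derivative U x) (at x)"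
    by (simp add: has_real_derivative_iff_has_vector_derivative at_within_Icc_at)
  then have "((\<lambda>u. primitive (x - 1) + integral {x-1..u} U) has_real_derivative U x) (at x)"
    by (auto intro!: derivative_eq_intros)
  then show ?thesis
  proof (rule has_field_derivative_transform_within_open[where S = "{x-1<..<x+1}"])
    show "primitive (x - 1) + integral {x - 1..u} U = primitive u" if "u \<in> {x-1<..<x+1}" for u
      using primitive_diff[of "x-1" u] that by simp
  qed auto
qed

lemma conv_deriv_has_deriv:
  assumes "isCont U x"
  shows "(conv_deriv U has_real_derivative conv kernel U x - U x) (at x)"
  using DERIV_diff[OF conv_deriv_plus_primitive primitive_deriv[OF assms]] by simp

lemma right_bound: "\<bar>exp x * right_exp_integral U x\<bar> \<le> M"
proof -
  have e: "((\<lambda>t. M * exp (-1 * t)) has_integral M * (exp (-1 * x) / 1)) {x..}"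
    using has_integral_exp_minus_to_infinity[of 1 x] by (intro has_integral_mult_right) auto
  have "norm (right_exp_integral U x) \<le> integral {x..} (\<lambda>t. M * exp (-1 * t))"
    unfolding right_exp_integral_def
    using e right_int bndU
    by (intro integral_norm_bound_integral) (auto simp: abs_mult mult.commute integrable_on_def)
  then have "\<bar>right_exp_integral U x\<bar> \<le> M * exp (- x)" using integral_unique[OF e] by auto
  then have "exp x * \<bar>right_exp_integral U x\<bar> \<le> exp x * (M * exp (- x))" by simp
  also have "\<dots> = M" by (simp add: exp_minus)
  finally show ?thesis by (simp add: abs_mult)
qed

end

lemma bounded_source_reflect:
  assumes "bounded_source U M" shows "bounded_source (\<lambda>t. U (- t)) M"
proof
  have "(\<lambda>t. U (-1 *\<^sub>R t)) \<in> borel_measurable lebesgue"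
    using assms by (intro measurable_compose[OF lebesgue_measurable_scaling])
      (auto simp: bounded_source_def)
  then show "(\<lambda>t. U (- t)) \<in> borel_measurable lebesgue" by simp
qed (use assms in \<open>auto simp: bounded_source_def\<close>)

lemma conv_reflect: "conv kernel (\<lambda>t. U (- t)) x = conv kernel U (- x)"
proof -
  have "conv kernel (\<lambda>t. U (- t)) x = \<bar>-1\<bar> *\<^sub>R (LINT y|lebesgue. kernel (x - (0 + (-1) * y)) * U (- (0 + (-1) * y)))"
    unfolding conv_def by (rule lebesgue_integral_real_affine) auto
  also have "\<dots> = conv kernel U (- x)"
    unfolding conv_def kernel_def by (simp add: abs_minus_commute add.commute)
  finally show ?thesis .
qed

context bounded_source begin

lemma conv_deriv_reflect: "conv_deriv (\<lambda>t. U (- t)) x = - conv_deriv U (- x)"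
proof -
  interpret r: bounded_source "\<lambda>t. U (- t)" M
    by (rule bounded_source_reflect) unfold_locales
  have "((\<lambda>x. conv kernel U (- x)) has_real_derivative - conv_deriv U (- x)) (at x)"
    using conv_has_deriv[of "- x"] by (simp add: DERIV_mirror)
  then show ?thesis
    using r.conv_has_deriv[of x] by (simp add: conv_reflect[abs_def] DERIV_unique)
qed

lemma sum_reflect: "conv kernel U x + conv_deriv U x = exp x * right_exp_integral U x"
  by (simp add: conv_eq conv_deriv_def field_simps)

lemma diff_reflect: "conv kernel U x - conv_deriv U x = exp (- x) * left_exp_integral U x"
  by (simp add: conv_eq conv_deriv_def field_simps)

lemma conv_bounds: "\<bar>conv kernel U x\<bar> \<le> M" "\<bar>conv_deriv U x\<bar> \<le> M"
proof -
  interpret r: bounded_source "\<lambda>t. U (- t)" M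
    by (rule bounded_source_reflect) unfold_locales
  have 1: "\<bar>conv kernel U x + conv_deriv U x\<bar> \<le> M"
    using right_bound[of x] by (simp add: sum_reflect)
  have 2: "\<bar>conv kernel U x - conv_deriv U x\<bar> \<le> M"
    using r.right_bound[of "-x"] by (simp only: r.sum_reflect[symmetric] conv_deriv_reflect conv_reflect) simp
  show "\<bar>conv kernel U x\<bar> \<le> M" "\<bar>conv_deriv U x\<bar> \<le> M" using 1 2 by linarith+
qed

text \<open>\<open>V + V'\<close> and \<open>V - V'\<close> are the right and left exponential
  integrals of \<open>U\<close> up to positive factors, hence nonnegative. Decay of \<open>V\<close>
  therefore carries over to \<open>V'\<close>.\<close>

lemma conv_deriv_le_conv:
  assumes "\<And>t. 0 \<le> U t"
  shows "\<bar>conv_deriv U x\<bar> \<le> conv kernel U x"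
proof -
  have "0 \<le> right_exp_integral U x" "0 \<le> left_exp_integral U x"
    unfolding right_exp_integral_def left_exp_integral_def
    using assms by (auto intro!: Henstock_Kurzweil_Integration.integral_nonneg right_int left_int)
  then have "0 \<le> conv kernel U x + conv_deriv U x" "0 \<le> conv kernel U x - conv_deriv U x"
    by (simp_all add: sum_reflect diff_reflect)
  then show ?thesis by linarith
qed

text \<open>\<open>V' <= V\<close> makes \<open>exp (- z) * V z\<close> nonincreasing, while
  \<open>V\<close> is nonnegative.\<close>

lemma conv_zero_propagates:
  assumes "\<And>t. 0 \<le> U t" "conv kernel U x = 0" "x \<le> y"
  shows "conv kernel U y = 0"
proof -
  have "(\<lambda>z. exp (- z) * conv kernel U z) y \<le> (\<lambda>z. exp (- z) * conv kernel U z) x"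
  proof (rule DERIV_nonpos_imp_nonincreasing[OF assms(3)])
    fix z
    show "\<exists>D. ((\<lambda>z. exp (- z) * conv kernel U z) has_real_derivative D) (at z) \<and> D \<le> 0"
      using conv_deriv_le_conv[OF assms(1), of z]
      by (intro exI[of _ "exp (- z) * (conv_deriv U z - conv kernel U z)"] conjI)
        (auto intro!: derivative_eq_intros conv_has_deriv simp: algebra_simps)
  qed
  then have "exp (- y) * conv kernel U y \<le> 0" using assms(2) by simp
  then have "conv kernel U y \<le> 0" by (simp add: mult_le_0_iff)
  moreover have "0 \<le> conv kernel U y" using conv_deriv_le_conv[OF assms(1), of y] by linarith
  ultimately show ?thesis by linarith
qed

text \<open>The difference \<open>(D, E)\<close> of two bounded solutions satisfies \<open>D' = E\<close>, \<open>E' = D\<close>, so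
  \<open>(D \<plusminus> E) exp (\<minusplus> x)\<close> are constant and \<open>D = 0\<close>.\<close>

lemma conv_unique:
  assumes "finite P" and cV: "continuous_on UNIV V" and cW: "continuous_on UNIV W"
    and V: "\<And>x. x \<notin> P \<Longrightarrow> (V has_real_derivative W x) (at x)"
    and W: "\<And>x. x \<notin> P \<Longrightarrow> (W has_real_derivative V x - U x) (at x)"
    and cU: "\<And>x. x \<notin> P \<Longrightarrow> isCont U x"
    and bnd: "\<And>x. \<bar>V x\<bar> \<le> B" "\<And>x. \<bar>W x\<bar> \<le> B"
  shows "conv kernel U x = V x"
proof -
  define D where "D = (\<lambda>x. V x - conv kernel U x)"
  define E where "E = (\<lambda>x. W x - conv_deriv U x)"
  have cD: "continuous_on UNIV D" "continuous_on UNIV E"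
    unfolding D_def E_def using conv_isCont conv_deriv_isCont
    by (auto intro!: continuous_on_diff cV cW intro: continuous_at_imp_continuous_on)
  have dD: "(D has_real_derivative E x) (at x)" if "x \<notin> P" for x
    unfolding D_def E_def by (intro DERIV_diff V conv_has_deriv that)
  have dE: "(E has_real_derivative D x) (at x)" if "x \<notin> P" for x
    using DERIV_diff[OF W[OF that] conv_deriv_has_deriv[OF cU[OF that]]]
    unfolding D_def E_def by (simp add: algebra_simps)
  have "(\<lambda>x. exp (- x) * (D x + E x)) constant_on UNIV"
  proof (rule DERIV_zero_connected_constant_on[OF _ _ assms(1)])
    show "\<forall>x\<in>UNIV - P. ((\<lambda>x. exp (- x) * (D x + E x)) has_real_derivative 0) (at x)"
      by (auto intro!: derivative_eq_intros dD dE simp: algebra_simps)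
  qed (auto intro!: continuous_intros cD)
  then obtain c1 where "\<And>x. exp (- x) * (D x + E x) = c1" by (auto simp: constant_on_def)
  then have c1: "D x + E x = c1 * exp x" for x by (auto simp: exp_minus field_simps)
  have "(\<lambda>x. exp x * (D x - E x)) constant_on UNIV"
  proof (rule DERIV_zero_connected_constant_on[OF _ _ assms(1)])
    show "\<forall>x\<in>UNIV - P. ((\<lambda>x. exp x * (D x - E x)) has_real_derivative 0) (at x)"
      by (auto intro!: derivative_eq_intros dD dE simp: algebra_simps)
  qed (auto intro!: continuous_intros cD)
  then obtain c2 where "\<And>x. exp x * (D x - E x) = c2" by (auto simp: constant_on_def)
  then have c2: "D x - E x = c2 * exp (- x)" for x by (auto simp: exp_minus field_simps)
  have bD: "\<bar>D x\<bar> \<le> B + M" "\<bar>E x\<bar> \<le> B + M" for x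
    using bnd(1)[of x] bnd(2)[of x] conv_bounds[of x] unfolding D_def E_def by linarith+
  have zero: "c = 0" if "\<And>x. \<bar>c * exp x\<bar> \<le> K" for c K :: real
  proof (rule ccontr)
    assume "c \<noteq> 0"
    \<comment> \<open>At the point \<open>K / \<bar>c\<bar>\<close> the bound
      \<open>exp s >= 1 + s\<close> already gives a value of at least
      \<open>K + \<bar>c\<bar>\<close>.\<close>
    have "K / \<bar>c\<bar> + 1 \<le> exp (K / \<bar>c\<bar>)" by (metis add.commute exp_ge_add_one_self)
    then have "\<bar>c\<bar> * (K / \<bar>c\<bar> + 1) \<le> \<bar>c\<bar> * exp (K / \<bar>c\<bar>)" by (intro mult_left_mono) auto
    also have "\<dots> \<le> K" using that[of "K / \<bar>c\<bar>"] by (simp add: abs_mult)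
    finally have "\<bar>c\<bar> * (K / \<bar>c\<bar> + 1) \<le> K" .
    moreover have "\<bar>c\<bar> * (K / \<bar>c\<bar> + 1) = K + \<bar>c\<bar>"
      using \<open>c \<noteq> 0\<close> by (simp add: distrib_left)
    ultimately show False using \<open>c \<noteq> 0\<close> by simp
  qed
  have "\<bar>c1 * exp x\<bar> \<le> 2 * (B + M)" for x
    using abs_triangle_ineq[of "D x" "E x"] add_mono[OF bD[of x]] unfolding c1[symmetric] by simp
  then have "c1 = 0" by (rule zero)
  have "\<bar>c2 * exp x\<bar> \<le> 2 * (B + M)" for x
    using abs_triangle_ineq4[of "D (-x)" "E (-x)"] add_mono[OF bD[of "-x"]] c2[of "-x"] by simp
  then have "c2 = 0" by (rule zero)
  have "D x = 0" using c1[of x] c2[of x] \<open>c1 = 0\<close> \<open>c2 = 0\<close> by simp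
  then show ?thesis by (simp add: D_def)
qed

end

subsection \<open>Orbits in a potential well\<close>

lemma DERIV_inverse_strong:
  fixes f h :: "real \<Rightarrow> real"
  assumes "open S" "x \<in> S" "continuous_on S f" "\<And>z. z \<in> S \<Longrightarrow> h (f z) = z"
    and "(f has_real_derivative d) (at x)" "d \<noteq> 0"
  shows "(h has_real_derivative inverse d) (at (f x))"
  unfolding has_field_derivative_def
  by (rule has_derivative_inverse_strong[OF assms(1-4) assms(5)[unfolded has_field_derivative_def]])
    (use assms(6) in auto)

text \<open>\<open>F\<close> is the squared speed as a function of position. The condition
  \<open>F' m < 0\<close> makes \<open>m\<close> a nondegenerate turning point, reached in finite
  time. Nothing is required of \<open>F\<close> at \<open>l\<close>, which lets \<open>l\<close> be
  a rest state or an arbitrary cut-off.\<close>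

locale potential_well =
  fixes F F' :: "real \<Rightarrow> real" and l m :: real
  assumes lm: "l < m"
    and dF: "\<And>v. l < v \<Longrightarrow> v \<le> m \<Longrightarrow> (F has_real_derivative F' v) (at v)"
    and Fm: "F m = 0" and F'm: "F' m < 0"
    and Fpos: "\<And>v. l < v \<Longrightarrow> v < m \<Longrightarrow> 0 < F v"
begin

definition "R = sqrt (m - l)"

text \<open>With \<open>v = m - s\<^sup>2\<close> the travel time \<open>\<integral> dv / sqrt (F v)\<close> loses its singularity at the
  turning point \<open>v = m\<close>.\<close>

definition "q s = (if s = 0 then - F' m else F (m - s\<^sup>2) / s\<^sup>2)"
text \<open>The transformed integrand: with \<open>v = m - s^2\<close> one has
  \<open>\<bar>dv\<bar> = 2 * \<bar>s\<bar> * ds\<close> and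
  \<open>sqrt (F v) = \<bar>s\<bar> * sqrt (q s)\<close>.\<close>

definition "\<psi> s = 2 / sqrt (q s)"
definition "S r = integral {0..r} \<psi> - integral {r..0} \<psi>"
definition "I = {-R<..<R}"
definition "X = S ` I"
text \<open>The signed square root of the distance to the turning point as a function of time,
  negative before time 0 and positive after it. One formula thus covers the rising and the falling
  half of the orbit.\<close>

definition "r = the_inv_into I S"
definition "V x = m - (r x)\<^sup>2"
definition "Vd x = - 2 * r x / \<psi> (r x)"
definition "T v = S (sqrt (m - v))"

lemma R_pos: "0 < R" using lm by (simp add: R_def)

lemma I_arg: assumes "s \<in> I" shows "l < m - s\<^sup>2"
proof -
  have "\<bar>s\<bar> < R" using assms by (auto simp: I_def)
  then have "s\<^sup>2 < R\<^sup>2" by (metis abs_ge_zero power2_abs power_strict_mono zero_less_numeral)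
  then show ?thesis using lm by (simp add: R_def)
qed

lemma q_pos: "s \<in> I \<Longrightarrow> 0 < q s"
  using F'm Fpos I_arg by (auto simp: q_def)

lemma \<psi>_pos: "s \<in> I \<Longrightarrow> 0 < \<psi> s"
  using q_pos by (simp add: \<psi>_def)

lemma I_open: "open I" by (simp add: I_def)

lemma q_isCont: assumes "s \<in> I" shows "isCont q s"
proof (cases "s = 0")
  case True
  have "((\<lambda>h. (F (m + h) - F m) / h) \<longlongrightarrow> F' m) (at 0)"
    using dF[of m] lm by (simp add: DERIV_def)
  \<comment> \<open>\<open>- s^2\<close> tends to 0 through nonzero values, so the difference
    quotient of \<open>F\<close> at \<open>m\<close> may be evaluated along it.\<close>
  moreover have "filterlim (\<lambda>s::real. - s\<^sup>2) (at 0) (at 0)"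
  proof -
    have "((\<lambda>s::real. - s\<^sup>2) \<longlongrightarrow> - 0\<^sup>2) (at 0)" by (intro tendsto_intros)
    then show ?thesis by (auto simp: filterlim_at eventually_at_filter)
  qed
  ultimately have "((\<lambda>s. (F (m + - s\<^sup>2) - F m) / (- s\<^sup>2)) \<longlongrightarrow> F' m) (at 0)"
    by (rule filterlim_compose)
  then have "((\<lambda>s. - ((F (m + - s\<^sup>2) - F m) / (- s\<^sup>2))) \<longlongrightarrow> - F' m) (at 0)"
    by (rule tendsto_minus)
  then have "(q \<longlongrightarrow> - F' m) (at 0)"
    by (rule tendsto_cong[THEN iffD1, rotated]) (simp add: eventually_at_filter q_def Fm)
  then show ?thesis using True by (simp add: isCont_def q_def)
next
  case False
  have "eventually (\<lambda>z. z \<noteq> 0) (nhds s)"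
    using False by (rule t1_space_nhds)
  then have "eventually (\<lambda>z. q z = F (m - z\<^sup>2) / z\<^sup>2) (nhds s)"
    by eventually_elim (simp add: q_def)
  moreover have "isCont (\<lambda>z. F (m - z\<^sup>2) / z\<^sup>2) s"
  proof -
    have "isCont F (m - s\<^sup>2)" using dF[of "m - s\<^sup>2"] I_arg[OF assms] by (auto intro: DERIV_isCont)
    then have "isCont (\<lambda>z. F (m - z\<^sup>2)) s"
      by (rule isCont_o2[where g = F, rotated]) auto
    then show ?thesis using False by (auto intro!: continuous_intros)
  qed
  ultimately show ?thesis by (rule isCont_cong[THEN iffD2])
qed

lemma \<psi>_isCont: "s \<in> I \<Longrightarrow> isCont \<psi> s"
  unfolding \<psi>_def[abs_def] using q_pos[of s]
  by (intro continuous_divide continuous_const isCont_real_sqrt continuous_real_sqrt q_isCont) auto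

lemma \<psi>_even: "\<psi> (- s) = \<psi> s" by (simp add: \<psi>_def q_def)

lemma S_odd: "S (- s) = - S s"
  using Henstock_Kurzweil_Integration.integral_reflect_real[of 0 s \<psi>]
    Henstock_Kurzweil_Integration.integral_reflect_real[of s 0 \<psi>]
  by (simp add: S_def \<psi>_even)

lemma S_0: "S 0 = 0" by (simp add: S_def)

lemma I_0: "0 \<in> I" using R_pos by (simp add: I_def)

lemma dS: assumes "s \<in> I" shows "(S has_real_derivative \<psi> s) (at s)"
proof -
  have "\<bar>s\<bar> < R" using assms by (auto simp: I_def)
  then obtain b where b: "\<bar>s\<bar> < b" "b < R" using dense by blast
  have c: "continuous_on {-b..b} \<psi>"
    using b by (auto intro!: continuous_at_imp_continuous_on \<psi>_isCont simp: I_def)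
  have int: "\<psi> integrable_on {x..y}" if "-b \<le> x" "y \<le> b" for x y
    using that by (intro integrable_continuous_interval continuous_on_subset[OF c]) auto
  have "((\<lambda>x. integral {-b..x} \<psi>) has_real_derivative \<psi> s) (at s within {-b..b})"
    using b by (intro integral_has_real_derivative c) auto
  then have "((\<lambda>x. integral {-b..x} \<psi>) has_real_derivative \<psi> s) (at s)"
    using b by (simp add: at_within_Icc_at)
  then have "((\<lambda>x. integral {-b..x} \<psi> - integral {-b..0} \<psi>) has_real_derivative \<psi> s) (at s)"
    by (auto intro!: derivative_eq_intros)
  then show ?thesis
  proof (rule has_field_derivative_transform_within_open[where S = "{-b<..<b}"])
    fix x assume x: "x \<in> {-b<..<b}"
    have deg: "integral {s..t} \<psi> = 0" if "t \<le> s" for s t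
      using that by (cases "s = t") auto
    show "integral {-b..x} \<psi> - integral {-b..0} \<psi> = S x"
    proof (cases "x \<ge> 0")
      case True
      then show ?thesis
        using Henstock_Kurzweil_Integration.integral_combine[of "-b" 0 x \<psi>] int[of "-b" x] x
        by (simp add: S_def deg)
    next
      case False
      then show ?thesis
        using Henstock_Kurzweil_Integration.integral_combine[of "-b" x 0 \<psi>] int[of "-b" 0] x
        by (simp add: S_def deg)
    qed
  qed (use b in auto)
qed

lemma S_less: "s \<in> I \<Longrightarrow> t \<in> I \<Longrightarrow> s < t \<Longrightarrow> S s < S t"
  by (rule DERIV_pos_imp_increasing) (auto simp: I_def intro!: exI dS \<psi>_pos)

lemma S_inj: "inj_on S I"
  by (rule inj_onI) (metis S_less less_irrefl linorder_neqE_linordered_idom)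

lemma S_cont: "continuous_on I S"
  by (auto intro!: continuous_at_imp_continuous_on intro: DERIV_isCont dS)

lemma r_S: "s \<in> I \<Longrightarrow> r (S s) = s"
  unfolding r_def by (rule the_inv_into_f_f[OF S_inj])

lemma r_I: "x \<in> X \<Longrightarrow> r x \<in> I"
  unfolding r_def X_def using the_inv_into_into[OF S_inj] by blast

lemma S_r: "x \<in> X \<Longrightarrow> S (r x) = x"
  unfolding r_def X_def by (rule f_the_inv_into_f[OF S_inj])

lemma S_X: "s \<in> I \<Longrightarrow> S s \<in> X" by (simp add: X_def)

lemma I_minus: "s \<in> I \<Longrightarrow> - s \<in> I" by (auto simp: I_def)

lemma X_minus: "x \<in> X \<Longrightarrow> - x \<in> X"
  unfolding X_def using I_minus S_odd[symmetric] by (auto intro!: image_eqI)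

lemma X_0: "0 \<in> X" using S_X[OF I_0] S_0 by simp

lemma X_open: "open X"
  unfolding X_def
  using invariance_of_domain[of I S] S_cont I_open S_inj by blast

lemma X_convex: assumes "x \<in> X" "\<bar>y\<bar> \<le> \<bar>x\<bar>" shows "y \<in> X"
proof -
  have "connected X" unfolding X_def
    by (rule connected_continuous_image[OF S_cont]) (simp add: I_def)
  moreover have "\<bar>x\<bar> \<in> X" "- \<bar>x\<bar> \<in> X" using assms X_minus by (auto simp: abs_if)
  ultimately show ?thesis using assms(2) unfolding connected_iff_interval by (metis abs_le_D1 abs_le_D2 minus_le_iff)
qed

lemma r_odd: "x \<in> X \<Longrightarrow> r (- x) = - r x"
  by (metis I_minus S_odd S_r r_I r_S)

lemma r_0: "r 0 = 0" using r_S[OF I_0] S_0 by simp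

lemma r_pos: assumes "x \<in> X" "0 < x" shows "0 < r x"
proof (rule ccontr)
  assume "\<not> 0 < r x"
  then have "r x < 0 \<or> r x = 0" by linarith
  then have "S (r x) \<le> 0" using S_less[OF r_I[OF assms(1)] I_0] S_0 by auto
  then show False using S_r assms by simp
qed

lemma r_neg: assumes "x \<in> X" "x < 0" shows "r x < 0"
  using r_pos[OF X_minus[OF assms(1)]] assms r_odd by simp

lemma dr: assumes "x \<in> X" shows "(r has_real_derivative inverse (\<psi> (r x))) (at x)"
  using DERIV_inverse_strong[OF I_open r_I[OF assms] S_cont r_S dS[OF r_I[OF assms]]]
    \<psi>_pos[OF r_I[OF assms]] S_r[OF assms] by simp

lemma V_range: assumes "x \<in> X" shows "l < V x" "V x \<le> m"
  using I_arg[OF r_I[OF assms]] by (auto simp: V_def)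

lemma V_even: "x \<in> X \<Longrightarrow> V (- x) = V x" by (simp add: V_def r_odd)

lemma Vd_odd: "x \<in> X \<Longrightarrow> Vd (- x) = - Vd x" by (simp add: Vd_def r_odd \<psi>_even)

lemma V_0: "V 0 = m" by (simp add: V_def r_0)

lemma V_less: assumes "x \<in> X" "x \<noteq> 0" shows "V x < m"
  using r_pos[OF assms(1)] r_neg[OF assms(1)] assms(2)
  by (cases "0 < x") (auto simp: V_def)

lemma dV: assumes "x \<in> X" shows "(V has_real_derivative Vd x) (at x)"
  unfolding V_def[abs_def] Vd_def
  by (rule derivative_eq_intros dr assms refl)+ (simp add: field_simps)

lemma \<psi>_nz: assumes "s \<noteq> 0" shows "\<psi> s = 2 * \<bar>s\<bar> / sqrt (F (m - s\<^sup>2))"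
  using assms by (simp add: \<psi>_def q_def real_sqrt_divide)

lemma Vd_pos_arg: assumes "x \<in> X" "0 < x" shows "Vd x = - sqrt (F (V x))"
  using r_pos[OF assms] by (simp add: Vd_def \<psi>_nz V_def)

lemma Vd_neg_arg: assumes "x \<in> X" "x < 0" shows "Vd x = sqrt (F (V x))"
  using r_neg[OF assms] by (simp add: Vd_def \<psi>_nz V_def)

lemma Vd_0: "Vd 0 = 0" by (simp add: Vd_def r_0)

lemma F_V_nonneg: "x \<in> X \<Longrightarrow> 0 \<le> F (V x)"
  using Fpos[of "V x"] V_range[of x] Fm by (cases "V x = m") auto

lemma Vd_sq: assumes "x \<in> X" shows "(Vd x)\<^sup>2 = F (V x)"
  using Vd_pos_arg[OF assms] Vd_neg_arg[OF assms] F_V_nonneg[OF assms] Vd_0 V_0 Fm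
  by (cases x "0::real" rule: linorder_cases) auto

text \<open>Away from the turning point the speed \<open>sqrt (F (V x))\<close> can be
  differentiated directly. At time 0 the square root is singular, and the difference quotient of
  \<open>- 2 * r / \<psi> r\<close> is used; its limit is
  \<open>- 2 / (\<psi> 0)^2 = F' m / 2\<close>.\<close>

lemma dVd: assumes "x \<in> X" shows "(Vd has_real_derivative F' (V x) / 2) (at x)"
proof (cases "x = 0")
  case True
  have *: "((\<lambda>y. (r y - r 0) / (y - 0)) \<longlongrightarrow> inverse (\<psi> (r 0))) (at 0)"
    using dr[OF X_0] unfolding has_field_derivative_iff by simp
  have "isCont (\<lambda>y. \<psi> (r y)) 0"
    by (rule isCont_o2[OF DERIV_isCont[OF dr[OF X_0]]]) (simp add: r_0 \<psi>_isCont I_0)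
  then have "((\<lambda>y. - 2 / \<psi> (r y)) \<longlongrightarrow> - 2 / \<psi> (r 0)) (at 0)"
    using \<psi>_pos[OF I_0] unfolding isCont_def by (intro tendsto_intros) (auto simp: r_0)
  from tendsto_mult[OF * this]
  have lim: "((\<lambda>y. (Vd y - Vd 0) / (y - 0)) \<longlongrightarrow> inverse (\<psi> 0) * (- 2 / \<psi> 0)) (at 0)"
    by (simp add: r_0 Vd_0) (simp add: Vd_def mult.commute)
  have "inverse (\<psi> 0) * (- 2 / \<psi> 0) = F' m / 2"
    using F'm by (simp add: \<psi>_def q_def field_simps)
  then show ?thesis
    using lim unfolding has_field_derivative_iff True V_0 by (simp only:)
next
  case False
  have F0: "0 < F (V x)" using Fpos V_range[OF assms] V_less[OF assms False] by auto
  have d: "((\<lambda>y. F (V y)) has_real_derivative F' (V x) * Vd x) (at x)"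
    by (rule DERIV_chain2[OF dF dV[OF assms]]) (use V_range[OF assms] in auto)
  have d2: "((\<lambda>y. sqrt (F (V y))) has_real_derivative F' (V x) * Vd x / (2 * sqrt (F (V x)))) (at x)"
    using F0 by (auto intro!: derivative_eq_intros d simp: field_simps)
  show ?thesis
  proof (cases "x > 0")
    case True
    have "((\<lambda>y. - sqrt (F (V y))) has_real_derivative F' (V x) / 2) (at x)"
      using DERIV_minus[OF d2] Vd_pos_arg[OF assms True] F0 by (simp add: field_simps)
    then show ?thesis
      by (rule has_field_derivative_transform_within_open[where S = "X \<inter> {0<..}"])
        (use True assms X_open Vd_pos_arg in auto)
  next
    case neg: False
    have "((\<lambda>y. sqrt (F (V y))) has_real_derivative F' (V x) / 2) (at x)"
      using d2 Vd_neg_arg[OF assms] neg False F0 by (simp add: field_simps)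
    then show ?thesis
      by (rule has_field_derivative_transform_within_open[where S = "X \<inter> {..<0}"])
        (use neg False assms X_open Vd_neg_arg in auto)
  qed
qed

lemma sqrt_I: assumes "l < v" "v \<le> m" shows "sqrt (m - v) \<in> I"
proof -
  have "sqrt (m - v) < R" "0 \<le> sqrt (m - v)" using assms by (simp_all add: R_def)
  then have "- R < sqrt (m - v)" using R_pos by linarith
  with \<open>sqrt (m - v) < R\<close> show ?thesis by (simp add: I_def)
qed

lemma T_X: "l < v \<Longrightarrow> v \<le> m \<Longrightarrow> T v \<in> X"
  unfolding T_def by (intro S_X sqrt_I)

lemma V_T: "l < v \<Longrightarrow> v \<le> m \<Longrightarrow> V (T v) = v"
  unfolding V_def T_def using sqrt_I by (simp add: r_S)

lemma T_m: "T m = 0" by (simp add: T_def S_0)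

lemma T_less: "l < v \<Longrightarrow> v < w \<Longrightarrow> w \<le> m \<Longrightarrow> T w < T v"
  unfolding T_def by (intro S_less sqrt_I) auto

lemma T_nonneg: "l < v \<Longrightarrow> v \<le> m \<Longrightarrow> 0 \<le> T v"
  using T_less[of v m] T_m by (cases "v = m") auto

lemma T_V: assumes "x \<in> X" shows "T (V x) = \<bar>x\<bar>"
proof (cases "x \<ge> 0")
  case True
  then have "r x \<ge> 0" using r_pos[OF assms] r_0 by (cases "x = 0") auto
  then show ?thesis using True S_r[OF assms] by (simp add: T_def V_def)
next
  case False
  then show ?thesis using r_neg[OF assms] S_r[OF assms] S_odd[of "r x"] by (simp add: T_def V_def)
qed

lemma dT: assumes "l < v" "v < m" shows "(T has_real_derivative - 1 / sqrt (F v)) (at v)"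
proof -
  have "(T has_real_derivative \<psi> (sqrt (m - v)) * (- 1 / (2 * sqrt (m - v)))) (at v)"
    unfolding T_def[abs_def]
    by (rule DERIV_chain2[where f = S and g = "\<lambda>v. sqrt (m - v)", OF dS[OF sqrt_I]])
      (use assms in \<open>auto intro!: derivative_eq_intros simp: field_simps\<close>)
  moreover have "\<psi> (sqrt (m - v)) * (- 1 / (2 * sqrt (m - v))) = - 1 / sqrt (F v)"
    using assms by (simp add: \<psi>_nz)
  ultimately show ?thesis by simp
qed

lemma T_cont: "continuous_on {l<..m} T"
  unfolding T_def[abs_def]
  by (rule continuous_on_compose2[OF S_cont]) (auto intro!: continuous_intros sqrt_I)

text \<open>The true integrand is unbounded at \<open>m\<close>, where the formula takes the value
  \<open>1 / 0 = 0\<close>. The fundamental theorem needs the derivative of \<open>T\<close> only in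
  the interior, with continuity of \<open>T\<close> up to \<open>m\<close>.\<close>

lemma travel_time:
  assumes "l < v" "v \<le> m"
  shows "((\<lambda>v. 1 / sqrt (F v)) has_integral T v) {v..m}"
proof -
  have "((\<lambda>v. 1 / sqrt (F v)) has_integral - T m - (- T v)) {v..m}"
  proof (rule fundamental_theorem_of_calculus_interior[OF assms(2)])
    show "continuous_on {v..m} (\<lambda>v. - T v)"
      using assms by (intro continuous_on_minus continuous_on_subset[OF T_cont]) auto
    show "((\<lambda>v. - T v) has_vector_derivative 1 / sqrt (F x)) (at x)" if "x \<in> {v<..<m}" for x
      using DERIV_minus[OF dT[of x]] that assms
      by (simp add: has_real_derivative_iff_has_vector_derivative)
  qed
  then show ?thesis by (simp add: T_m)
qed

text \<open>Separation of variables, in place of a uniqueness theorem for the differential equation.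
  The ends of the interval may sit at \<open>m\<close>, so the argument can start from a turning
  point.\<close>

lemma T_along:
  assumes "c \<le> b" "continuous_on {c..b} W"
    and W: "\<And>x. c < x \<Longrightarrow> x < b \<Longrightarrow> (W has_real_derivative - sqrt (F (W x))) (at x)"
    and rng: "\<And>x. c < x \<Longrightarrow> x < b \<Longrightarrow> l < W x \<and> W x < m"
    and ends: "l < W c" "W c \<le> m" "l < W b" "W b \<le> m"
  shows "T (W b) = T (W c) + (b - c)"
proof (cases "c = b")
  case False
  then have cb: "c < b" using assms(1) by simp
  have rng': "W x \<in> {l<..m}" if "x \<in> {c..b}" for x
    using that rng[of x] ends by (cases "x = c"; cases "x = b") auto
  have "(\<lambda>x. T (W x) - x) b = (\<lambda>x. T (W x) - x) c"
  proof (rule DERIV_isconst_end[OF cb])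
    show "continuous_on {c..b} (\<lambda>x. T (W x) - x)"
      by (intro continuous_on_diff continuous_on_compose2[OF T_cont] assms continuous_on_id)
        (use rng' in auto)
    fix x assume x: "c < x" "x < b"
    have F0: "0 < F (W x)" using rng[OF x] Fpos by auto
    have "((\<lambda>x. T (W x)) has_real_derivative - 1 / sqrt (F (W x)) * - sqrt (F (W x))) (at x)"
      by (rule DERIV_chain2[OF dT W[OF x]]) (use rng[OF x] in auto)
    then show "((\<lambda>x. T (W x) - x) has_real_derivative 0) (at x)"
      using F0 by (auto intro!: derivative_eq_intros)
  qed
  then show ?thesis by simp
qed simp

end

subsection \<open>Functions on the real line\<close>

lemma tendsto_even_at_bot:
  fixes u v :: "real \<Rightarrow> real"
  assumes "(u \<longlongrightarrow> L) at_top" "\<And>x. v (- x) = u x" shows "(v \<longlongrightarrow> L) at_bot"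
  using assms by (simp add: filterlim_at_bot_mirror)

lemma abs_tendsto:
  fixes u :: "real \<Rightarrow> real" and c :: real
  assumes "(u \<longlongrightarrow> L) at_top"
  shows "((\<lambda>x. u (\<bar>x\<bar> - c)) \<longlongrightarrow> L) at_top" "((\<lambda>x. u (\<bar>x\<bar> - c)) \<longlongrightarrow> L) at_bot"
proof -
  have 1: "filterlim (\<lambda>x. - c + x) at_top at_top"
    by (rule filterlim_tendsto_add_at_top[OF tendsto_const filterlim_ident])
  have 2: "filterlim (\<lambda>x. \<bar>x\<bar>) at_top (at_top :: real filter)"
    by (rule filterlim_at_top_mono[OF filterlim_ident]) (auto intro: always_eventually)
  have "filterlim (\<lambda>x. \<bar>x\<bar> - c) at_top at_top"
    using filterlim_compose[OF 1 2] by simp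
  from filterlim_compose[OF assms this]
  show "((\<lambda>x. u (\<bar>x\<bar> - c)) \<longlongrightarrow> L) at_top" .
  then show "((\<lambda>x. u (\<bar>x\<bar> - c)) \<longlongrightarrow> L) at_bot" by (simp add: filterlim_at_bot_mirror)
qed

lemma positive_attains_max:
  fixes W :: "real \<Rightarrow> real"
  assumes "continuous_on UNIV W" "\<And>x. 0 < W x" "(W \<longlongrightarrow> 0) at_top" "(W \<longlongrightarrow> 0) at_bot"
  obtains c where "\<And>x. W x \<le> W c"
proof -
  have "\<forall>\<^sub>F x in at_top. W x < W 0" using assms(2,3) by (rule_tac order_tendstoD(2)) auto
  then obtain K1 where K1: "\<And>x. K1 \<le> x \<Longrightarrow> W x < W 0" by (auto simp: eventually_at_top_linorder)
  have "\<forall>\<^sub>F x in at_bot. W x < W 0" using assms(2,4) by (rule_tac order_tendstoD(2)) auto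
  then obtain K2 where K2: "\<And>x. x \<le> K2 \<Longrightarrow> W x < W 0" by (auto simp: eventually_at_bot_linorder)
  have 0: "0 \<in> {K2..K1}" using K1[of 0] K2[of 0] by force
  obtain c where c: "c \<in> {K2..K1}" "\<And>x. x \<in> {K2..K1} \<Longrightarrow> W x \<le> W c"
    using continuous_attains_sup[of "{K2..K1}" W] 0 assms(1)
    by (metis compact_Icc continuous_on_subset empty_iff top_greatest)
  show ?thesis
  proof
    fix x show "W x \<le> W c"
      using c(2)[of x] c(2)[OF 0] K1[of x] K2[of x] by (cases "x \<in> {K2..K1}") force+
  qed
qed

text \<open>\<open>G\<close> is differentiated only within \<open>S\<close>, since orbits may touch
  the end of a branch domain; the chain rule goes through the image of the orbit. The equation is
  required only between \<open>p\<close> and \<open>q\<close>, so either may be a jump.\<close>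

lemma energy_const:
  fixes G h W W' :: "real \<Rightarrow> real"
  assumes G: "\<forall>v\<in>S. (G has_real_derivative h v - v) (at v within S)"
    and W: "\<And>x. x \<in> {p<..<q} \<Longrightarrow> (W has_real_derivative W' x) (at x)"
    and W': "\<And>x. x \<in> {p<..<q} \<Longrightarrow> (W' has_real_derivative W x - h (W x)) (at x)"
    and cont: "continuous_on {p..q} W" "continuous_on {p..q} W'"
    and rng: "\<And>x. x \<in> {p..q} \<Longrightarrow> W x \<in> S" and "p \<le> q"
  shows "(W' q)\<^sup>2 / 2 + G (W q) = (W' p)\<^sup>2 / 2 + G (W p)"
proof (cases "p = q")
  case False
  have cG: "continuous_on S G" by (rule DERIV_continuous_on) (rule G[rule_format])
  from False have "p < q" using \<open>p \<le> q\<close> by simp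
  then show ?thesis
  proof (rule DERIV_isconst_end[where f = "\<lambda>x. (W' x)\<^sup>2 / 2 + G (W x)"])
    show "continuous_on {p..q} (\<lambda>x. (W' x)\<^sup>2 / 2 + G (W x))"
      by (intro continuous_intros cont continuous_on_compose2[OF cG]) (use rng in auto)
    fix x assume x: "p < x" "x < q"
    have "((\<lambda>x. G (W x)) has_real_derivative (h (W x) - W x) * W' x) (at x within {p<..<q})"
    proof (rule DERIV_image_chain[of G _ W, unfolded o_def])
      show "(W has_real_derivative W' x) (at x within {p<..<q})"
        using W x by (auto intro: has_field_derivative_at_within)
      have "(G has_real_derivative h (W x) - W x) (at (W x) within S)"
        using rng[of x] x by (intro G[rule_format]) auto
      then show "(G has_real_derivative h (W x) - W x) (at (W x) within W ` {p<..<q})"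
        by (rule DERIV_subset) (intro image_subsetI rng, auto)
    qed
    then have 1: "((\<lambda>x. G (W x)) has_real_derivative (h (W x) - W x) * W' x) (at x)"
      using x at_within_open[of x "{p<..<q}"] by simp
    have w': "(W' has_real_derivative W x - h (W x)) (at x)" using W' x by simp
    have 2: "((\<lambda>x. (W' x)\<^sup>2 / 2) has_real_derivative W' x * (W x - h (W x))) (at x)"
      by (auto intro!: derivative_eq_intros w')
    show "((\<lambda>x. (W' x)\<^sup>2 / 2 + G (W x)) has_real_derivative 0) (at x)"
      using DERIV_add[OF 2 1] by (simp add: algebra_simps)
  qed
qed simp

text \<open>The discontinuities of an even function are symmetric. A second pair besides
  \<open>z\<close> and \<open>- z\<close> would give at least three points, even if 0 is among
  them.\<close>

lemma even_discontinuities: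
  fixes U :: "real \<Rightarrow> real"
  assumes "even_fun U" "finite P" "card P \<le> 2" "\<And>x. x \<notin> P \<Longrightarrow> isCont U x"
  obtains p where "0 \<le> p" "\<And>x. x \<notin> {-p, p} \<Longrightarrow> isCont U x"
proof (cases "\<exists>z. \<not> isCont U z")
  case True
  then obtain z where z: "\<not> isCont U z" by blast
  have mirror: "isCont U x" if "isCont U (- x)" for x
  proof -
    have "isCont (\<lambda>t. U (- t)) x"
      by (rule isCont_o2[where g = U]) (use that in auto)
    then show ?thesis using assms(1) by (simp add: even_fun_def)
  qed
  have "isCont U x" if x: "x \<notin> {-\<bar>z\<bar>, \<bar>z\<bar>}" for x
  proof (rule ccontr)
    assume nx: "\<not> isCont U x"
    have "{z, - z, x, - x} \<subseteq> P" using assms(4) mirror z nx by (metis empty_subsetI insert_subset minus_minus)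
    then have "card {z, - z, x, - x} \<le> 2" using assms(2,3) card_mono le_trans by metis
    moreover have "x \<noteq> z" "x \<noteq> - z" using x by (auto simp: abs_if split: if_splits)
    ultimately show False by (cases "z = 0"; cases "x = 0") (auto simp: card_insert_if split: if_splits)
  qed
  then show ?thesis using that[of "\<bar>z\<bar>"] by simp
next
  case False
  then show ?thesis using that[of 0] by simp
qed

lemma has_jump_mirror:
  assumes "even_fun u" "has_jump_at u p" shows "has_jump_at u (- p)"
proof -
  obtain l r where "(u \<longlongrightarrow> l) (at_left p)" "(u \<longlongrightarrow> r) (at_right p)" "l \<noteq> r"
    using assms(2) unfolding has_jump_at_def by blast
  moreover have "(\<lambda>x. u (- x)) = u" using assms(1) by (auto simp: even_fun_def)
  ultimately have "(u \<longlongrightarrow> l) (at_right (- p))" "(u \<longlongrightarrow> r) (at_left (- p))"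
    by (simp_all add: at_left_minus[of p] at_right_minus[of p] filterlim_filtermap)
  then show ?thesis using \<open>l \<noteq> r\<close> unfolding has_jump_at_def by metis
qed

text \<open>In the application \<open>D = V'' = V - U\<close>, and \<open>U \<le> C V''\<close> near infinity because \<open>g' 0 > 1\<close>.\<close>

lemma square_integrable_tail:
  fixes U D W :: "real \<Rightarrow> real"
  assumes mU: "U \<in> borel_measurable borel" and mD: "D \<in> borel_measurable borel"
    and even: "even_fun U" and U: "\<And>x. 0 \<le> U x" "\<And>x. U x \<le> M"
    and "0 \<le> b" "0 < C" and W: "\<And>x. b \<le> x \<Longrightarrow> (W has_real_derivative D x) (at x)"
    and UD: "\<And>x. b \<le> x \<Longrightarrow> U x \<le> C * D x" and lim: "(W \<longlongrightarrow> 0) at_top"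
  shows "integrable lebesgue (\<lambda>x. (U x)\<^sup>2)"
proof -
  \<comment> \<open>The only source of integrability: \<open>D\<close> is nonnegative beyond
    \<open>b\<close> and integrates there to \<open>- W b\<close>. The square is then dominated by
    \<open>U^2 <= M * U <= M * C * D\<close>, mirrored to the left, plus a bounded middle
    part.\<close>
  define h where "h = (\<lambda>x. D x * indicator {b..} x)"
  have D: "0 \<le> D x" if "b \<le> x" for x
    using order_trans[OF U(1) UD[OF that]] \<open>0 < C\<close> by (simp add: zero_le_mult_iff)
  have "(\<integral>\<^sup>+x. ennreal (D x) * indicator {b..} x \<partial>lborel) = 0 - W b"
    by (rule nn_integral_FTC_atLeast[OF mD W D lim])
  also have "(\<integral>\<^sup>+x. ennreal (D x) * indicator {b..} x \<partial>lborel) = (\<integral>\<^sup>+x. ennreal (h x) \<partial>lborel)"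
    by (intro nn_integral_cong) (auto simp: h_def indicator_def)
  finally have h: "integrable lborel h"
    using D mD by (intro integrableI_nonneg) (auto simp: h_def indicator_def)
  have h': "integrable lborel (\<lambda>x. h (0 + (-1) * x))"
    by (rule lborel_integrable_real_affine[OF h]) simp
  have i: "integrable lborel (\<lambda>x. M\<^sup>2 * indicator {-b..b} x)"
    by (intro integrable_mult_right integrable_real_indicator) (auto simp: emeasure_lborel_Icc_eq)
  have "integrable lborel (\<lambda>x. (M * C) * (h x + h (0 + (-1) * x)) + M\<^sup>2 * indicator {-b..b} x)"
    by (intro Bochner_Integration.integrable_add integrable_mult_right h h' i)
  then have "integrable lborel (\<lambda>x. (U x)\<^sup>2)"
  proof (rule Bochner_Integration.integrable_bound)
    have M: "0 \<le> M" using U[of 0] by linarith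
    have tail: "(U x)\<^sup>2 \<le> (M * C) * h x" if "b \<le> x" for x
    proof -
      have "(U x)\<^sup>2 \<le> M * U x" using U[of x] by (simp add: power2_eq_square mult_right_mono)
      also have "\<dots> \<le> M * (C * D x)" using UD[OF that] M by (intro mult_left_mono)
      finally show ?thesis using that by (simp add: h_def)
    qed
    have hn: "0 \<le> h x" for x using D by (auto simp: h_def indicator_def)
    have "(U x)\<^sup>2 \<le> (M * C) * (h x + h (- x)) + M\<^sup>2 * indicator {-b..b} x" for x
    proof -
      have nn: "0 \<le> M * C * h x" "0 \<le> M * C * h (- x)" using M \<open>0 < C\<close> hn by auto
      consider "b \<le> x" | "b \<le> - x" | "x \<in> {-b..b}" by fastforce
      then show ?thesis
      proof cases
        case 1
        then show ?thesis using tail[of x] nn by (auto simp: distrib_left indicator_def intro: add_increasing2)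
      next
        case 2
        then show ?thesis using tail[of "-x"] nn even
          by (auto simp: distrib_left indicator_def even_fun_def intro: add_increasing2)
      next
        case 3
        have "(U x)\<^sup>2 \<le> M\<^sup>2" using U[of x] by (intro power_mono)
        then show ?thesis using 3 nn by (simp add: distrib_left)
      qed
    qed
    then show "AE x in lborel. norm ((U x)\<^sup>2) \<le>
        norm ((M * C) * (h x + h (0 + (-1) * x)) + M\<^sup>2 * indicator {-b..b} x)"
      by (intro AE_I2) (auto intro: order_trans[OF _ abs_ge_self])
  qed (use mU in simp)
  then show ?thesis using mU by (subst integrable_completion) auto
qed

lemma AE_off_finite:
  fixes P :: "real set"
  assumes "finite P" "\<And>x. x \<notin> P \<Longrightarrow> Q x"
  shows "AE x in lebesgue. Q x"
proof -
  have "P \<in> null_sets lebesgue"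
    using negligible_finite[OF assms(1)] by (simp add: negligible_iff_null_sets)
  then have "AE x in lebesgue. x \<notin> P" by (rule AE_not_in)
  then show ?thesis by eventually_elim (rule assms(2))
qed

subsection \<open>The bistable nonlinearity and its homoclinic orbit\<close>

text \<open>Positivity of \<open>g'\<close> is required only inside the branch: in the application
  one end is a critical point of \<open>g\<close>, where the inverse has a vertical tangent.\<close>

locale increasing_branch =
  fixes g g' :: "real \<Rightarrow> real" and p q :: real
  assumes pq: "p < q"
    and dg: "\<And>u. (g has_real_derivative g' u) (at u)"
    and g'_pos: "\<And>u. p < u \<Longrightarrow> u < q \<Longrightarrow> 0 < g' u"
begin

abbreviation "h \<equiv> the_inv_into {p..q} g"

lemma g_cont: "continuous_on S g"
  by (rule DERIV_continuous_on) (rule has_field_derivative_at_within[OF dg])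

lemma g_less: "p \<le> u \<Longrightarrow> u < w \<Longrightarrow> w \<le> q \<Longrightarrow> g u < g w"
  by (rule DERIV_pos_imp_increasing_open[of u w g])
    (use dg g'_pos g_cont in \<open>force+\<close>)

lemma g_le: "p \<le> u \<Longrightarrow> u \<le> w \<Longrightarrow> w \<le> q \<Longrightarrow> g u \<le> g w"
  using g_less[of u w] by (cases "u = w") auto

lemma g_inj: "inj_on g {p..q}"
  by (rule linorder_inj_onI) (use g_less in force)+

lemma g_image: "g ` {p..q} = {g p..g q}"
proof
  show "g ` {p..q} \<subseteq> {g p..g q}" using g_le by auto
  show "{g p..g q} \<subseteq> g ` {p..q}"
  proof
    fix v assume "v \<in> {g p..g q}"
    then show "v \<in> g ` {p..q}"
      using IVT'[of g p v q] pq g_cont by force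
  qed
qed

lemma h_g: "p \<le> u \<Longrightarrow> u \<le> q \<Longrightarrow> h (g u) = u"
  by (rule the_inv_into_f_f[OF g_inj]) auto

lemma g_h: "g p \<le> v \<Longrightarrow> v \<le> g q \<Longrightarrow> g (h v) = v"
  by (rule f_the_inv_into_f[OF g_inj]) (auto simp: g_image)

lemma h_range: assumes "g p \<le> v" "v \<le> g q" shows "p \<le> h v" "h v \<le> q"
  using the_inv_into_into[OF g_inj, of v "{p..q}"] assms by (auto simp: g_image)

lemma h_less: assumes "g p \<le> v" "v < w" "w \<le> g q" shows "h v < h w"
proof (rule ccontr)
  assume "\<not> h v < h w"
  then have "g (h w) \<le> g (h v)" using h_range[of v] h_range[of w] assms by (intro g_le) auto
  then show False using g_h[of v] g_h[of w] assms by simp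
qed

lemma h_cont: "continuous_on {g p..g q} h"
  using continuous_on_inv[OF g_cont compact_Icc, of p q h] h_g by (simp add: g_image)

lemma dh: assumes "g p < v" "v < g q"
  shows "(h has_real_derivative inverse (g' (h v))) (at v)"
proof -
  have eq: "g (h v) = v" using assms by (intro g_h) auto
  have "p < h v" "h v < q"
    using h_range[of v] assms eq by (auto simp: less_le)
  then show ?thesis
    using DERIV_inverse_strong[OF open_greaterThanLessThan[of p q] _ g_cont, of "h v" h "g' (h v)"]
      h_g dg[of "h v"] g'_pos[of "h v"] eq by force
qed

end

locale bistable =
  fixes f g :: "real \<Rightarrow> real" and d a \<beta> \<gamma> :: real
  assumes d_pos: "0 < d" and f_smooth: "smooth_on_open UNIV f"
    and a_pos: "0 < a" and a_less: "a < 1"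
    and f0: "f 0 = 0" and fa: "f a = 0" and f1: "f 1 = 0"
    and f_neg: "\<And>u. 0 < u \<Longrightarrow> u < a \<Longrightarrow> f u < 0"
    and f_pos: "\<And>u. a < u \<Longrightarrow> u < 1 \<Longrightarrow> 0 < f u"
    and df0: "deriv f 0 < 0"
    and g_def: "\<And>u. g u = u - f u / d"
    and \<beta>_pos: "0 < \<beta>" and \<beta>\<gamma>: "\<beta> < \<gamma>" and \<gamma>_less: "\<gamma> < 1"
    and g'_minus: "\<And>u. 0 \<le> u \<Longrightarrow> u < \<beta> \<Longrightarrow> 0 < deriv g u"
    and g'_plus: "\<And>u. \<gamma> < u \<Longrightarrow> u \<le> 1 \<Longrightarrow> 0 < deriv g u"
    and g'_mid: "\<And>u. \<beta> < u \<Longrightarrow> u < \<gamma> \<Longrightarrow> deriv g u < 0"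
    and Gm_end: "0 < G_minus g \<beta> (g \<beta>)"
begin

abbreviation "hm \<equiv> g_minus_inv g \<beta>"
abbreviation "hp \<equiv> g_plus_inv g \<gamma>"
abbreviation "Gm \<equiv> G_minus g \<beta>"
abbreviation "Gp \<equiv> G_plus g \<gamma>"
abbreviation "vm \<equiv> v_m g \<beta>"

lemma dg_eq: "(g has_real_derivative 1 - deriv f u / d) (at u)"
  unfolding g_def[abs_def]
  using d_pos by (auto intro!: derivative_eq_intros smooth_deriv[OF f_smooth])

lemma deriv_g: "deriv g u = 1 - deriv f u / d"
  by (rule DERIV_imp_deriv[OF dg_eq])

lemma dg: "(g has_real_derivative deriv g u) (at u)"
  using dg_eq by (simp add: deriv_g)

lemma Ck_deriv_g: "Ck n UNIV (deriv g)"
proof -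
  have "Ck n UNIV (\<lambda>u. 1 + (- 1 / d) * deriv f u)"
    by (intro Ck_add Ck_mult Ck_const smooth_imp_Ck smooth_on_open_deriv f_smooth)
  moreover have "deriv g = (\<lambda>u. 1 + (- 1 / d) * deriv f u)" by (auto simp: deriv_g)
  ultimately show ?thesis by simp
qed

sublocale minus: increasing_branch g "deriv g" 0 \<beta>
  by unfold_locales (auto intro: \<beta>_pos dg g'_minus)

sublocale plus: increasing_branch g "deriv g" \<gamma> 1
  by unfold_locales (auto intro: \<gamma>_less dg g'_plus)

lemma g0: "g 0 = 0" and g1: "g 1 = 1" and ga: "g a = a"
  by (simp_all add: g_def f0 f1 fa)

lemma g_gt: "0 < u \<Longrightarrow> u < a \<Longrightarrow> u < g u"
  using f_neg[of u] d_pos divide_neg_pos[of "f u" d] by (simp add: g_def)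

lemma g_lt: "a < u \<Longrightarrow> u < 1 \<Longrightarrow> g u < u"
  using f_pos[of u] d_pos by (simp add: g_def)

lemma g_mid_less: assumes "\<beta> \<le> u" "u < w" "w \<le> \<gamma>" shows "g w < g u"
  by (rule DERIV_neg_imp_decreasing_open[OF assms(2)])
    (use assms dg g'_mid minus.g_cont in \<open>force+\<close>)

lemmas hm_g = minus.h_g[folded g_minus_inv_def]
lemmas g_hm = minus.g_h[folded g_minus_inv_def, unfolded g0]
lemmas hm_range = minus.h_range[folded g_minus_inv_def, unfolded g0]
lemmas hm_less = minus.h_less[folded g_minus_inv_def, unfolded g0]
lemmas hm_cont = minus.h_cont[folded g_minus_inv_def, unfolded g0]
lemmas dhm = minus.dh[folded g_minus_inv_def, unfolded g0]
lemmas hp_g = plus.h_g[folded g_plus_inv_def]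
lemmas g_hp = plus.g_h[folded g_plus_inv_def, unfolded g1]
lemmas hp_range = plus.h_range[folded g_plus_inv_def, unfolded g1]
lemmas hp_less = plus.h_less[folded g_plus_inv_def, unfolded g1]
lemmas hp_cont = plus.h_cont[folded g_plus_inv_def, unfolded g1]
lemmas dhp = plus.dh[folded g_plus_inv_def, unfolded g1]

lemma g\<beta>_pos: "0 < g \<beta>" using minus.g_less[of 0 \<beta>] \<beta>_pos g0 by simp
lemma g\<gamma>_less: "g \<gamma> < g \<beta>" using g_mid_less[of \<beta> \<gamma>] \<beta>\<gamma> by simp
lemma g\<gamma>_less1: "g \<gamma> < 1" using plus.g_less[of \<gamma> 1] \<gamma>_less g1 by simp

lemma hm_0: "hm 0 = 0" using hm_g[of 0] \<beta>_pos g0 by simp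
lemma hm_pos: "0 < v \<Longrightarrow> v \<le> g \<beta> \<Longrightarrow> 0 < hm v" using hm_less[of 0 v] hm_0 by simp

text \<open>\<open>f < 0\<close> on \<open>(0, a)\<close> lifts \<open>g\<close> above the diagonal,
  so its inverse falls below. The argument must not rely on \<open>a < \<beta>\<close>, which is
  derived from it.\<close>

lemma hm_lt: assumes "0 < v" "v < a" "v \<le> g \<beta>" shows "hm v < v"
proof (rule ccontr)
  assume n: "\<not> hm v < v"
  have r: "0 \<le> hm v" "hm v \<le> \<beta>" "g (hm v) = v" using assms hm_range g_hm by auto
  have "v < g v" using g_gt assms by simp
  also have "g v \<le> g (hm v)" using n r assms by (intro minus.g_le) auto
  finally show False using r by simp
qed

section \<open>The potential of the minus branch\<close>

lemma dGm_within:
  assumes "0 \<le> v" "v \<le> g \<beta>"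
  shows "(Gm has_real_derivative hm v - v) (at v within {0..g \<beta>})"
proof -
  have "((\<lambda>V. integral {0..V} hm) has_real_derivative hm v) (at v within {0..g \<beta>})"
    using assms by (intro integral_has_real_derivative hm_cont) auto
  then show ?thesis
    unfolding G_minus_def[abs_def] by (auto intro!: derivative_eq_intros)
qed

lemma dGm: assumes "0 < v" "v < g \<beta>" shows "(Gm has_real_derivative hm v - v) (at v)"
  using dGm_within[of v] assms by (simp add: at_within_Icc_at)

lemma Gm_cont: "continuous_on {0..g \<beta>} Gm"
  by (rule DERIV_continuous_on) (auto intro: dGm_within)

lemma Gm_0: "Gm 0 = 0" by (simp add: G_minus_def)

text \<open>If \<open>\<beta> <= a\<close>, the derivative \<open>hm v - v\<close> of
  \<open>Gm\<close> is negative on the whole open domain, so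
  \<open>Gm (g \<beta>) < Gm 0 = 0\<close>, against the assumption on the potential.\<close>

lemma a_less_\<beta>: "a < \<beta>"
proof (rule ccontr)
  assume "\<not> a < \<beta>"
  have "Gm (g \<beta>) < Gm 0"
  proof (rule DERIV_neg_imp_decreasing_open[OF g\<beta>_pos _ Gm_cont])
    fix v assume v: "0 < v" "v < g \<beta>"
    have "0 < hm v" "hm v < \<beta>"
      using hm_pos[of v] hm_less[of v "g \<beta>"] hm_g[of \<beta>] \<beta>_pos v by auto
    then have "hm v < v" using g_gt[of "hm v"] g_hm[of v] v \<open>\<not> a < \<beta>\<close> by auto
    then show "\<exists>y. (Gm has_real_derivative y) (at v) \<and> y < 0"
      using dGm[OF v] by (intro exI[of _ "hm v - v"]) auto
  qed
  then show False using Gm_end Gm_0 by simp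
qed

lemma a_less_g\<beta>: "a < g \<beta>" using minus.g_less[of a \<beta>] a_less_\<beta> a_pos ga by simp

lemma g\<beta>_less: "g \<beta> < \<beta>" using g_lt[of \<beta>] a_less_\<beta> \<beta>\<gamma> \<gamma>_less by simp
lemma g\<beta>_less1: "g \<beta> < 1" using g\<beta>_less \<beta>\<gamma> \<gamma>_less by simp

lemma hm_gt: assumes "a < v" "v \<le> g \<beta>" shows "v < hm v"
proof -
  have r: "0 \<le> hm v" "hm v \<le> \<beta>" "g (hm v) = v"
    using assms a_pos hm_range[of v] g_hm[of v] by auto
  have "hm a = a" using hm_g[of a] a_pos a_less_\<beta> ga by simp
  then have "a < hm v" using hm_less[of a v] assms a_pos by simp
  then show ?thesis using g_lt[of "hm v"] r \<beta>\<gamma> \<gamma>_less by simp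
qed

lemma Gm_dec: assumes "0 \<le> v" "v < w" "w \<le> a" shows "Gm w < Gm v"
proof (rule DERIV_neg_imp_decreasing_open[OF assms(2)])
  show "\<exists>y. (Gm has_real_derivative y) (at x) \<and> y < 0" if "v < x" "x < w" for x
    using dGm[of x] hm_lt[of x] that assms a_less_g\<beta> by (intro exI[of _ "hm x - x"]) auto
  show "continuous_on {v..w} Gm"
    using assms a_less_g\<beta> by (intro continuous_on_subset[OF Gm_cont]) auto
qed

lemma Gm_inc: assumes "a \<le> v" "v < w" "w \<le> g \<beta>" shows "Gm v < Gm w"
proof (rule DERIV_pos_imp_increasing_open[OF assms(2)])
  show "\<exists>y. (Gm has_real_derivative y) (at x) \<and> 0 < y" if "v < x" "x < w" for x
    using dGm[of x] hm_gt[of x] that assms a_pos by (intro exI[of _ "hm x - x"]) auto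
  show "continuous_on {v..w} Gm"
    using assms a_pos by (intro continuous_on_subset[OF Gm_cont]) auto
qed

text \<open>\<open>Gm\<close> falls from 0 on \<open>[0, a]\<close> and rises on
  \<open>[a, g \<beta>]\<close> to a positive value, so it has exactly one zero beyond 0.\<close>

lemma vm_props: "a < vm \<and> vm < g \<beta> \<and> Gm vm = 0"
proof -
  have "Gm a < 0" using Gm_dec[of 0 a] a_pos Gm_0 by simp
  moreover have "continuous_on {a..g \<beta>} Gm"
    using a_pos by (intro continuous_on_subset[OF Gm_cont]) auto
  ultimately obtain v where v: "a \<le> v" "v \<le> g \<beta>" "Gm v = 0"
    using IVT'[of Gm a 0 "g \<beta>"] Gm_end a_less_g\<beta> by auto
  have v': "a < v" "v < g \<beta>"
    using v \<open>Gm a < 0\<close> Gm_end by (auto simp: less_le)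
  have neg: "Gm w < 0" if "0 < w" "w < v" for w
    using that Gm_dec[of 0 w] Gm_0 Gm_inc[of w v] v by (cases "w \<le> a") auto
  have "vm = v"
    unfolding v_m_def
  proof (rule the_equality)
    show "0 < v \<and> v < g \<beta> \<and> Gm v = 0 \<and> (\<forall>w\<in>{0<..<v}. Gm w < 0)"
      using v v' neg a_pos by auto
    fix w assume w: "0 < w \<and> w < g \<beta> \<and> Gm w = 0 \<and> (\<forall>w\<in>{0<..<w}. Gm w < 0)"
    show "w = v"
    proof (rule ccontr)
      assume "w \<noteq> v"
      then consider "w < v" | "v < w" by linarith
      then show False
      proof cases
        case 1 then show False using neg[of w] w by simp
      next
        case 2
        then have "Gm v < 0" using w v' a_pos by auto
        then show False using v by simp
      qed
    qed
  qed
  then show ?thesis using v v' by simp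
qed

lemma a_vm: "a < vm" and vm_g\<beta>: "vm < g \<beta>" and Gm_vm: "Gm vm = 0"
  using vm_props by auto

lemma vm_pos: "0 < vm" using a_vm a_pos by simp

lemma Gm_neg: assumes "0 < w" "w < vm" shows "Gm w < 0"
  using assms Gm_dec[of 0 w] Gm_0 Gm_inc[of w vm] Gm_vm vm_g\<beta> by (cases "w \<le> a") auto

lemma Gm_pos: assumes "vm < w" "w \<le> g \<beta>" shows "0 < Gm w"
  using assms Gm_inc[of vm w] Gm_vm a_vm by auto

lemma hm_vm_gt: "vm < hm vm" using hm_gt[of vm] a_vm vm_g\<beta> by simp

text \<open>The squared speed on the zero-energy level, the only level whose orbits can converge to
  the origin.\<close>

definition "Fm v = - 2 * Gm v"
definition "Fm' v = 2 * (v - hm v)"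

sublocale mw: potential_well Fm Fm' 0 vm
proof
  show "(Fm has_real_derivative Fm' v) (at v)" if "0 < v" "v \<le> vm" for v
    using that vm_g\<beta> unfolding Fm_def[abs_def] Fm'_def by (auto intro!: derivative_eq_intros dGm)
qed (use vm_pos Gm_vm hm_vm_gt Gm_neg in \<open>auto simp: Fm_def Fm'_def\<close>)

lemma Gm_lower: assumes "0 \<le> v" "v \<le> g \<beta>" shows "- v\<^sup>2 / 2 \<le> Gm v"
proof -
  have "0 \<le> integral {0..v} hm"
    using assms hm_range
    by (intro Henstock_Kurzweil_Integration.integral_nonneg integrable_continuous_interval
        continuous_on_subset[OF hm_cont]) auto
  then show ?thesis by (simp add: G_minus_def)
qed

text \<open>Since \<open>- 2 Gm v \<le> v\<^sup>2\<close>, the time needed to reach the rest state \<open>0\<close> is infinite.\<close>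

lemma mw_T_lower: assumes "0 < v" "v \<le> vm" shows "ln vm - ln v \<le> mw.T v"
proof -
  have "- mw.T v - ln v \<le> - mw.T vm - ln vm"
  proof (rule DERIV_nonneg_imp_increasing_open[OF assms(2)])
    show "continuous_on {v..vm} (\<lambda>w. - mw.T w - ln w)"
      using assms by (intro continuous_intros continuous_on_subset[OF mw.T_cont]) auto
    fix w assume w: "v < w" "w < vm"
    have "sqrt (Fm w) \<le> sqrt (w\<^sup>2)"
      using Gm_lower[of w] w assms vm_g\<beta> by (intro real_sqrt_le_mono) (auto simp: Fm_def)
    then have "1 / w \<le> 1 / sqrt (Fm w)"
      using w assms mw.Fpos[of w] by (intro divide_left_mono) auto
    moreover have "((\<lambda>w. - mw.T w - ln w) has_real_derivative - (- 1 / sqrt (Fm w)) - 1 / w) (at w)"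
      using w assms by (intro DERIV_diff DERIV_minus mw.dT DERIV_ln_divide) auto
    ultimately show "\<exists>y. ((\<lambda>w. - mw.T w - ln w) has_real_derivative y) (at w) \<and> 0 \<le> y"
      by (intro exI conjI) auto
  qed
  then show ?thesis by (simp add: mw.T_m)
qed

lemma mw_X: "mw.X = UNIV"
proof -
  have "x \<in> mw.X" for x
  proof (rule mw.X_convex)
    \<comment> \<open>By the logarithmic lower bound, descending from \<open>vm\<close> to
      \<open>vm * exp (- \<bar>x\<bar>)\<close> takes at least time
      \<open>\<bar>x\<bar>\<close>.\<close>
    have v: "0 < vm * exp (- \<bar>x\<bar>)" "vm * exp (- \<bar>x\<bar>) \<le> vm" using vm_pos by auto
    show "mw.T (vm * exp (- \<bar>x\<bar>)) \<in> mw.X" using v by (rule mw.T_X)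
    show "\<bar>x\<bar> \<le> \<bar>mw.T (vm * exp (- \<bar>x\<bar>))\<bar>"
      using mw_T_lower[OF v] vm_pos by (simp add: ln_mult)
  qed
  then show ?thesis by auto
qed

section \<open>The homoclinic orbit and its uniqueness\<close>

abbreviation "Vs \<equiv> mw.V"
abbreviation "Ws \<equiv> mw.Vd"

lemma dVs: "(Vs has_real_derivative Ws x) (at x)"
  by (rule mw.dV) (simp add: mw_X)

lemma dWs: "(Ws has_real_derivative Vs x - hm (Vs x)) (at x)"
proof -
  have eq: "Fm' (Vs x) / 2 = Vs x - hm (Vs x)" by (simp add: Fm'_def field_simps)
  show ?thesis using mw.dVd[of x] unfolding mw_X eq by simp
qed

lemma Vs_range: "0 < Vs x" "Vs x \<le> vm" "Vs x \<in> {0..g \<beta>}"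
  using mw.V_range[of x] mw_X vm_g\<beta> by auto

lemma Vs_even: "Vs (- x) = Vs x" and Ws_odd: "Ws (- x) = - Ws x"
  by (simp_all add: mw.V_even mw.Vd_odd mw_X)

lemma Ws_sq: "(Ws x)\<^sup>2 = - 2 * Gm (Vs x)"
  using mw.Vd_sq[of x] by (simp add: mw_X Fm_def)

lemma Vs_T: "0 < v \<Longrightarrow> v \<le> vm \<Longrightarrow> Vs (mw.T v) = v"
  by (rule mw.V_T)

lemma Vs_dec: assumes "0 \<le> x" "x < y" shows "Vs y < Vs x"
proof (rule DERIV_neg_imp_decreasing_open[OF assms(2)])
  show "continuous_on {x..y} Vs"
    by (rule DERIV_continuous_on) (rule has_field_derivative_at_within[OF dVs])
  fix z assume "x < z" "z < y"
  then have "Ws z = - sqrt (Fm (Vs z))" "Vs z < vm"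
    using assms mw.Vd_pos_arg[of z] mw.V_less[of z] mw_X by auto
  then show "\<exists>D. (Vs has_real_derivative D) (at z) \<and> D < 0"
    using dVs[of z] mw.Fpos[of "Vs z"] Vs_range[of z] by (intro exI[of _ "Ws z"] conjI) auto
qed

lemma Vs_tendsto: "(Vs \<longlongrightarrow> 0) at_top"
proof (rule tendstoI)
  fix e :: real assume e: "0 < e"
  define v where "v = min e vm"
  have v: "0 < v" "v \<le> vm" using e vm_pos by (auto simp: v_def)
  have "Vs x < e" if "mw.T v < x" for x
    using Vs_dec[OF mw.T_nonneg[OF v] that] Vs_T[OF v] by (simp add: v_def)
  then show "\<forall>\<^sub>F x in at_top. dist (Vs x) 0 < e"
    by (intro eventually_mono[OF eventually_gt_at_top[of "mw.T v"]]) (use Vs_range(1) in \<open>auto simp: abs_of_pos\<close>)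
qed

lemma Ws_le: "\<bar>Ws x\<bar> \<le> Vs x"
proof (rule power2_le_imp_le)
  show "\<bar>Ws x\<bar>\<^sup>2 \<le> (Vs x)\<^sup>2"
    using Ws_sq[of x] Gm_lower[of "Vs x"] Vs_range[of x] by simp
qed (use Vs_range[of x] in simp)

lemma Ws_tendsto: "(Ws \<longlongrightarrow> 0) at_top"
  by (rule Lim_null_comparison[OF _ Vs_tendsto]) (simp add: Ws_le)

lemma Vs_homoclinic: "positive_homoclinic hm {0..g \<beta>} Vs"
  unfolding positive_homoclinic_def solves_def
proof (intro conjI allI exI[of _ Ws] ballI)
  fix x
  show "0 < Vs x" by (rule Vs_range)
  show "Vs x \<in> {0..g \<beta>}" by (rule Vs_range)
  show "(Vs has_real_derivative Ws x) (at x within UNIV)" using dVs by simp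
  show "\<exists>V2. (Ws has_real_derivative V2) (at x within UNIV) \<and> Vs x - V2 = hm (Vs x)"
    using dWs by (intro exI[of _ "Vs x - hm (Vs x)"]) auto
  show "(Vs \<longlongrightarrow> 0) at_bot" by (rule tendsto_even_at_bot[OF Vs_tendsto Vs_even])
  show "(Ws \<longlongrightarrow> 0) at_bot"
    using Ws_odd tendsto_minus[OF Ws_tendsto] by (intro tendsto_even_at_bot[of "\<lambda>x. - Ws x"]) auto
qed (rule Vs_tendsto Ws_tendsto)+

text \<open>On the zero-energy level \<open>W'\<close> can vanish only where \<open>W\<close> is 0
  or \<open>vm\<close>. A falling orbit has left \<open>vm\<close> behind and cannot reach 0 in
  finite time, so it keeps falling and its travel time identifies it. The derivative at
  \<open>c\<close> is one-sided, so \<open>c\<close> may be a jump point.\<close>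

lemma falling_orbit:
  assumes W: "\<And>x. c \<le> x \<Longrightarrow> (W has_real_derivative W' x) (at x within {c..})"
    and cW': "continuous_on {c..} W'"
    and en: "\<And>x. c \<le> x \<Longrightarrow> (W' x)\<^sup>2 = - 2 * Gm (W x)"
    and nn: "\<And>x. c \<le> x \<Longrightarrow> 0 \<le> W x" and start: "0 < W c" "W c < vm" "W' c < 0"
    and x: "c \<le> x"
  shows "W x = Vs (x - c + mw.T (W c))"
proof -
  have cW: "continuous_on {c..} W"
    by (rule DERIV_continuous_on[of _ _ W']) (rule W, simp)
  have dW: "(W has_real_derivative W' y) (at y)" if "c < y" for y
  proof -
    have "at y within {c..} = at y"
      using that by (intro at_within_interior) (simp add: interior_real_atLeast)
    then show ?thesis using W[of y] that by simp
  qed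
  have along: "0 < W y \<Longrightarrow> mw.T (W y) = mw.T (W c) + (y - c)"
    if cy: "c \<le> y" and neg: "\<And>z. c < z \<Longrightarrow> z < y \<Longrightarrow> W' z < 0" for y
  proof -
    assume pos: "0 < W y"
    have dec: "W w < W z" if "c \<le> z" "z < w" "w \<le> y" for z w
    proof (rule DERIV_neg_imp_decreasing_open[OF that(2)])
      show "continuous_on {z..w} W" using that by (intro continuous_on_subset[OF cW]) auto
      show "\<exists>D. (W has_real_derivative D) (at u) \<and> D < 0" if "z < u" "u < w" for u
        using dW[of u] neg[of u] that \<open>c \<le> z\<close> \<open>w \<le> y\<close> by (intro exI[of _ "W' u"]) auto
    qed
    have rng: "0 < W z \<and> W z < vm" if "c \<le> z" "z \<le> y" for z
      using dec[of c z] dec[of z y] that start pos by (cases "z = c"; cases "z = y") auto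
    show ?thesis
    proof (rule mw.T_along[OF cy])
      show "continuous_on {c..y} W" by (rule continuous_on_subset[OF cW]) auto
      fix z assume z: "c < z" "z < y"
      have "sqrt (Fm (W z)) = \<bar>W' z\<bar>"
        using en[of z] z real_sqrt_abs[of "W' z"] by (simp add: Fm_def)
      then show "(W has_real_derivative - sqrt (Fm (W z))) (at z)"
        using dW[OF z(1)] neg[OF z] by simp
    qed (use rng cy in \<open>auto intro: less_imp_le\<close>)
  qed
  have neg: "W' y < 0" if cy: "c \<le> y" for y
  proof (rule ccontr)
    assume "\<not> W' y < 0"
    define A where "A = {z \<in> {c..y}. W' z = 0}"
    have cont: "continuous_on {c..y} W'" using cW' by (rule continuous_on_subset) auto
    have "A \<noteq> {}"
      using IVT'[of W' c 0 y] start cy cont \<open>\<not> W' y < 0\<close> by (auto simp: A_def)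
    have "closed A"
      using continuous_closed_preimage_constant[OF cont closed_atLeastAtMost, of 0] by (simp add: A_def)
    have bdd: "bdd_below A" by (rule bdd_belowI[of _ c]) (auto simp: A_def)
    \<comment> \<open>The first time at which the orbit would stop falling.\<close>
    define z where "z = Inf A"
    have zA: "z \<in> A" unfolding z_def by (rule closed_contains_Inf) fact+
    have zmin: "z \<le> w" if "w \<in> A" for w unfolding z_def using that bdd by (rule cInf_lower)
    have z: "c < z" "z \<le> y" "W' z = 0" using zA start by (auto simp: A_def less_le)
    have before: "W' w < 0" if w: "c \<le> w" "w < z" for w
    proof (rule ccontr)
      assume "\<not> W' w < 0"
      moreover have "continuous_on {c..w} W'" using cW' by (rule continuous_on_subset) auto
      ultimately obtain u where "c \<le> u" "u \<le> w" "W' u = 0"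
        using IVT'[of W' c 0 w] start w by auto
      then show False using zmin[of u] w z by (auto simp: A_def)
    qed
    have decz: "W z < W c"
    proof (rule DERIV_neg_imp_decreasing_open[OF z(1)])
      show "continuous_on {c..z} W" by (rule continuous_on_subset[OF cW]) auto
      show "\<exists>D. (W has_real_derivative D) (at u) \<and> D < 0" if "c < u" "u < z" for u
        using dW[of u] before[of u] that by (intro exI[of _ "W' u"]) auto
    qed
    have "Gm (W z) = 0" using en[of z] z by simp
    then have "\<not> 0 < W z" using Gm_neg[of "W z"] decz start by auto
    then have Wz: "W z = 0" using nn[of z] z by simp
    \<comment> \<open>The time that the reference orbit spends from its peak to the value reached at
      \<open>z\<close>, if the orbit could be followed that far. It would bound \<open>W\<close>
      below by \<open>vm * exp (- K)\<close> just before \<open>z\<close>, contradicting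
      \<open>W z = 0\<close>.\<close>
    define K where "K = mw.T (W c) + (z - c)"
    have bound: "vm * exp (- K) \<le> W w" if w: "c < w" "w < z" for w
    proof -
      have "W z < W w"
      proof (rule DERIV_neg_imp_decreasing_open[OF w(2)])
        show "continuous_on {w..z} W" using w by (intro continuous_on_subset[OF cW]) auto
        show "\<exists>D. (W has_real_derivative D) (at u) \<and> D < 0" if "w < u" "u < z" for u
          using dW[of u] before[of u] that w by (intro exI[of _ "W' u"]) auto
      qed
      then have pos: "0 < W w" using Wz by simp
      have "W w < W c"
      proof (rule DERIV_neg_imp_decreasing_open[OF w(1)])
        show "continuous_on {c..w} W" by (rule continuous_on_subset[OF cW]) auto
        show "\<exists>D. (W has_real_derivative D) (at u) \<and> D < 0" if "c < u" "u < w" for u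
          using dW[of u] before[of u] that w by (intro exI[of _ "W' u"]) auto
      qed
      then have le: "W w \<le> vm" using start by simp
      have "mw.T (W w) = mw.T (W c) + (w - c)"
        by (rule along) (use w before pos in auto)
      then have "ln vm + - K \<le> ln (W w)"
        using mw_T_lower[OF pos le] w by (simp add: K_def)
      then have "exp (ln vm + - K) \<le> exp (ln (W w))" by (simp only: exp_le_cancel_iff)
      then show ?thesis using pos vm_pos unfolding exp_add by simp
    qed
    have "((W \<longlongrightarrow> W z) (at_left z))"
      using DERIV_isCont[OF dW[OF z(1)]] by (simp add: isCont_def filterlim_at_split)
    moreover have "\<forall>\<^sub>F w in at_left z. vm * exp (- K) \<le> W w"
      using eventually_at_left_real[OF z(1)] by eventually_elim (use bound in auto)
    ultimately have "vm * exp (- K) \<le> W z"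
      by (rule tendsto_lowerbound) simp
    then show False using Wz vm_pos by (simp add: mult_le_0_iff)
  qed
  have pos: "0 < W y" if cy: "c \<le> y" for y
  proof -
    have "0 < (W' y)\<^sup>2" using neg[OF cy] by simp
    then have "Gm (W y) < 0" using en[OF cy] by simp
    then show ?thesis using nn[OF cy] Gm_0 by (cases "W y = 0") auto
  qed
  have "mw.T (W x) = mw.T (W c) + (x - c)"
    by (rule along[OF x _ pos[OF x]]) (use neg in auto)
  moreover have "W x \<le> vm"
  proof (cases "x = c")
    case False
    have "W x < W c"
    proof (rule DERIV_neg_imp_decreasing_open[of c x W])
      show "c < x" using False x by simp
      show "continuous_on {c..x} W" by (rule continuous_on_subset[OF cW]) auto
      show "\<exists>D. (W has_real_derivative D) (at u) \<and> D < 0" if "c < u" "u < x" for u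
        using dW[of u] neg[of u] that by (intro exI[of _ "W' u"]) auto
    qed
    then show ?thesis using start by simp
  qed (use start in simp)
  ultimately show ?thesis using Vs_T[OF pos[OF x]] by (simp add: add.commute)
qed

text \<open>\<open>falling_orbit\<close> cannot start at the peak, where \<open>W' c = 0\<close>.
  There \<open>W'' = vm - hm vm < 0\<close>, so \<open>W\<close> falls at once; a short interval is
  handled by the travel time, and \<open>falling_orbit\<close> takes over from its end.\<close>

lemma peak_orbit:
  assumes W: "\<And>x. (W has_real_derivative W' x) (at x)"
    and W': "\<And>x. (W' has_real_derivative W x - hm (W x)) (at x)"
    and en: "\<And>x. (W' x)\<^sup>2 = - 2 * Gm (W x)"
    and rng: "\<And>x. 0 < W x" "\<And>x. W x \<le> vm" and peak: "W c = vm" and "c \<le> x"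
  shows "W x = Vs (x - c)"
proof -
  have cW: "continuous_on S W" for S
    using W by (auto intro!: continuous_at_imp_continuous_on intro: DERIV_isCont)
  have cW': "continuous_on S W'" for S
    using W' by (auto intro!: continuous_at_imp_continuous_on intro: DERIV_isCont)
  have W'c: "W' c = 0" using en[of c] peak Gm_vm by simp
  have "vm - hm vm < 0" using hm_vm_gt by simp
  then obtain e where e: "0 < e" "\<And>h. 0 < h \<Longrightarrow> h < e \<Longrightarrow> W' (c + h) < W' c"
    using DERIV_neg_dec_right[OF W'[of c]] peak by auto
  \<comment> \<open>Half of \<open>e\<close>, so that \<open>W' < 0\<close> still holds at
    \<open>c'\<close> itself.\<close>
  define c' where "c' = c + e / 2"
  have neg: "W' y < 0" if "c < y" "y \<le> c'" for y
    using e(2)[of "y - c"] that e(1) W'c by (simp add: c'_def)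
  have small: "mw.T (W y) = y - c" if y: "c \<le> y" "y \<le> c'" for y
  proof -
    have "mw.T (W y) = mw.T (W c) + (y - c)"
    proof (rule mw.T_along[OF y(1) cW])
      fix z assume z: "c < z" "z < y"
      have W'z: "W' z < 0" using neg z y by auto
      have "sqrt (Fm (W z)) = \<bar>W' z\<bar>"
        using en[of z] real_sqrt_abs[of "W' z"] by (simp add: Fm_def)
      then show "(W has_real_derivative - sqrt (Fm (W z))) (at z)"
        using W[of z] W'z by simp
      have "W z \<noteq> vm" using en[of z] W'z Gm_vm by auto
      then show "0 < W z \<and> W z < vm" using rng[of z] by simp
    qed (use rng in auto)
    then show ?thesis using peak mw.T_m by simp
  qed
  show ?thesis
  proof (cases "x \<le> c'")
    case True
    then show ?thesis using small[of x] \<open>c \<le> x\<close> Vs_T[OF rng[of x]] by simp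
  next
    case False
    have c': "c < c'" using e by (simp add: c'_def)
    have "W c' \<noteq> vm" using en[of c'] neg[of c'] c' Gm_vm by auto
    then have "W x = Vs (x - c' + mw.T (W c'))"
      using rng neg[of c'] False c' less_imp_le[OF rng(1)] le_neq_trans[OF rng(2)]
      by (intro falling_orbit[of c' W W'] cW' en)
        (auto intro: has_field_derivative_at_within[OF W])
    then show ?thesis using small[of c'] c' by simp
  qed
qed

lemma dGm_within': "\<forall>v\<in>{0..g \<beta>}. (Gm has_real_derivative hm v - v) (at v within {0..g \<beta>})"
  by (simp add: dGm_within)

lemmas minus_energy_const = energy_const[OF dGm_within']

text \<open>Decay forces zero energy. At a maximum the derivative vanishes, so the value there is
  \<open>vm\<close>, and \<open>peak_orbit\<close> applies to the right half and to the reflected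
  left half.\<close>

lemma homoclinic_unique:
  assumes "positive_homoclinic hm {0..g \<beta>} W"
  shows "\<exists>c. \<forall>x. W x = Vs (x - c)"
proof -
  from assms obtain W' where pos: "\<And>x. 0 < W x"
    and sol: "solves hm {0..g \<beta>} UNIV W W'"
    and lim: "(W \<longlongrightarrow> 0) at_top" "(W' \<longlongrightarrow> 0) at_top" "(W \<longlongrightarrow> 0) at_bot" "(W' \<longlongrightarrow> 0) at_bot"
    unfolding positive_homoclinic_def by blast
  have rng: "W x \<in> {0..g \<beta>}" and dW: "(W has_real_derivative W' x) (at x)" for x
    using sol unfolding solves_def by auto
  have dW': "(W' has_real_derivative W x - hm (W x)) (at x)" for x
  proof -
    obtain V2 where "(W' has_real_derivative V2) (at x)" "W x - V2 = hm (W x)"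
      using sol unfolding solves_def by auto
    moreover from this have "V2 = W x - hm (W x)" by simp
    ultimately show ?thesis by simp
  qed
  have cW: "continuous_on S W" and cW': "continuous_on S W'" for S
    using dW dW' by (auto intro!: continuous_at_imp_continuous_on intro: DERIV_isCont)
  define E where "E = (\<lambda>x. (W' x)\<^sup>2 / 2 + Gm (W x))"
  have const: "E x = E 0" for x
    using minus_energy_const[of 0 x W W'] minus_energy_const[of x 0 W W'] dW dW' cW cW' rng
    unfolding E_def by (cases "0 \<le> x") auto
  have "(E \<longlongrightarrow> 0\<^sup>2 / 2 + Gm 0) at_top"
    unfolding E_def using g\<beta>_pos rng
    by (intro tendsto_intros lim continuous_on_tendsto_compose[OF Gm_cont]) auto
  moreover have "(E \<longlongrightarrow> E 0) at_top"
    by (rule tendsto_eventually) (intro always_eventually allI const)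
  ultimately have "E 0 = 0\<^sup>2 / 2 + Gm 0"
    by (intro tendsto_unique[OF trivial_limit_at_top_linorder, of E])
  then have "E 0 = 0" by (simp add: Gm_0)
  then have en: "(W' x)\<^sup>2 = - 2 * Gm (W x)" for x using const[of x] by (simp add: E_def)
  have le: "W x \<le> vm" for x
  proof (rule ccontr)
    assume "\<not> W x \<le> vm"
    then have "0 < Gm (W x)" using Gm_pos rng[of x] by auto
    then show False using en[of x] zero_le_power2[of "W' x"] by linarith
  qed
  obtain c where c: "\<And>x. W x \<le> W c"
    using positive_attains_max[OF cW pos lim(1,3)] by blast
  have "W' c = 0"
    using DERIV_local_max[OF dW[of c], of 1] c by simp
  then have "Gm (W c) = 0" using en[of c] by simp
  then have peak: "W c = vm" using Gm_neg[of "W c"] pos[of c] le[of c] by (cases "W c = vm") auto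
  have right: "W x = Vs (x - c)" if "c \<le> x" for x
    by (rule peak_orbit[OF dW dW' en pos le peak that])
  have dR: "((\<lambda>x. W (- x)) has_real_derivative - W' (- x)) (at x)" for x
    using dW[of "- x"] by (simp add: DERIV_mirror)
  have dR': "((\<lambda>x. - W' (- x)) has_real_derivative W (- x) - hm (W (- x))) (at x)" for x
    using dW'[of "- x"] by (auto simp: DERIV_mirror intro!: derivative_eq_intros)
  have left: "W x = Vs (x - c)" if "x \<le> c" for x
  proof -
    have "W (- (- x)) = Vs (- x - - c)"
      by (rule peak_orbit[OF dR dR']) (use en pos le peak that in auto)
    then show ?thesis using Vs_even[of "x - c"] by simp
  qed
  have "W x = Vs (x - c)" for x using left[of x] right[of x] linear[of x c] by blast
  then show ?thesis by blast
qed

text \<open>\<open>Vs\<close> takes the value \<open>vm\<close> only at 0, whereas evenness would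
  put peaks at both \<open>c\<close> and \<open>- c\<close>.\<close>

lemma homoclinic_unique_even:
  assumes "positive_homoclinic hm {0..g \<beta>} W" "even_fun W" shows "W = Vs"
proof -
  obtain c where c: "\<And>x. W x = Vs (x - c)" using homoclinic_unique[OF assms(1)] by blast
  have "W (- c) = W c" using assms(2) by (simp add: even_fun_def)
  then have "Vs (- c - c) = vm" using c[of c] c[of "- c"] mw.V_0 by simp
  then have "c = 0" using mw.V_less[of "- c - c"] by (auto simp: mw_X)
  then show ?thesis using c by (intro ext) simp
qed

lemma Vs_even_fun: "even_fun Vs" by (simp add: even_fun_def Vs_even)

section \<open>Constructing ground states, and the smooth one\<close>

lemma g_superlinear:
  obtains \<delta> \<eta> where "0 < \<delta>" "0 < \<eta>" "\<And>u. 0 \<le> u \<Longrightarrow> u \<le> \<eta> \<Longrightarrow> (1 + \<delta>) * u \<le> g u"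
proof -
  \<comment> \<open>Half of the excess of \<open>deriv g 0 = 1 - deriv f 0 / d\<close> over 1, which
    leaves room for the difference quotients near 0.\<close>
  define \<delta> where "\<delta> = - (deriv f 0 / d) / 2"
  have "deriv f 0 / d < 0" using df0 d_pos by (rule divide_neg_pos)
  moreover have "0 < - z / 2" if "z < 0" for z :: real using that by simp
  ultimately have \<delta>: "0 < \<delta>" unfolding \<delta>_def by blast
  have "((\<lambda>h. (g (0 + h) - g 0) / h) \<longlongrightarrow> deriv g 0) (at 0)"
    using dg[of 0] unfolding DERIV_def .
  moreover have "1 + \<delta> < deriv g 0" using \<delta> by (simp add: deriv_g \<delta>_def)
  ultimately have "\<forall>\<^sub>F h in at 0. 1 + \<delta> < g h / h"
    using order_tendstoD(1) by (fastforce simp: g0)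
  then obtain e where e: "0 < e" "\<And>h. h \<noteq> 0 \<Longrightarrow> \<bar>h\<bar> < e \<Longrightarrow> 1 + \<delta> < g h / h"
    by (auto simp: eventually_at dist_real_def)
  show ?thesis
  proof (rule that[OF \<delta>, of "e / 2"])
    show "(1 + \<delta>) * u \<le> g u" if "0 \<le> u" "u \<le> e / 2" for u
      using e(2)[of u] that e(1) g0 by (cases "u = 0") (auto simp: field_simps)
  qed (use e in simp)
qed

text \<open>Bounded C^1 solutions are unique, so \<open>V\<close> must be the convolution of
  \<open>U\<close>, and \<open>g (U x) = V x\<close> is then the ground state equation. Stated with
  a finite exceptional set, it serves both \<open>Us\<close> and the discontinuous family.\<close>

lemma ground_state_construct:
  assumes "finite P" and cV: "continuous_on UNIV V" and cW: "continuous_on UNIV W"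
    and dV: "\<And>x. x \<notin> P \<Longrightarrow> (V has_real_derivative W x) (at x)"
    and dW: "\<And>x. x \<notin> P \<Longrightarrow> (W has_real_derivative V x - U x) (at x)"
    and cU: "\<And>x. x \<notin> P \<Longrightarrow> isCont U x"
    and bnd: "\<And>x. \<bar>V x\<bar> \<le> B" "\<And>x. \<bar>W x\<bar> \<le> B"
    and U: "\<And>x. 0 < U x" "\<And>x. U x \<le> 1" and gU: "\<And>x. g (U x) = V x" and even: "even_fun U"
    and tail: "\<And>x. b \<le> x \<Longrightarrow> V x \<in> {0..g \<beta>} \<and> U x = hm (V x)"
    and lim: "(V \<longlongrightarrow> 0) at_top" "(W \<longlongrightarrow> 0) at_top"
  shows "ground_state f d U"
proof -
  have mU: "U \<in> borel_measurable borel"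
    using assms(1) cU
    by (intro borel_measurable_continuous_countable_exceptions[of P] uncountable_infinite)
      (auto intro: countable_finite continuous_at_imp_continuous_on)
  have mV: "V \<in> borel_measurable borel" by (rule borel_measurable_continuous_onI[OF cV])
  interpret bounded_source U 1
  proof
    show "U \<in> borel_measurable lebesgue" using mU by (simp add: measurable_completion)
    show "\<bar>U t\<bar> \<le> 1" for t using U[of t] by simp
  qed
  have conv: "conv kernel U x = V x" for x
    by (rule conv_unique[OF assms(1) cV cW dV dW cU bnd])
  have "((\<lambda>x. hm (V x)) \<longlongrightarrow> hm 0) at_top"
    using lim(1) g\<beta>_pos tail by (intro continuous_on_tendsto_compose[OF hm_cont])
      (auto intro: eventually_mono[OF eventually_ge_at_top[of b]])
  then have "((\<lambda>x. hm (V x)) \<longlongrightarrow> 0) at_top" by (simp add: hm_0)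
  then have limU: "(U \<longlongrightarrow> 0) at_top"
    by (rule Lim_transform_eventually)
      (use tail hm_0 in \<open>auto intro: eventually_mono[OF eventually_ge_at_top[of b]]\<close>)
  obtain \<delta> \<eta> where \<delta>: "0 < \<delta>" "0 < \<eta>" "\<And>u. 0 \<le> u \<Longrightarrow> u \<le> \<eta> \<Longrightarrow> (1 + \<delta>) * u \<le> g u"
    using g_superlinear by metis
  have "\<forall>\<^sub>F x in at_top. U x < \<eta>" using limU \<delta>(2) by (rule order_tendstoD)
  then obtain b1 where b1: "\<And>x. b1 \<le> x \<Longrightarrow> U x < \<eta>" by (auto simp: eventually_at_top_linorder)
  have "bdd_above P" using assms(1) by (rule bdd_above_finite)
  then obtain b2 where b2: "\<And>p. p \<in> P \<Longrightarrow> p \<le> b2" by (auto simp: bdd_above_def)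
  \<comment> \<open>Beyond \<open>b0\<close> there are no exceptional points and
    \<open>U < \<eta>\<close>.\<close>
  define b0 where "b0 = max 0 (max b1 (b2 + 1))"
  have "integrable lebesgue (\<lambda>x. (U x)\<^sup>2)"
  proof (rule square_integrable_tail[where b = b0 and C = "1 / \<delta>" and W = W and M = 1])
    show "(\<lambda>x. V x - U x) \<in> borel_measurable borel" using mV mU by simp
    fix x assume x: "b0 \<le> x"
    then have "x \<notin> P" using b2[of x] by (force simp: b0_def)
    then show "(W has_real_derivative V x - U x) (at x)" by (rule dW)
    \<comment> \<open>Superlinearity of \<open>g\<close> at small values,
      \<open>(1 + \<delta>) * U <= g U = V\<close>, is what bounds \<open>U\<close> by a multiple of
      \<open>V'' = V - U\<close>.\<close>
    have "(1 + \<delta>) * U x \<le> V x"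
      using \<delta>(3)[of "U x"] U[of x] b1[of x] x gU[of x] by (auto simp: b0_def)
    then show "U x \<le> 1 / \<delta> * (V x - U x)" using \<delta>(1) by (simp add: field_simps)
  qed (use mU even U \<delta> lim in \<open>auto simp: b0_def intro: less_imp_le\<close>)
  moreover have "0 = d * (- U x + conv kernel U x) + f (U x)" for x
    using gU[of x] d_pos unfolding conv g_def by (simp add: field_simps)
  moreover have "bounded (range U)"
    using bndU by (auto simp: bounded_iff)
  moreover have "(U \<longlongrightarrow> 0) at_bot"
    by (rule tendsto_even_at_bot[OF limU]) (use even in \<open>simp add: even_fun_def\<close>)
  ultimately show ?thesis
    unfolding ground_state_def using measU limU U even by blast
qed

definition "Us x = hm (Vs x)"

lemma hm_vm_less: "hm vm < \<beta>"
  using hm_less[of vm "g \<beta>"] vm_pos vm_g\<beta> hm_g[of \<beta>] \<beta>_pos by simp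

lemma Us_range: "0 < Us x" "Us x \<le> hm vm" "Us x < \<beta>"
proof -
  show "0 < Us x" using hm_pos Vs_range[of x] by (simp add: Us_def)
  show "Us x \<le> hm vm"
    using hm_less[of "Vs x" vm] Vs_range[of x] vm_g\<beta> by (cases "Vs x = vm") (auto simp: Us_def)
  then show "Us x < \<beta>" using hm_vm_less by simp
qed

lemma g_Us: "g (Us x) = Vs x" using g_hm[of "Vs x"] Vs_range[of x] by (simp add: Us_def)

lemma dUs: "(Us has_real_derivative Ws x / deriv g (Us x)) (at x)"
proof -
  have "((\<lambda>x. hm (Vs x)) has_real_derivative inverse (deriv g (hm (Vs x))) * Ws x) (at x)"
    by (rule DERIV_chain2[OF dhm dVs]) (use Vs_range[of x] vm_g\<beta> in auto)
  then show ?thesis by (simp add: Us_def[abs_def] divide_inverse mult.commute)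
qed

lemma Us_smooth: "smooth_on_open UNIV Us"
proof (rule smooth_bootstrap[OF open_UNIV, where V = Vs and W = Ws and g' = "deriv g"])
  show "(Ws has_real_derivative Vs x - Us x) (at x)" for x using dWs by (simp add: Us_def)
  show "deriv g (Us x) \<noteq> 0" for x using g'_minus[of "Us x"] Us_range[of x] by auto
qed (rule dVs dUs Ck_deriv_g)+

lemma Us_ground_state: "ground_state f d Us"
proof (rule ground_state_construct[where P = "{}" and V = Vs and W = Ws and B = 1])
  show "continuous_on UNIV Vs" "continuous_on UNIV Ws"
    using dVs dWs by (auto intro!: continuous_at_imp_continuous_on intro: DERIV_isCont)
  show "(Vs has_real_derivative Ws x) (at x)" for x by (rule dVs)
  show "(Ws has_real_derivative Vs x - Us x) (at x)" for x using dWs by (simp add: Us_def)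
  show "isCont Us x" for x using dUs by (rule DERIV_isCont)
  show V1: "\<bar>Vs x\<bar> \<le> 1" for x using Vs_range[of x] vm_g\<beta> g\<beta>_less1 by simp
  show "\<bar>Ws x\<bar> \<le> 1" for x using Ws_le[of x] V1[of x] by simp
  show "Us x \<le> 1" for x using Us_range[of x] \<beta>\<gamma> \<gamma>_less by simp
  show "Vs x \<in> {0..g \<beta>} \<and> Us x = hm (Vs x)" if "0 \<le> x" for x
    using Vs_range[of x] by (simp add: Us_def)
  show "even_fun Us" by (simp add: even_fun_def Us_def Vs_even)
qed (auto intro: Vs_tendsto Ws_tendsto Us_range g_Us)

section \<open>Properties of arbitrary ground states\<close>

lemma ground_state_bounded_source:
  assumes "ground_state f d U" obtains M where "bounded_source U M"
proof -
  obtain M where "\<And>x. \<bar>U x\<bar> \<le> M"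
    using assms unfolding ground_state_def bounded_iff by auto
  then show ?thesis using assms that unfolding ground_state_def bounded_source_def by blast
qed

lemma ground_state_conv:
  assumes "ground_state f d U" shows "conv kernel U x = g (U x)"
proof -
  have "0 = d * (- U x + conv kernel U x) + f (U x)"
    using assms unfolding ground_state_def by blast
  then show ?thesis using d_pos by (simp add: g_def field_simps)
qed

text \<open>A zero of \<open>V\<close> would spread to the right, to points where
  \<open>0 < U < \<beta>\<close>; but there \<open>V = g (U)\<close> is positive.\<close>

lemma ground_state_conv_pos:
  assumes gs: "ground_state f d U" shows "0 < conv kernel U x"
proof -
  obtain M where "bounded_source U M" using ground_state_bounded_source[OF gs] .
  then interpret bounded_source U M .
  have U: "0 < U t" for t using gs unfolding ground_state_def by blast
  have lim: "(U \<longlongrightarrow> 0) at_top" using gs unfolding ground_state_def by blast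
  have "conv kernel U x \<noteq> 0"
  proof
    assume z: "conv kernel U x = 0"
    have "\<forall>\<^sub>F y in at_top. U y < \<beta>" using lim \<beta>_pos by (rule order_tendstoD)
    then have "\<forall>\<^sub>F y in at_top. U y < \<beta> \<and> x \<le> y"
      using eventually_ge_at_top by (rule eventually_conj)
    then obtain y where y: "U y < \<beta>" "x \<le> y" by (auto simp: eventually_at_top_linorder)
    have "conv kernel U y = 0"
      using conv_zero_propagates[OF less_imp_le[OF U] z y(2)] .
    then show False
      using minus.g_less[of 0 "U y"] U[of y] y g0 ground_state_conv[OF gs, of y] by simp
  qed
  moreover have "0 \<le> conv kernel U x"
    using conv_deriv_le_conv[OF less_imp_le[OF U], of x] by simp
  ultimately show ?thesis by simp
qed

lemma ground_state_conv_lim: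
  assumes "ground_state f d U"
  shows "(conv kernel U \<longlongrightarrow> 0) at_top" "(conv kernel U \<longlongrightarrow> 0) at_bot"
proof -
  have eq: "conv kernel U = (\<lambda>x. g (U x))" using ground_state_conv[OF assms] by (rule ext)
  have "isCont g 0" using dg by (rule DERIV_isCont)
  from isCont_tendsto_compose[OF this]
  have *: "(U \<longlongrightarrow> 0) F \<Longrightarrow> ((\<lambda>x. g (U x)) \<longlongrightarrow> 0) F" for F
    by (simp add: g0)
  show "(conv kernel U \<longlongrightarrow> 0) at_top" "(conv kernel U \<longlongrightarrow> 0) at_bot"
    unfolding eq using assms by (auto intro!: * simp: ground_state_def)
qed

lemma ground_state_conv_even:
  assumes "ground_state f d U"
  shows "conv kernel U (- x) = conv kernel U x" "conv_deriv U (- x) = - conv_deriv U x"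
proof -
  obtain M where "bounded_source U M" using ground_state_bounded_source[OF assms] .
  then interpret bounded_source U M .
  have "(\<lambda>t. U (- t)) = U" using assms by (auto simp: ground_state_def even_fun_def)
  then show "conv kernel U (- x) = conv kernel U x" "conv_deriv U (- x) = - conv_deriv U x"
    using conv_reflect[of U x] conv_deriv_reflect[of x] by simp_all
qed

text \<open>Replacing \<open>U\<close> by the continuous function \<open>hm \<circ> V\<close>, which differs from it at finitely many
  points only, changes neither \<open>V = K * U\<close> nor its derivative.\<close>

lemma ground_state_minus_branch:
  assumes gs: "ground_state f d U" and "finite P" and P: "\<And>x. x \<notin> P \<Longrightarrow> U x \<le> \<beta>"
  shows "AE x in lebesgue. U x = Us x"
proof -
  obtain M where "bounded_source U M" using ground_state_bounded_source[OF gs] .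
  then interpret U: bounded_source U M .
  define V where "V = conv kernel U"
  have gU: "V x = g (U x)" for x using ground_state_conv[OF gs] by (simp add: V_def)
  have U0: "0 < U x" for x using gs unfolding ground_state_def by blast
  have cV: "continuous_on S V" for S
    unfolding V_def by (auto intro!: continuous_at_imp_continuous_on U.conv_isCont)
  have off: "V x \<in> {0..g \<beta>} \<and> hm (V x) = U x" if "x \<notin> P" for x
    using that minus.g_le[of 0 "U x"] minus.g_le[of "U x" \<beta>] P[OF that] U0[of x] gU[of x] g0
      hm_g[of "U x"] by auto
  have rng: "V x \<in> {0..g \<beta>}" for x
  proof -
    \<comment> \<open>The upper bound on \<open>V\<close> reaches the points of \<open>P\<close> by
      continuity, since the complement of a finite set is dense.\<close>
    have cl: "closure (- P) = UNIV"
      using \<open>finite P\<close> by (simp add: closure_complement empty_interior_finite)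
    have "V x \<le> g \<beta>"
      by (rule continuous_le_on_closure[of "- P" V x "g \<beta>"]) (use cl cV off in auto)
    moreover have "0 < V x" using ground_state_conv_pos[OF gs] by (simp add: V_def)
    ultimately show ?thesis by simp
  qed
  define U2 where "U2 = (\<lambda>x. hm (V x))"
  have cU2: "isCont U2 x" for x
  proof -
    have "continuous_on UNIV U2"
      unfolding U2_def by (rule continuous_on_compose2[OF hm_cont cV]) (use rng in auto)
    then show ?thesis by (simp add: continuous_on_eq_continuous_at)
  qed
  have U2: "0 \<le> U2 x \<and> U2 x \<le> \<beta>" for x using hm_range rng[of x] by (auto simp: U2_def)
  interpret U2: bounded_source U2 \<beta>
  proof
    have "U2 \<in> borel_measurable borel"
      using cU2 by (intro borel_measurable_continuous_onI continuous_at_imp_continuous_on) auto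
    then show "U2 \<in> borel_measurable lebesgue" by (simp add: measurable_completion)
    show "\<bar>U2 t\<bar> \<le> \<beta>" for t using U2[of t] by simp
  qed
  have eq: "conv kernel U2 = V"
  proof
    fix x
    have m: "(\<lambda>y. kernel (x - y)) \<in> borel_measurable lebesgue"
      unfolding kernel_def by (intro measurable_completion) simp
    show "conv kernel U2 x = V x"
      unfolding V_def conv_def
    proof (rule integral_cong_AE)
      show "AE y in lebesgue. kernel (x - y) * U2 y = kernel (x - y) * U y"
        using off by (intro AE_off_finite[OF \<open>finite P\<close>]) (simp add: U2_def)
    qed (intro borel_measurable_times m U.measU U2.measU)+
  qed
  have lim: "(V \<longlongrightarrow> 0) at_top" "(V \<longlongrightarrow> 0) at_bot"
    using ground_state_conv_lim[OF gs] by (simp_all add: V_def)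
  have le: "\<bar>conv_deriv U2 x\<bar> \<le> V x" for x
    using U2.conv_deriv_le_conv[of x] U2 by (simp add: eq)
  have "positive_homoclinic hm {0..g \<beta>} V"
    unfolding positive_homoclinic_def solves_def
  proof (intro conjI allI exI[of _ "conv_deriv U2"] ballI)
    fix x
    show "0 < V x" using ground_state_conv_pos[OF gs] by (simp add: V_def)
    show "V x \<in> {0..g \<beta>}" by (rule rng)
    show "(V has_real_derivative conv_deriv U2 x) (at x within UNIV)"
      using U2.conv_has_deriv[of x] by (simp add: eq)
    show "\<exists>V2. (conv_deriv U2 has_real_derivative V2) (at x within UNIV) \<and> V x - V2 = hm (V x)"
      using U2.conv_deriv_has_deriv[OF cU2, of x] unfolding eq
      by (intro exI[of _ "V x - U2 x"]) (auto simp: U2_def)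
    show "(conv_deriv U2 \<longlongrightarrow> 0) at_top" "(conv_deriv U2 \<longlongrightarrow> 0) at_bot"
      by (rule Lim_null_comparison[OF _ lim(1)], simp add: le,
          rule Lim_null_comparison[OF _ lim(2)], simp add: le)
  qed (rule lim)+
  moreover have "even_fun V"
    using ground_state_conv_even[OF gs] by (simp add: V_def even_fun_def)
  ultimately have "V = Vs" by (rule homoclinic_unique_even)
  then show ?thesis
    using off by (intro AE_off_finite[OF \<open>finite P\<close>]) (simp add: Us_def)
qed

section \<open>The potential of the plus branch\<close>

lemma hp_gt: assumes "g \<gamma> \<le> v" "v < 1" shows "v < hp v"
proof -
  have r: "\<gamma> \<le> hp v" "hp v \<le> 1" "g (hp v) = v" using assms hp_range g_hp by auto
  then have "hp v < 1" using g1 assms by (cases "hp v = 1") auto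
  then show ?thesis using g_lt[of "hp v"] r a_less_\<beta> \<beta>\<gamma> by simp
qed

lemma dGp_within:
  assumes "g \<gamma> \<le> v" "v \<le> 1"
  shows "(Gp has_real_derivative hp v - v) (at v within {g \<gamma>..1})"
proof -
  have "((\<lambda>V. integral {V..1} hp) has_real_derivative - hp v) (at v within {g \<gamma>..1})"
    using assms by (intro integral_has_real_derivative' hp_cont) auto
  then show ?thesis
    unfolding G_plus_def[abs_def] by (auto intro!: derivative_eq_intros)
qed

lemma dGp_within': "\<forall>v\<in>{g \<gamma>..1}. (Gp has_real_derivative hp v - v) (at v within {g \<gamma>..1})"
  by (simp add: dGp_within)

lemmas plus_energy_const = energy_const[OF dGp_within']

lemma dGp: assumes "g \<gamma> < v" "v < 1" shows "(Gp has_real_derivative hp v - v) (at v)"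
  using dGp_within[of v] assms by (simp add: at_within_Icc_at)

lemma Gp_cont: "continuous_on {g \<gamma>..1} Gp"
  by (rule DERIV_continuous_on) (rule dGp_within, auto)

lemma Gp_inc: assumes "g \<gamma> \<le> v" "v < w" "w \<le> 1" shows "Gp v < Gp w"
proof (rule DERIV_pos_imp_increasing_open[OF assms(2)])
  show "\<exists>y. (Gp has_real_derivative y) (at x) \<and> 0 < y" if "v < x" "x < w" for x
    using dGp[of x] hp_gt[of x] that assms by (intro exI[of _ "hp x - x"]) auto
  show "continuous_on {v..w} Gp"
    using assms by (intro continuous_on_subset[OF Gp_cont]) auto
qed

lemma Gp_le_iff:
  assumes "g \<gamma> \<le> v" "v \<le> 1" "g \<gamma> \<le> w" "w \<le> 1"
  shows "Gp v \<le> Gp w \<longleftrightarrow> v \<le> w"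
  using assms Gp_inc[of v w] Gp_inc[of w v] by (cases v w rule: linorder_cases) auto

end

subsection \<open>The family with two jumps\<close>

locale bistable_jump = bistable +
  fixes v0 :: real
  assumes v0_pos: "0 < v0" and v0_ge: "g \<gamma> \<le> v0" and v0_less: "v0 < vm"
begin

abbreviation "E \<equiv> inner_energy g \<beta> \<gamma> v0"

lemma vm_less1: "vm < 1" using vm_g\<beta> g\<beta>_less1 by simp
lemma v0_less1: "v0 < 1" using v0_less vm_less1 by simp
lemma Gm_v0: "Gm v0 < 0" using Gm_neg v0_pos v0_less by simp

lemma E_gt: "Gp v0 < E" using Gm_v0 by (simp add: inner_energy_def)

text \<open>The derivative of \<open>Gm - Gp\<close> is
  \<open>hm - hp <= \<beta> - \<gamma> < 0\<close>. Since \<open>Gm vm = 0\<close>, this gives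
  \<open>E < Gp vm < Gp 1\<close>: the inner level is hit strictly before the end of the
  branch.\<close>

lemma E_less: "E < Gp 1"
proof -
  have "Gm vm - Gp vm < Gm v0 - Gp v0"
  proof (rule DERIV_neg_imp_decreasing_open[OF v0_less, of "\<lambda>v. Gm v - Gp v"])
    show "continuous_on {v0..vm} (\<lambda>v. Gm v - Gp v)"
      using v0_pos v0_ge vm_g\<beta> vm_less1
      by (intro continuous_on_diff continuous_on_subset[OF Gm_cont] continuous_on_subset[OF Gp_cont]) auto
    fix x assume x: "v0 < x" "x < vm"
    have "hm x \<le> \<beta>" "\<gamma> \<le> hp x" using x hm_range[of x] hp_range[of x] v0_pos v0_ge vm_g\<beta> vm_less1 by auto
    moreover have "((\<lambda>v. Gm v - Gp v) has_real_derivative (hm x - x) - (hp x - x)) (at x)"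
      using x v0_pos v0_ge vm_g\<beta> vm_less1 by (intro DERIV_diff dGm dGp) auto
    ultimately show "\<exists>y. ((\<lambda>v. Gm v - Gp v) has_real_derivative y) (at x) \<and> y < 0"
      using \<beta>\<gamma> by (intro exI conjI) auto
  qed
  moreover have "Gp vm < Gp 1" using Gp_inc[of vm 1] vm_less1 v0_ge v0_less by simp
  ultimately show ?thesis using Gm_vm by (simp add: inner_energy_def)
qed

abbreviation "vs \<equiv> v_star g \<beta> \<gamma> v0"

lemma v_star_props: "is_v_star g \<beta> \<gamma> v0 vs \<and> vs < 1"
proof -
  have "continuous_on {v0..1} Gp" using v0_ge by (intro continuous_on_subset[OF Gp_cont]) auto
  then obtain v where v: "v0 \<le> v" "v \<le> 1" "Gp v = E"
    using IVT'[of Gp v0 E 1] E_gt E_less v0_less1 by auto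
  have v': "v0 < v" "v < 1" using v E_gt E_less by (auto simp: less_le)
  have st: "is_v_star g \<beta> \<gamma> v0 v"
    unfolding is_v_star_def using v v' v0_ge Gp_inc[of _ v] by auto
  have "vs = v"
    unfolding v_star_def
  proof (rule the_equality[where P = "is_v_star g \<beta> \<gamma> v0", OF st])
    fix w assume "is_v_star g \<beta> \<gamma> v0 w"
    then have w: "v0 < w" "w \<le> 1" "Gp w = Gp v" unfolding is_v_star_def using v by auto
    show "w = v"
      using Gp_le_iff[of v w] Gp_le_iff[of w v] w v v0_ge by auto
  qed
  then show ?thesis using st v' by simp
qed

lemma is_vs: "is_v_star g \<beta> \<gamma> v0 vs" and vs_less1: "vs < 1"
  using v_star_props by auto

lemma v0_vs: "v0 < vs" and Gp_vs: "Gp vs = E"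
  using is_vs unfolding is_v_star_def by auto

text \<open>The branch \<open>hp\<close> is extended constantly to the left of \<open>g \<gamma>\<close>, so that all derivatives on
  \<open>{v0..vs}\<close> are two-sided, also when \<open>v0 = g \<gamma>\<close>.\<close>

definition "k w = hp (max (g \<gamma>) w) - w"
definition "Fp v = 2 * (integral {v0 - 1..vs} k - integral {v0 - 1..v} k)"
definition "Fp' v = - 2 * k v"

lemma k_pos: "w < 1 \<Longrightarrow> 0 < k w"
  using hp_gt[of "max (g \<gamma>) w"] g\<gamma>_less1 by (auto simp: k_def max_def split: if_splits)

lemma k_cont: "continuous_on {..1} k"
  unfolding k_def using g\<gamma>_less1
  by (intro continuous_on_diff continuous_on_id continuous_on_compose2[OF hp_cont] continuous_intros) auto

lemma dk: assumes "v0 - 1 < v" "v < 1"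
  shows "((\<lambda>v. integral {v0 - 1..v} k) has_real_derivative k v) (at v)"
proof -
  have "((\<lambda>v. integral {v0 - 1..v} k) has_real_derivative k v) (at v within {v0 - 1..1})"
    using assms by (intro integral_has_real_derivative continuous_on_subset[OF k_cont]) auto
  then show ?thesis using assms by (simp add: at_within_Icc_at)
qed

lemma k_int_cont: "v0 - 1 < v \<Longrightarrow> w < 1 \<Longrightarrow> continuous_on {v..w} (\<lambda>v. integral {v0 - 1..v} k)"
  by (auto intro!: continuous_at_imp_continuous_on DERIV_isCont[OF dk])

text \<open>The left end is any level strictly below \<open>v0\<close>; then \<open>v0\<close> and
  the time at which it is passed are interior, and the formulas for the derivatives hold there
  two-sidedly.\<close>

sublocale pw: potential_well Fp Fp' "v0 - 1" vs
proof
  show "(Fp has_real_derivative Fp' v) (at v)" if "v0 - 1 < v" "v \<le> vs" for v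
    unfolding Fp_def[abs_def] Fp'_def using that vs_less1
    by (auto intro!: derivative_eq_intros dk)
  show "0 < Fp v" if "v0 - 1 < v" "v < vs" for v
  proof -
    have "integral {v0 - 1..v} k < integral {v0 - 1..vs} k"
    proof (rule DERIV_pos_imp_increasing_open[OF that(2)])
      show "\<exists>y. ((\<lambda>v. integral {v0 - 1..v} k) has_real_derivative y) (at x) \<and> 0 < y"
        if "v < x" "x < vs" for x
        using dk[of x] k_pos[of x] that \<open>v0 - 1 < v\<close> vs_less1 by (intro exI[of _ "k x"]) auto
    qed (rule k_int_cont[OF that(1) vs_less1])
    then show ?thesis by (simp add: Fp_def)
  qed
qed (use v0_vs k_pos[OF vs_less1] in \<open>auto simp: Fp_def Fp'_def\<close>)

lemma Fp_eq: assumes "v0 \<le> v" "v \<le> vs" shows "Fp v = 2 * (E - Gp v)"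
proof (cases "v = vs")
  case False
  then have "v < vs" using assms by simp
  then have "(\<lambda>v. integral {v0 - 1..v} k - Gp v) vs = (\<lambda>v. integral {v0 - 1..v} k - Gp v) v"
  proof (rule DERIV_isconst_end)
    show "continuous_on {v..vs} (\<lambda>v. integral {v0 - 1..v} k - Gp v)"
      using assms v0_ge vs_less1
      by (intro continuous_on_diff k_int_cont continuous_on_subset[OF Gp_cont]) auto
    fix x assume x: "v < x" "x < vs"
    have "((\<lambda>v. integral {v0 - 1..v} k - Gp v) has_real_derivative k x - (hp x - x)) (at x)"
      using x assms v0_ge vs_less1 by (intro DERIV_diff dk dGp) auto
    then show "((\<lambda>v. integral {v0 - 1..v} k - Gp v) has_real_derivative 0) (at x)"
      using x assms v0_ge by (simp add: k_def max_def)
  qed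
  then show ?thesis using Gp_vs by (simp add: Fp_def)
qed (use Gp_vs in \<open>simp add: Fp_def\<close>)

lemma Fp'_eq: assumes "v0 \<le> v" shows "Fp' v / 2 = v - hp v"
  using assms v0_ge by (simp add: Fp'_def k_def max_def)

abbreviation "x0 \<equiv> jump_point g \<beta> \<gamma> v0"

lemma travel_has_integral: "(travel_integrand g \<beta> \<gamma> v0 has_integral pw.T v0) {v0..vs}"
  by (rule has_integral_eq[OF _ pw.travel_time])
    (use v0_vs in \<open>auto simp: travel_integrand_def Fp_eq\<close>)

lemma x0_eq: "x0 = pw.T v0"
  unfolding jump_point_def using travel_has_integral by (rule integral_unique)

lemma x0_pos: "0 < x0"
  using pw.T_less[of v0 vs] pw.T_m v0_vs by (simp add: x0_eq)

abbreviation "Vp \<equiv> pw.V"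
abbreviation "Wp \<equiv> pw.Vd"

lemma x0_X: "x0 \<in> pw.X" using pw.T_X[of v0] v0_vs by (simp add: x0_eq)

lemma in_X: "\<bar>x\<bar> \<le> x0 \<Longrightarrow> x \<in> pw.X"
  using pw.X_convex[OF x0_X] by simp

lemma Vp_x0: "Vp x0 = v0" using pw.V_T[of v0] v0_vs by (simp add: x0_eq)

lemma Vp_gt: assumes "\<bar>x\<bar> < x0" shows "v0 < Vp x"
proof (rule ccontr)
  assume "\<not> v0 < Vp x"
  then have "pw.T v0 \<le> pw.T (Vp x)"
    using pw.T_less[of "Vp x" v0] pw.V_range[OF in_X] assms v0_vs by (cases "Vp x = v0") auto
  then show False using pw.T_V[OF in_X, of x] assms by (simp add: x0_eq)
qed

lemma Vp_range: assumes "\<bar>x\<bar> \<le> x0" shows "v0 \<le> Vp x" "Vp x \<le> vs"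
proof -
  show "Vp x \<le> vs" using pw.V_range[OF in_X[OF assms]] by simp
  show "v0 \<le> Vp x"
  proof (cases "\<bar>x\<bar> = x0")
    case True
    then have "x = x0 \<or> x = - x0" by linarith
    then show ?thesis using Vp_x0 pw.V_even[OF x0_X] by auto
  qed (use assms Vp_gt[of x] in auto)
qed

lemma dVp: "\<bar>x\<bar> \<le> x0 \<Longrightarrow> (Vp has_real_derivative Wp x) (at x)"
  by (rule pw.dV[OF in_X])

lemma dWp: "\<bar>x\<bar> \<le> x0 \<Longrightarrow> (Wp has_real_derivative Vp x - hp (Vp x)) (at x)"
  using pw.dVd[OF in_X, of x] Fp'_eq[OF Vp_range(1), of x] by simp

lemma Wp_energy: "\<bar>x\<bar> \<le> x0 \<Longrightarrow> (Wp x)\<^sup>2 / 2 + Gp (Vp x) = E"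
  using pw.Vd_sq[OF in_X, of x] Fp_eq[OF Vp_range, of x] by (simp add: field_simps)

lemma Wp_x0: "Wp x0 = - sqrt (- 2 * Gm v0)"
  using pw.Vd_pos_arg[OF x0_X x0_pos] Vp_x0 Fp_eq[of v0] v0_vs by (simp add: inner_energy_def)

text \<open>The half-length \<open>p\<close> is not prescribed. The energy keeps
  \<open>W <= vs < 1\<close>, where \<open>W'' = W - hp W < 0\<close>, so \<open>W\<close> falls
  from \<open>W 0 = vs\<close> and its travel time at \<open>x\<close> is exactly \<open>x\<close>.
  Reading this at \<open>p\<close> yields \<open>p = x0\<close>.\<close>

lemma inner_orbit:
  assumes p: "0 < p" and cW: "continuous_on {0..p} W" and cW': "continuous_on {0..p} W'"
    and dW: "\<And>x. 0 < x \<Longrightarrow> x < p \<Longrightarrow> (W has_real_derivative W' x) (at x)"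
    and dW': "\<And>x. 0 < x \<Longrightarrow> x < p \<Longrightarrow> (W' has_real_derivative W x - hp (W x)) (at x)"
    and W'0: "W' 0 = 0" and rng: "\<And>x. x \<in> {0..p} \<Longrightarrow> W x \<in> {g \<gamma>..1}"
    and en: "\<And>x. x \<in> {0..p} \<Longrightarrow> (W' x)\<^sup>2 / 2 + Gp (W x) = E" and Wp: "W p = v0"
  shows "p = x0" and "x \<in> {0..p} \<Longrightarrow> W x = Vp x"
proof -
  have le: "W x \<le> vs" if "x \<in> {0..p}" for x
  proof -
    have "Gp (W x) \<le> E" using en[OF that] zero_le_power2[of "W' x"] by linarith
    then have "Gp (W x) \<le> Gp vs" using Gp_vs by simp
    then show ?thesis
      using Gp_le_iff[of "W x" vs] rng[OF that] v0_ge v0_vs vs_less1 by simp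
  qed
  have neg: "W' x < 0" if "0 < x" "x \<le> p" for x
  proof -
    have "W' x < W' 0"
    proof (rule DERIV_neg_imp_decreasing_open[OF that(1)])
      show "continuous_on {0..x} W'" using that by (intro continuous_on_subset[OF cW']) auto
      show "\<exists>D. (W' has_real_derivative D) (at y) \<and> D < 0" if "0 < y" "y < x" for y
        using dW'[of y] hp_gt[of "W y"] rng[of y] le[of y] vs_less1 that \<open>x \<le> p\<close>
        by (intro exI[of _ "W y - hp (W y)"]) auto
    qed
    then show ?thesis using W'0 by simp
  qed
  have dec: "W y < W x" if "0 \<le> x" "x < y" "y \<le> p" for x y
  proof (rule DERIV_neg_imp_decreasing_open[OF that(2)])
    show "continuous_on {x..y} W" using that by (intro continuous_on_subset[OF cW]) auto
    show "\<exists>D. (W has_real_derivative D) (at z) \<and> D < 0" if "x < z" "z < y" for z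
      using dW[of z] neg[of z] that \<open>0 \<le> x\<close> \<open>y \<le> p\<close> by (intro exI[of _ "W' z"]) auto
  qed
  have ge: "v0 \<le> W x" if "x \<in> {0..p}" for x
    using dec[of x p] that Wp by (cases "x = p") auto
  have "Gp (W 0) = Gp vs" using en[of 0] W'0 p Gp_vs by simp
  then have W0: "W 0 = vs"
    using Gp_le_iff[of "W 0" vs] Gp_le_iff[of vs "W 0"] rng[of 0] p v0_ge v0_vs vs_less1 by simp
  have T: "pw.T (W x) = x" if x: "x \<in> {0..p}" for x
  proof -
    have "pw.T (W x) = pw.T (W 0) + (x - 0)"
    proof (rule pw.T_along)
      show "continuous_on {0..x} W" using x by (intro continuous_on_subset[OF cW]) auto
      fix z assume z: "0 < z" "z < x"
      then have zp: "z \<in> {0..p}" using x by auto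
      have "Fp (W z) = (W' z)\<^sup>2"
        using en[OF zp] Fp_eq[OF ge le, OF zp zp] by (simp add: field_simps)
      then have "sqrt (Fp (W z)) = \<bar>W' z\<bar>" by simp
      then show "(W has_real_derivative - sqrt (Fp (W z))) (at z)"
        using dW[of z] neg[of z] z x by simp
      show "v0 - 1 < W z \<and> W z < vs" using ge[OF zp] dec[of 0 z] z x W0 by auto
    qed (use x ge[OF x] le[OF x] W0 v0_vs in auto)
    then show ?thesis using W0 pw.T_m by simp
  qed
  show "p = x0" using T[of p] Wp p by (simp add: x0_eq)
  show "W x = Vp x" if x: "x \<in> {0..p}"
    using pw.V_T[of "W x"] T[OF x] ge[OF x] le[OF x] by simp
qed

section \<open>The inner and outer solutions as definite functions\<close>

definition "Vplus x = (if \<bar>x\<bar> \<le> x0 then Vp x else 0)"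

lemma at_within_x0: "\<bar>x\<bar> < x0 \<Longrightarrow> at x within {-x0..x0} = at x"
  by (rule at_within_interior) (auto simp: interior_atLeastAtMost_real)

lemma Vplus_is_V_plus: "is_V_plus g \<beta> \<gamma> v0 Vplus"
  unfolding is_V_plus_def Let_def solves_def
proof (intro conjI exI[of _ Wp] ballI)
  show "even_fun Vplus" using pw.V_even[OF in_X] by (auto simp: even_fun_def Vplus_def)
  show "\<forall>x. x0 < \<bar>x\<bar> \<longrightarrow> Vplus x = 0" by (simp add: Vplus_def)
  show "Vplus 0 = vs" using x0_pos pw.V_0 by (simp add: Vplus_def)
  show "Vplus x0 = v0" "Vplus (- x0) = v0"
    using x0_pos Vp_x0 pw.V_even[OF x0_X] by (simp_all add: Vplus_def)
  show "Wp x0 = - sqrt (- 2 * Gm v0)" "Wp (- x0) = sqrt (- 2 * Gm v0)"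
    using Wp_x0 pw.Vd_odd[OF x0_X] by simp_all
  fix x assume "x \<in> {-x0..x0}"
  then have x: "\<bar>x\<bar> \<le> x0" by auto
  then have eq: "Vplus x = Vp x" by (simp add: Vplus_def)
  show "Vplus x \<in> {g \<gamma>..1}" using Vp_range[OF x] v0_ge vs_less1 eq by simp
  show "(Vplus has_real_derivative Wp x) (at x within {-x0..x0})"
    by (rule has_field_derivative_transform_within[OF has_field_derivative_at_within[OF dVp[OF x]] zero_less_one])
      (use x in \<open>auto simp: Vplus_def\<close>)
  show "\<exists>V2. (Wp has_real_derivative V2) (at x within {-x0..x0}) \<and> Vplus x - V2 = hp (Vplus x)"
    using has_field_derivative_at_within[OF dWp[OF x]] eq by (intro exI[of _ "Vp x - hp (Vp x)"]) auto
  show "(Wp x)\<^sup>2 / 2 + Gp (Vplus x) = E" using Wp_energy[OF x] eq by simp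
qed

text \<open>The energy at \<open>V 0 = vs\<close> gives \<open>V' 0 = 0\<close>, so
  \<open>inner_orbit\<close> determines the right half; evenness does the rest.\<close>

lemma V_plus_unique:
  assumes "is_V_plus g \<beta> \<gamma> v0 V" shows "V = Vplus"
proof -
  from assms obtain V' where ev: "even_fun V" and out: "\<And>x. x0 < \<bar>x\<bar> \<Longrightarrow> V x = 0"
    and V0: "V 0 = vs" and Vx0: "V x0 = v0"
    and sol: "solves hp {g \<gamma>..1} {-x0..x0} V V'"
    and en: "\<And>x. x \<in> {-x0..x0} \<Longrightarrow> (V' x)\<^sup>2 / 2 + Gp (V x) = E"
    unfolding is_V_plus_def Let_def by blast
  have dV: "(V has_real_derivative V' x) (at x within {-x0..x0})" if "x \<in> {-x0..x0}" for x
    using sol that unfolding solves_def by auto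
  have dV': "(V' has_real_derivative V x - hp (V x)) (at x within {-x0..x0})" if x: "x \<in> {-x0..x0}" for x
  proof -
    obtain V2 where "(V' has_real_derivative V2) (at x within {-x0..x0})" "V x - V2 = hp (V x)"
      using sol x unfolding solves_def by blast
    moreover from this have "V2 = V x - hp (V x)" by simp
    ultimately show ?thesis by simp
  qed
  have "continuous_on {-x0..x0} V" by (rule DERIV_continuous_on) (rule dV)
  then have cV: "continuous_on {0..x0} V" by (rule continuous_on_subset) auto
  have "continuous_on {-x0..x0} V'" by (rule DERIV_continuous_on) (rule dV')
  then have cV': "continuous_on {0..x0} V'" by (rule continuous_on_subset) auto
  have V'0: "V' 0 = 0" using en[of 0] V0 Gp_vs x0_pos by simp
  have half: "V x = Vp x" if x: "x \<in> {0..x0}" for x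
  proof (rule inner_orbit(2)[OF x0_pos cV cV' _ _ V'0 _ _ Vx0 x])
    fix z assume z: "0 < z" "z < x0"
    then have "at z within {-x0..x0} = at z" by (intro at_within_x0) auto
    then show "(V has_real_derivative V' z) (at z)" "(V' has_real_derivative V z - hp (V z)) (at z)"
      using dV[of z] dV'[of z] z by auto
  next
    fix z assume "z \<in> {0..x0}"
    then show "V z \<in> {g \<gamma>..1}" "(V' z)\<^sup>2 / 2 + Gp (V z) = E"
      using sol en[of z] unfolding solves_def by auto
  qed
  show ?thesis
  proof
    fix x show "V x = Vplus x"
    proof (cases "\<bar>x\<bar> \<le> x0")
      case True
      then have "V \<bar>x\<bar> = Vp \<bar>x\<bar>" by (intro half) auto
      then show ?thesis
        using ev pw.V_even[OF in_X[OF True]] True by (auto simp: even_fun_def Vplus_def abs_if split: if_splits)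
    qed (simp add: out Vplus_def)
  qed
qed

lemma V_plus_eq: "V_plus g \<beta> \<gamma> v0 = Vplus"
  unfolding V_plus_def
  by (rule the_equality[where P = "is_V_plus g \<beta> \<gamma> v0", OF Vplus_is_V_plus V_plus_unique])

text \<open>The time at which the homoclinic orbit falls through \<open>v0\<close>. The shift
  \<open>sh = x0 - c0\<close>, of either sign, moves that passage to the jump point.\<close>

definition "c0 = mw.T v0"
definition "sh = x0 - c0"
definition "Vminus x = (if \<bar>x\<bar> < x0 then 0 else Vs (\<bar>x\<bar> - sh))"

lemma c0_pos: "0 < c0"
  using mw.T_less[of v0 vm] mw.T_m v0_pos v0_less by (simp add: c0_def)

lemma Vs_c0: "Vs c0 = v0" using Vs_T v0_pos v0_less by (simp add: c0_def)

lemma Ws_neg: assumes "0 < x" shows "Ws x = - sqrt (- 2 * Gm (Vs x))"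
  using mw.Vd_pos_arg[of x] assms by (simp add: mw_X Fm_def)

lemma Ws_c0: "Ws c0 = - sqrt (- 2 * Gm v0)" using Ws_neg[OF c0_pos] Vs_c0 by simp

lemma Vs_energy: "(Ws x)\<^sup>2 / 2 + Gm (Vs x) = 0" using Ws_sq[of x] by simp

definition "Wminus x = sgn x * Ws (\<bar>x\<bar> - sh)"

lemma dVs_abs: assumes "x \<noteq> 0"
  shows "((\<lambda>x. Vs (\<bar>x\<bar> - sh)) has_real_derivative Wminus x) (at x)"
    and "(Wminus has_real_derivative Vs (\<bar>x\<bar> - sh) - hm (Vs (\<bar>x\<bar> - sh))) (at x)"
proof -
  \<comment> \<open>The open half-line on the side of \<open>x\<close>, where
    \<open>\<bar>y\<bar> = sgn x * y\<close>.\<close>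
  have op: "open {y. 0 < y * x}" by (intro open_Collect_less continuous_intros)
  have mem: "x \<in> {y. 0 < y * x}" using assms by (auto simp: zero_less_mult_iff)
  have "((\<lambda>y. sgn x * y - sh) has_real_derivative sgn x) (at x)"
    by (auto intro!: derivative_eq_intros)
  then have abs: "((\<lambda>x. \<bar>x\<bar> - sh) has_real_derivative sgn x) (at x)"
    by (rule has_field_derivative_transform_within_open[OF _ op mem])
      (auto simp: sgn_real_def zero_less_mult_iff)
  show "((\<lambda>x. Vs (\<bar>x\<bar> - sh)) has_real_derivative Wminus x) (at x)"
    using DERIV_chain2[OF dVs abs] by (simp add: Wminus_def mult.commute)
  have "((\<lambda>y. sgn x * Ws (\<bar>y\<bar> - sh)) has_real_derivative
      sgn x * ((Vs (\<bar>x\<bar> - sh) - hm (Vs (\<bar>x\<bar> - sh))) * sgn x)) (at x)"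
    by (intro DERIV_cmult DERIV_chain2[OF dWs abs])
  moreover have "sgn x * (c * sgn x) = c" for c :: real
    using assms by (simp add: sgn_real_def)
  ultimately have *: "((\<lambda>y. sgn x * Ws (\<bar>y\<bar> - sh)) has_real_derivative
      Vs (\<bar>x\<bar> - sh) - hm (Vs (\<bar>x\<bar> - sh))) (at x)" by simp
  have "sgn x * Ws (\<bar>y\<bar> - sh) = Wminus y" if "y \<in> {y. 0 < y * x}" for y
    using that by (auto simp: Wminus_def sgn_real_def zero_less_mult_iff)
  then show "(Wminus has_real_derivative Vs (\<bar>x\<bar> - sh) - hm (Vs (\<bar>x\<bar> - sh))) (at x)"
    by (rule has_field_derivative_transform_within_open[OF * op mem])
qed

lemma Vminus_is_V_minus: "is_V_minus g \<beta> \<gamma> v0 Vminus"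
  unfolding is_V_minus_def Let_def solves_def
proof (intro conjI exI[of _ Wminus] ballI allI impI)
  have sh: "x0 - sh = c0" by (simp add: sh_def)
  show "even_fun Vminus" by (simp add: even_fun_def Vminus_def)
  show "Vminus x = 0" if "\<bar>x\<bar> < x0" for x using that by (simp add: Vminus_def)
  show "Vminus x0 = v0" "Vminus (- x0) = v0" using x0_pos Vs_c0 sh by (simp_all add: Vminus_def)
  show "Wminus x0 = - sqrt (- 2 * Gm v0)" "Wminus (- x0) = sqrt (- 2 * Gm v0)"
    using Ws_c0 x0_pos sh by (simp_all add: Wminus_def)
  have ev: "\<forall>\<^sub>F x in at_top. Vs (\<bar>x\<bar> - sh) = Vminus x"
    by (rule eventually_mono[OF eventually_ge_at_top[of x0]]) (simp add: Vminus_def)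
  show "(Vminus \<longlongrightarrow> 0) at_top"
    by (rule Lim_transform_eventually[OF abs_tendsto(1)[OF Vs_tendsto] ev])
  then show "(Vminus \<longlongrightarrow> 0) at_bot"
    by (rule tendsto_even_at_bot) (simp add: Vminus_def)
  fix x
  have eq: "Vminus x = Vs (\<bar>x\<bar> - sh)" if "x0 \<le> \<bar>x\<bar>" using that by (simp add: Vminus_def)
  show "(Wminus x)\<^sup>2 / 2 + Gm (Vminus x) = 0" if "x0 \<le> \<bar>x\<bar>"
    using Vs_energy[of "\<bar>x\<bar> - sh"] that x0_pos eq
    by (auto simp: Wminus_def power_mult_distrib sgn_real_def)
  assume "x \<in> {x. x0 \<le> \<bar>x\<bar>}"
  then have x: "x0 \<le> \<bar>x\<bar>" "x \<noteq> 0" using x0_pos by auto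
  show "Vminus x \<in> {0..g \<beta>}" using Vs_range(3) eq x by simp
  show "(Vminus has_real_derivative Wminus x) (at x within {x. x0 \<le> \<bar>x\<bar>})"
    by (rule has_field_derivative_transform_within[OF has_field_derivative_at_within[OF dVs_abs(1)[OF x(2)]] zero_less_one])
      (use x in \<open>auto simp: Vminus_def\<close>)
  show "\<exists>V2. (Wminus has_real_derivative V2) (at x within {x. x0 \<le> \<bar>x\<bar>}) \<and> Vminus x - V2 = hm (Vminus x)"
    using has_field_derivative_at_within[OF dVs_abs(2)[OF x(2)]] eq x
    by (intro exI[of _ "Vs (\<bar>x\<bar> - sh) - hm (Vs (\<bar>x\<bar> - sh))"]) auto
qed

text \<open>The prescribed slope at \<open>x0\<close> is negative because \<open>Gm v0 < 0\<close>,
  so \<open>falling_orbit\<close> starts at \<open>x0\<close>.\<close>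

lemma V_minus_unique:
  assumes "is_V_minus g \<beta> \<gamma> v0 V" shows "V = Vminus"
proof -
  let ?X = "{x. x0 \<le> \<bar>x\<bar>}"
  from assms obtain V' where ev: "even_fun V" and inn: "\<And>x. \<bar>x\<bar> < x0 \<Longrightarrow> V x = 0"
    and Vx0: "V x0 = v0" and sol: "solves hm {0..g \<beta>} ?X V V'"
    and en: "\<And>x. x0 \<le> \<bar>x\<bar> \<Longrightarrow> (V' x)\<^sup>2 / 2 + Gm (V x) = 0"
    and V'x0: "V' x0 = - sqrt (- 2 * Gm v0)"
    unfolding is_V_minus_def Let_def by blast
  have sub: "{x0..} \<subseteq> ?X" by auto
  have half: "V x = Vs (x - sh)" if x: "x0 \<le> x" for x
  proof -
    have "V x = Vs (x - x0 + mw.T (V x0))"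
    proof (rule falling_orbit[where W' = V'])
      show "(V has_real_derivative V' z) (at z within {x0..})" if "x0 \<le> z" for z
        using sol that sub unfolding solves_def by (intro DERIV_subset[OF _ sub]) auto
      have "V' differentiable (at z within ?X)" if "z \<in> ?X" for z
        using sol that unfolding solves_def real_differentiable_def by blast
      then have "continuous_on ?X V'"
        by (intro differentiable_imp_continuous_on) (auto simp: differentiable_on_def)
      then show "continuous_on {x0..} V'" using sub by (rule continuous_on_subset)
      show "(V' z)\<^sup>2 = - 2 * Gm (V z)" if "x0 \<le> z" for z using en[of z] that x0_pos by simp
      show "0 \<le> V z" if "x0 \<le> z" for z using sol that unfolding solves_def by auto
      show "V' x0 < 0" using V'x0 Gm_v0 by simp
    qed (use Vx0 v0_pos v0_less x in auto)
    then show ?thesis using Vx0 by (simp add: sh_def c0_def algebra_simps)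
  qed
  show ?thesis
  proof
    fix x show "V x = Vminus x"
    proof (cases "\<bar>x\<bar> < x0")
      case False
      have "V x = V \<bar>x\<bar>" using ev by (simp add: even_fun_def abs_if)
      then show ?thesis using half[of "\<bar>x\<bar>"] False by (simp add: Vminus_def)
    qed (simp add: inn Vminus_def)
  qed
qed

lemma V_minus_eq: "V_minus g \<beta> \<gamma> v0 = Vminus"
  unfolding V_minus_def
  by (rule the_equality[where P = "is_V_minus g \<beta> \<gamma> v0", OF Vminus_is_V_minus V_minus_unique])

section \<open>The glued profile\<close>

abbreviation "Uj \<equiv> U_jump g \<beta> \<gamma> v0"

lemma Uj_eq: "Uj x = (if \<bar>x\<bar> < x0 then hp (Vp x) else hm (Vs (\<bar>x\<bar> - sh)))"
  by (simp add: U_jump_def V_plus_eq V_minus_eq Vplus_def Vminus_def)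

text \<open>The convolution of \<open>Uj\<close> and its derivative, guessed by gluing. Value and
  slope match at the jump points, so both functions are continuous although \<open>Uj\<close> is
  not.\<close>

definition "VJ x = (if \<bar>x\<bar> \<le> x0 then Vp x else Vs (\<bar>x\<bar> - sh))"
definition "WJ x = (if \<bar>x\<bar> \<le> x0 then Wp x else Wminus x)"

lemma abs_x0_cases: "\<bar>x\<bar> = x0 \<Longrightarrow> x = x0 \<or> x = - x0" by linarith

lemma VJ_glue: "\<bar>x\<bar> = x0 \<Longrightarrow> Vp x = Vs (\<bar>x\<bar> - sh)"
  using Vp_x0 pw.V_even[OF x0_X] Vs_c0 abs_x0_cases[of x] by (auto simp: sh_def)

lemma WJ_glue: "\<bar>x\<bar> = x0 \<Longrightarrow> Wp x = Wminus x"
  using Wp_x0 pw.Vd_odd[OF x0_X] Ws_c0 abs_x0_cases[of x] x0_pos by (auto simp: sh_def Wminus_def)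

lemma UNIV_split: "UNIV = {x. \<bar>x\<bar> \<le> x0} \<union> {x. x0 \<le> \<bar>x\<bar>}" by auto

lemma VJ_cont: "continuous_on UNIV VJ"
  unfolding UNIV_split VJ_def[abs_def]
proof (rule continuous_on_cases)
  show "continuous_on {x. \<bar>x\<bar> \<le> x0} Vp"
    by (auto intro!: continuous_at_imp_continuous_on DERIV_isCont[OF dVp])
  show "continuous_on {x. x0 \<le> \<bar>x\<bar>} (\<lambda>x. Vs (\<bar>x\<bar> - sh))"
    using x0_pos by (auto intro!: continuous_at_imp_continuous_on DERIV_isCont[OF dVs_abs(1)])
qed (auto intro!: closed_Collect_le continuous_intros VJ_glue)

lemma WJ_cont: "continuous_on UNIV WJ"
  unfolding UNIV_split WJ_def[abs_def]
proof (rule continuous_on_cases)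
  show "continuous_on {x. \<bar>x\<bar> \<le> x0} Wp"
    by (auto intro!: continuous_at_imp_continuous_on DERIV_isCont[OF dWp])
  show "continuous_on {x. x0 \<le> \<bar>x\<bar>} Wminus"
    using x0_pos by (auto intro!: continuous_at_imp_continuous_on DERIV_isCont[OF dVs_abs(2)])
qed (auto intro!: closed_Collect_le continuous_intros WJ_glue)

lemma inner_open: "open {x. \<bar>x\<bar> < x0}" and outer_open: "open {x. x0 < \<bar>x\<bar>}"
  by (auto intro!: open_Collect_less continuous_intros)

lemma off_cases:
  assumes "x \<notin> {-x0, x0}"
  obtains "\<bar>x\<bar> < x0" | "x0 < \<bar>x\<bar>" "x \<noteq> 0"
  using assms x0_pos by (cases "\<bar>x\<bar>" x0 rule: linorder_cases) (auto dest: abs_x0_cases)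

text \<open>Strictly inside, \<open>Vp x > v0 >= g \<gamma>\<close>, so the profile stays off the
  critical point \<open>\<gamma>\<close> even when \<open>v0 = g \<gamma>\<close>; smoothness can
  fail only at the jump points.\<close>

lemma hp_Vp_props: assumes "\<bar>x\<bar> < x0"
  shows "((\<lambda>x. hp (Vp x)) has_real_derivative Wp x / deriv g (hp (Vp x))) (at x)"
    and "0 < deriv g (hp (Vp x))"
proof -
  have v: "g \<gamma> < Vp x" "Vp x < 1" using Vp_gt[OF assms] Vp_range[of x] assms v0_ge vs_less1 by auto
  have "((\<lambda>x. hp (Vp x)) has_real_derivative inverse (deriv g (hp (Vp x))) * Wp x) (at x)"
    by (rule DERIV_chain2[OF dhp dVp]) (use v assms in auto)
  then show "((\<lambda>x. hp (Vp x)) has_real_derivative Wp x / deriv g (hp (Vp x))) (at x)"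
    by (simp add: divide_inverse mult.commute)
  have "hp (g \<gamma>) < hp (Vp x)" using v by (intro hp_less) auto
  then show "0 < deriv g (hp (Vp x))"
    using hp_g[of \<gamma>] hp_range[of "Vp x"] \<gamma>_less v by (intro g'_plus) auto
qed

lemma hm_Vs_props: assumes "x \<noteq> 0"
  shows "((\<lambda>x. hm (Vs (\<bar>x\<bar> - sh))) has_real_derivative Wminus x / deriv g (hm (Vs (\<bar>x\<bar> - sh)))) (at x)"
    and "0 < deriv g (hm (Vs (\<bar>x\<bar> - sh)))"
proof -
  let ?v = "Vs (\<bar>x\<bar> - sh)"
  have "((\<lambda>x. hm (Vs (\<bar>x\<bar> - sh))) has_real_derivative inverse (deriv g (hm ?v)) * Wminus x) (at x)"
    by (rule DERIV_chain2[OF dhm dVs_abs(1)]) (use Vs_range[of "\<bar>x\<bar> - sh"] vm_g\<beta> assms in auto)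
  then show "((\<lambda>x. hm (Vs (\<bar>x\<bar> - sh))) has_real_derivative Wminus x / deriv g (hm ?v)) (at x)"
    by (simp add: divide_inverse mult.commute)
  show "0 < deriv g (hm ?v)"
    using Us_range[of "\<bar>x\<bar> - sh"] by (intro g'_minus) (auto simp: Us_def)
qed

lemma VJ_deriv: assumes "x \<notin> {-x0, x0}" shows "(VJ has_real_derivative WJ x) (at x)"
  using assms
proof (cases rule: off_cases)
  case 1
  then have "(Vp has_real_derivative WJ x) (at x)" using dVp[of x] by (simp add: WJ_def)
  then show ?thesis
    by (rule has_field_derivative_transform_within_open[OF _ inner_open]) (use 1 in \<open>auto simp: VJ_def\<close>)
next
  case 2
  then have "((\<lambda>x. Vs (\<bar>x\<bar> - sh)) has_real_derivative WJ x) (at x)"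
    using dVs_abs(1)[of x] by (simp add: WJ_def)
  then show ?thesis
    by (rule has_field_derivative_transform_within_open[OF _ outer_open]) (use 2 in \<open>auto simp: VJ_def\<close>)
qed

lemma WJ_deriv: assumes "x \<notin> {-x0, x0}" shows "(WJ has_real_derivative VJ x - Uj x) (at x)"
  using assms
proof (cases rule: off_cases)
  case 1
  then have "(Wp has_real_derivative VJ x - Uj x) (at x)" using dWp[of x] by (simp add: VJ_def Uj_eq)
  then show ?thesis
    by (rule has_field_derivative_transform_within_open[OF _ inner_open]) (use 1 in \<open>auto simp: WJ_def\<close>)
next
  case 2
  then have "(Wminus has_real_derivative VJ x - Uj x) (at x)"
    using dVs_abs(2)[of x] by (simp add: VJ_def Uj_eq)
  then show ?thesis
    by (rule has_field_derivative_transform_within_open[OF _ outer_open]) (use 2 in \<open>auto simp: WJ_def\<close>)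
qed

lemma Uj_deriv_aux:
  assumes "x \<notin> {-x0, x0}"
  shows "(Uj has_real_derivative WJ x / deriv g (Uj x)) (at x) \<and> 0 < deriv g (Uj x)"
  using assms
proof (cases rule: off_cases)
  case 1
  then have "((\<lambda>x. hp (Vp x)) has_real_derivative WJ x / deriv g (Uj x)) (at x)"
    using hp_Vp_props(1)[of x] by (simp add: WJ_def Uj_eq)
  then have "(Uj has_real_derivative WJ x / deriv g (Uj x)) (at x)"
    by (rule has_field_derivative_transform_within_open[OF _ inner_open]) (use 1 in \<open>auto simp: Uj_eq\<close>)
  moreover have "0 < deriv g (Uj x)" using hp_Vp_props(2)[of x] 1 by (simp add: Uj_eq)
  ultimately show ?thesis ..
next
  case 2
  then have "((\<lambda>x. hm (Vs (\<bar>x\<bar> - sh))) has_real_derivative WJ x / deriv g (Uj x)) (at x)"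
    using hm_Vs_props(1)[of x] by (simp add: WJ_def Uj_eq)
  then have "(Uj has_real_derivative WJ x / deriv g (Uj x)) (at x)"
    by (rule has_field_derivative_transform_within_open[OF _ outer_open]) (use 2 in \<open>auto simp: Uj_eq\<close>)
  moreover have "0 < deriv g (Uj x)" using hm_Vs_props(2)[of x] 2 by (simp add: Uj_eq)
  ultimately show ?thesis ..
qed

lemmas Uj_deriv = conjunct1[OF Uj_deriv_aux] conjunct2[OF Uj_deriv_aux]

lemma Uj_smooth: "smooth_on_open (- {-x0, x0}) Uj"
proof (rule smooth_bootstrap[where V = VJ and W = WJ and g' = "deriv g"])
  show "open (- {-x0, x0})" by (intro open_Compl) simp
  show "deriv g (Uj x) \<noteq> 0" if "x \<in> - {-x0, x0}" for x using Uj_deriv(2)[of x] that by simp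
qed (use VJ_deriv WJ_deriv Uj_deriv Ck_deriv_g in auto)

lemma Uj_bounds: "0 < Uj x" "Uj x \<le> 1" and g_Uj: "g (Uj x) = VJ x" and Uj_even: "Uj (- x) = Uj x"
proof -
  have v: "g \<gamma> \<le> Vp x \<and> Vp x \<le> 1" if "\<bar>x\<bar> \<le> x0" using Vp_range[OF that] v0_ge vs_less1 by simp
  show "0 < Uj x" "Uj x \<le> 1"
    using v hp_range[of "Vp x"] \<beta>_pos \<beta>\<gamma> \<gamma>_less Us_range[of "\<bar>x\<bar> - sh"] by (auto simp: Uj_eq Us_def)
  show "g (Uj x) = VJ x"
  proof (cases "\<bar>x\<bar> < x0")
    case True
    then show ?thesis using v g_hp[of "Vp x"] by (simp add: Uj_eq VJ_def)
  next
    case False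
    then have "VJ x = Vs (\<bar>x\<bar> - sh)" using VJ_glue[of x] by (auto simp: VJ_def)
    then show ?thesis using g_Us[of "\<bar>x\<bar> - sh"] False by (simp add: Uj_eq Us_def)
  qed
  show "Uj (- x) = Uj x" using pw.V_even[OF in_X, of x] by (simp add: Uj_eq)
qed

lemma Uj_ground_state: "ground_state f d Uj"
proof -
  have "bounded (Wp ` {-x0..x0})"
    by (intro compact_imp_bounded compact_continuous_image)
      (auto intro!: continuous_at_imp_continuous_on DERIV_isCont[OF dWp])
  then obtain B where "\<forall>z\<in>Wp ` {-x0..x0}. norm z \<le> B" unfolding bounded_iff by blast
  then have B: "\<bar>Wp x\<bar> \<le> B" if "\<bar>x\<bar> \<le> x0" for x
  proof -
    have "x \<in> {-x0..x0}" using that by auto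
    then show ?thesis using \<open>\<forall>z\<in>Wp ` {-x0..x0}. norm z \<le> B\<close> by simp
  qed
  show ?thesis
  proof (rule ground_state_construct[where P = "{-x0, x0}" and V = VJ and W = WJ and B = "max B 1"])
    have V1: "\<bar>VJ x\<bar> \<le> 1" for x
      using Vp_range[of x] v0_pos vs_less1 Vs_range[of "\<bar>x\<bar> - sh"] vm_less1
      by (cases "\<bar>x\<bar> \<le> x0") (auto simp: VJ_def)
    have W1: "\<bar>Wminus x\<bar> \<le> 1" for x
      using Ws_le[of "\<bar>x\<bar> - sh"] Vs_range[of "\<bar>x\<bar> - sh"] vm_less1 by (auto simp: Wminus_def abs_mult sgn_real_def)
    show "\<bar>VJ x\<bar> \<le> max B 1" for x using V1[of x] by simp
    show "\<bar>WJ x\<bar> \<le> max B 1" for x using B[of x] W1[of x] by (simp add: WJ_def le_max_iff_disj)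
    show "isCont Uj x" if "x \<notin> {-x0, x0}" for x by (rule DERIV_isCont[OF Uj_deriv(1)[OF that]])
    show "VJ x \<in> {0..g \<beta>} \<and> Uj x = hm (VJ x)" if "x0 \<le> x" for x
      using VJ_glue[of x] x0_pos that Vs_range[of "\<bar>x\<bar> - sh"] vm_g\<beta>
      by (cases "x = x0") (auto simp: VJ_def Uj_eq)
    have ev: "\<forall>\<^sub>F x in at_top. Vs (\<bar>x\<bar> - sh) = VJ x"
      by (rule eventually_mono[OF eventually_gt_at_top[of x0]]) (use x0_pos in \<open>auto simp: VJ_def\<close>)
    show "(VJ \<longlongrightarrow> 0) at_top"
      by (rule Lim_transform_eventually[OF abs_tendsto(1)[OF Vs_tendsto] ev])
    have ev: "\<forall>\<^sub>F x in at_top. Ws (\<bar>x\<bar> - sh) = WJ x"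
      by (rule eventually_mono[OF eventually_gt_at_top[of x0]]) (use x0_pos in \<open>auto simp: WJ_def Wminus_def\<close>)
    show "(WJ \<longlongrightarrow> 0) at_top"
      by (rule Lim_transform_eventually[OF abs_tendsto(1)[OF Ws_tendsto] ev])
  qed (auto simp: even_fun_def Uj_even g_Uj VJ_cont WJ_cont
    intro: VJ_deriv WJ_deriv Uj_bounds)
qed

text \<open>The inner limit is at least \<open>\<gamma>\<close> and the outer one less than
  \<open>\<beta>\<close>.\<close>

lemma has_jump_at_x0: "has_jump_at Uj x0"
  unfolding has_jump_at_def
proof (intro exI conjI)
  have "((\<lambda>x. hp (Vp x)) \<longlongrightarrow> hp (Vp x0)) (at_left x0)"
  proof (rule continuous_on_tendsto_compose[OF hp_cont])
    show "(Vp \<longlongrightarrow> Vp x0) (at_left x0)"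
      using DERIV_isCont[OF dVp[of x0]] x0_pos by (simp add: isCont_def filterlim_at_split)
    show "\<forall>\<^sub>F x in at_left x0. Vp x \<in> {g \<gamma>..1}"
      using eventually_at_left_real[OF x0_pos]
    proof eventually_elim
      case (elim x)
      then show ?case using Vp_range[of x] v0_ge vs_less1 by simp
    qed
  qed (use Vp_x0 v0_ge v0_less1 in simp)
  moreover have "\<forall>\<^sub>F x in at_left x0. hp (Vp x) = Uj x"
    using eventually_at_left_real[OF x0_pos] by eventually_elim (simp add: Uj_eq)
  ultimately show "(Uj \<longlongrightarrow> hp (Vp x0)) (at_left x0)" by (rule Lim_transform_eventually)
  have "isCont (\<lambda>x. hm (Vs (\<bar>x\<bar> - sh))) x0"
    using x0_pos by (intro DERIV_isCont[OF hm_Vs_props(1)]) simp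
  then have "((\<lambda>x. hm (Vs (\<bar>x\<bar> - sh))) \<longlongrightarrow> hm (Vs (\<bar>x0\<bar> - sh))) (at_right x0)"
    by (simp add: isCont_def filterlim_at_split)
  moreover have "\<forall>\<^sub>F x in at_right x0. hm (Vs (\<bar>x\<bar> - sh)) = Uj x"
    using x0_pos by (intro eventually_mono[OF eventually_at_right_less[of x0]]) (simp add: Uj_eq)
  ultimately show "(Uj \<longlongrightarrow> hm (Vs (\<bar>x0\<bar> - sh))) (at_right x0)" by (rule Lim_transform_eventually)
  show "hp (Vp x0) \<noteq> hm (Vs (\<bar>x0\<bar> - sh))"
    using hp_range[of v0] Us_range[of "\<bar>x0\<bar> - sh"] \<beta>\<gamma> Vp_x0 v0_ge v0_less1 by (simp add: Us_def)
qed

lemma Uj_x0: "Uj x0 = hm v0"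
  using x0_pos Vs_c0 by (simp add: Uj_eq sh_def)

lemma jump_set: "{p. has_jump_at Uj p} = {-x0, x0}"
proof -
  have "even_fun Uj" by (simp add: even_fun_def Uj_even)
  moreover have "\<not> has_jump_at Uj p" if p: "p \<notin> {-x0, x0}" for p
  proof
    assume "has_jump_at Uj p"
    then obtain l r where lr: "(Uj \<longlongrightarrow> l) (at_left p)" "(Uj \<longlongrightarrow> r) (at_right p)" "l \<noteq> r"
      unfolding has_jump_at_def by blast
    have "(Uj \<longlongrightarrow> Uj p) (at_left p)" "(Uj \<longlongrightarrow> Uj p) (at_right p)"
      using DERIV_isCont[OF Uj_deriv(1)[OF p]] by (simp_all add: isCont_def filterlim_at_split)
    then show False using lr tendsto_unique[of "at_left p" Uj] tendsto_unique[of "at_right p" Uj] by auto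
  qed
  ultimately show ?thesis using has_jump_at_x0 has_jump_mirror by blast
qed

end

subsection \<open>Classification\<close>

context bistable begin

text \<open>If \<open>V\<close> exceeds \<open>vm\<close> only above \<open>g \<gamma>\<close>, then up to its first contact with \<open>vm\<close> it follows the
  homoclinic orbit of zero energy; at contact it turns, and it cannot come back to \<open>vm\<close>, since an
  intermediate minimum would have zero energy as well.\<close>

lemma ground_state_no_jump:
  assumes vm_le: "vm \<le> g \<gamma>" and gs: "ground_state f d U" and U1: "\<And>x. U x \<le> 1"
  shows "AE x in lebesgue. U x = Us x"
proof -
  obtain M where "bounded_source U M" using ground_state_bounded_source[OF gs] .
  then interpret bounded_source U M .
  define V where "V = conv kernel U"
  define W where "W = conv_deriv U"
  have gU: "V x = g (U x)" for x using ground_state_conv[OF gs] by (simp add: V_def)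
  have U0: "0 < U x" for x using gs unfolding ground_state_def by blast
  have V0: "0 < V x" for x using ground_state_conv_pos[OF gs] by (simp add: V_def)
  have dV: "(V has_real_derivative W x) (at x)" for x
    unfolding V_def W_def by (rule conv_has_deriv)
  have cV: "continuous_on S V" and cW: "continuous_on S W" for S
    unfolding V_def W_def
    by (auto intro!: continuous_at_imp_continuous_on conv_isCont conv_deriv_isCont)
  have Vev: "V (- x) = V x" for x using ground_state_conv_even[OF gs] by (simp add: V_def)
  have Vlim: "(V \<longlongrightarrow> 0) at_bot" using ground_state_conv_lim[OF gs] by (simp add: V_def)
  have WV: "\<bar>W x\<bar> \<le> V x" for x
    using conv_deriv_le_conv[OF less_imp_le[OF U0]] by (simp add: V_def W_def)
  have Wlim: "(W \<longlongrightarrow> 0) at_bot"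
    by (rule Lim_null_comparison[OF _ Vlim]) (simp add: WV)
  \<comment> \<open>On \<open>[\<beta>, 1]\<close> the function \<open>g\<close> has its minimum at
    \<open>\<gamma>\<close>. This is where the bound \<open>U <= 1\<close> enters.\<close>
  have low: "U x < \<beta>" if "V x < g \<gamma>" for x
  proof (rule ccontr)
    assume "\<not> U x < \<beta>"
    then consider "U x \<in> {\<beta>..\<gamma>}" | "U x \<in> {\<gamma>..1}" using U1[of x] by fastforce
    then have "g \<gamma> \<le> g (U x)"
    proof cases
      case 1
      then show ?thesis using g_mid_less[of "U x" \<gamma>] by (cases "U x = \<gamma>") auto
    next
      case 2
      then show ?thesis by (intro plus.g_le) auto
    qed
    then show False using that gU[of x] by simp
  qed
  have dW: "(W has_real_derivative V x - hm (V x)) (at x)" if x: "V x < vm" for x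
  proof -
    have op: "open {y. V y < vm}" by (intro open_Collect_less cV continuous_intros)
    have eq: "U y = hm (V y)" if "y \<in> {y. V y < vm}" for y
      using low[of y] that vm_le hm_g[of "U y"] U0[of y] gU[of y] by simp
    have "continuous_on {y. V y < vm} (\<lambda>y. hm (V y))"
      by (rule continuous_on_compose2[OF hm_cont cV]) (use V0 vm_g\<beta> less_imp_le in force)
    then have "continuous_on {y. V y < vm} U" by (rule continuous_on_eq) (simp add: eq)
    then have "isCont U x" using op x by (simp add: continuous_on_eq_continuous_at)
    then show ?thesis
      using conv_deriv_has_deriv[of x] eq[of x] x by (simp add: V_def W_def)
  qed
  \<comment> \<open>Contact with \<open>vm\<close> at 0 itself cannot be excluded, since
    \<open>Vs\<close> peaks there.\<close>
  have "V x < vm" if "x \<noteq> 0" for x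
  proof (rule ccontr)
    assume nx: "\<not> V x < vm"
    define A where "A = {y. vm \<le> V y}"
    have xA: "- \<bar>x\<bar> \<in> A" using nx Vev[of x] by (auto simp: A_def abs_if)
    have clA: "closed A" unfolding A_def by (intro closed_Collect_le cV continuous_intros)
    have "\<forall>\<^sub>F y in at_bot. V y < vm" using Vlim vm_pos by (rule order_tendstoD)
    then obtain K where K: "\<And>y. y \<le> K \<Longrightarrow> V y < vm" by (auto simp: eventually_at_bot_linorder)
    have bA: "bdd_below A"
    proof (rule bdd_belowI[of _ K])
      show "K \<le> y" if "y \<in> A" for y using K[of y] that by (cases "K \<le> y") (auto simp: A_def)
    qed
    define x1 where "x1 = Inf A"
    have x1A: "x1 \<in> A" unfolding x1_def using xA by (intro closed_contains_Inf clA bA) auto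
    have x1_neg: "x1 < 0"
      using cInf_lower[OF xA bA] that by (simp add: x1_def)
    have before: "V y < vm" if "y < x1" for y
      using cInf_lower[OF _ bA, of y] that by (force simp: A_def x1_def)
    have "V x1 = vm"
    proof (rule antisym)
      have "(V \<longlongrightarrow> V x1) (at_left x1)"
        using DERIV_isCont[OF dV[of x1]] by (simp add: isCont_def filterlim_at_split)
      moreover have "\<forall>\<^sub>F y in at_left x1. V y \<le> vm"
        using eventually_at_left_real[of "x1 - 1" x1] by (auto elim!: eventually_mono dest: before)
      ultimately show "V x1 \<le> vm" by (rule tendsto_upperbound) simp
    qed (use x1A in \<open>simp add: A_def\<close>)
    note Vx1 = this
    have "W x1 = 0"
    proof -
      have const: "(W x1)\<^sup>2 / 2 + Gm (V x1) = (W y)\<^sup>2 / 2 + Gm (V y)" if "y \<le> x1" for y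
      proof (rule minus_energy_const[OF dV _ cV cW _ that])
        show "V z \<in> {0..g \<beta>}" if "z \<in> {y..x1}" for z
          using before[of z] V0[of z] Vx1 vm_g\<beta> that by (cases "z = x1") auto
      qed (use before dW in auto)
      have "((\<lambda>y. (W y)\<^sup>2 / 2 + Gm (V y)) \<longlongrightarrow> 0\<^sup>2 / 2 + Gm 0) at_bot"
      proof (intro tendsto_intros Wlim continuous_on_tendsto_compose[OF Gm_cont Vlim])
        show "\<forall>\<^sub>F y in at_bot. V y \<in> {0..g \<beta>}"
          using \<open>\<forall>\<^sub>F y in at_bot. V y < vm\<close> by eventually_elim (use V0 vm_g\<beta> less_imp_le in force)
      qed (use g\<beta>_pos in auto)
      moreover have "((\<lambda>y. (W y)\<^sup>2 / 2 + Gm (V y)) \<longlongrightarrow> (W x1)\<^sup>2 / 2 + Gm (V x1)) at_bot"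
        by (rule tendsto_eventually)
          (auto intro!: eventually_mono[OF eventually_le_at_bot[of x1]] const[symmetric])
      ultimately have "0\<^sup>2 / 2 + Gm 0 = (W x1)\<^sup>2 / 2 + Gm (V x1)"
        by (rule tendsto_unique[OF trivial_limit_at_bot_linorder])
      then show ?thesis using Vx1 Gm_vm Gm_0 by simp
    qed
    \<comment> \<open>\<open>U\<close> may be discontinuous at \<open>x1\<close>, so no pointwise
      second derivative is available. Near \<open>x1\<close> one has \<open>V > g t\<close>, and
      \<open>g\<close> increases on \<open>[0, t]\<close>, which forces \<open>U >= t\<close> on
      whatever branch. With \<open>V <= s < t\<close> the integrated equation then gives
      \<open>W < 0\<close> to the right of \<open>x1\<close>.\<close>
    define t where "t = (vm + hm vm) / 2"
    have t: "vm < t" "t < hm vm" using hm_vm_gt by (simp_all add: t_def)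
    have gt: "g t < vm"
      using minus.g_less[of t "hm vm"] t vm_pos hm_vm_less g_hm[of vm] vm_g\<beta> by simp
    define s where "s = (vm + t) / 2"
    have s: "vm < s" "s < t" using t by (simp_all add: s_def)
    have "\<forall>\<^sub>F y in at x1. g t < V y" "\<forall>\<^sub>F y in at x1. V y < s"
      using DERIV_isCont[OF dV[of x1]] gt s Vx1 unfolding isCont_def
      by (auto intro: order_tendstoD)
    then have "\<forall>\<^sub>F y in at x1. g t < V y \<and> V y < s" by eventually_elim simp
    then obtain e where e: "0 < e" "\<And>y. y \<noteq> x1 \<Longrightarrow> \<bar>y - x1\<bar> < e \<Longrightarrow> g t < V y \<and> V y < s"
      by (auto simp: eventually_at dist_real_def)
    have near: "V y \<le> s" "t \<le> U y" if "x1 \<le> y" "y < x1 + e" for y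
    proof -
      have y: "g t < V y \<and> V y < s" using e(2)[of y] that Vx1 gt s by (cases "y = x1") auto
      then show "V y \<le> s" by simp
      show "t \<le> U y"
      proof (rule ccontr)
        assume "\<not> t \<le> U y"
        then have "g (U y) < g t"
          using U0[of y] t hm_vm_less by (intro minus.g_less) auto
        then show False using y gU[of y] by simp
      qed
    qed
    have neg: "W y < 0" if y: "x1 < y" "y < x1 + e" for y
    proof -
      have "W y - W x1 = integral {x1..y} (\<lambda>z. V z - U z)"
        using conv_deriv_diff[of x1 y] y by (simp add: V_def W_def)
      also have "\<dots> \<le> integral {x1..y} (\<lambda>z. s - t)"
      proof (rule integral_le)
        show "(\<lambda>z. V z - U z) integrable_on {x1..y}"
          by (intro integrable_diff integrable_continuous_interval cV integrable_U)
        show "V z - U z \<le> s - t" if "z \<in> {x1..y}" for z using near[of z] that y by auto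
      qed auto
      also have "\<dots> = (y - x1) * (s - t)" using y by simp
      also have "\<dots> < 0" using y s by (intro mult_pos_neg) auto
      finally show ?thesis using \<open>W x1 = 0\<close> by simp
    qed
    have dec: "V y < vm" if y: "x1 < y" "y < x1 + e" for y
    proof -
      have "V y < V x1"
      proof (rule DERIV_neg_imp_decreasing_open[OF y(1) _ cV])
        show "\<exists>D. (V has_real_derivative D) (at z) \<and> D < 0" if "x1 < z" "z < y" for z
          using dV[of z] neg[of z] that y by (intro exI[of _ "W z"]) auto
      qed
      then show ?thesis using Vx1 by simp
    qed
    define c where "c = x1 + e / 2"
    have c: "x1 < c" "c < x1 + e" using e(1) by (simp_all add: c_def)
    \<comment> \<open>Cut off at \<open>c\<close> rather than at \<open>x1\<close>, so that the
      infimum is the next contact and not \<open>x1\<close> again.\<close>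
    define A2 where "A2 = A \<inter> {c..}"
    \<comment> \<open>By evenness \<open>- x1\<close> is a contact point too, so a next contact
      exists; it lies beyond the stretch on which \<open>V\<close> was shown to be below
      \<open>vm\<close>.\<close>
    have "x1 + e \<le> - x1"
      using dec[of "- x1"] x1_neg Vev[of x1] Vx1 by (cases "x1 + e \<le> - x1") auto
    then have "- x1 \<in> A2" using x1A Vev[of x1] c by (auto simp: A2_def A_def)
    then have ne: "A2 \<noteq> {}" by auto
    have b2: "bdd_below A2" by (rule bdd_belowI[of _ c]) (simp add: A2_def)
    define x2 where "x2 = Inf A2"
    have x2: "x2 \<in> A2"
      unfolding x2_def by (intro closed_contains_Inf ne b2) (auto simp: A2_def intro: clA)
    have between: "V y < vm" if "x1 < y" "y < x2" for y
    proof (rule ccontr)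
      assume "\<not> V y < vm"
      then have "y \<in> A2"
        using dec[of y] that c by (cases "y < x1 + e") (auto simp: A2_def A_def)
      then show False using cInf_lower[OF _ b2, of y] that by (simp add: x2_def)
    qed
    have cx2: "c \<le> x2" "vm \<le> V x2" using x2 by (auto simp: A2_def A_def)
    obtain \<xi> where \<xi>: "\<xi> \<in> {x1..x2}" "\<And>y. y \<in> {x1..x2} \<Longrightarrow> V \<xi> \<le> V y"
      using continuous_attains_inf[of "{x1..x2}" V] cV c cx2 by force
    have V\<xi>: "V \<xi> < vm" using \<xi>(2)[of c] dec[OF c] c cx2 by simp
    then have "\<xi> \<noteq> x1" "\<xi> \<noteq> x2" using Vx1 cx2 by auto
    then have in\<xi>: "x1 < \<xi>" "\<xi> < x2" using \<xi>(1) by auto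
    have "W \<xi> = 0"
    proof (rule DERIV_local_min[OF dV])
      show "0 < min (\<xi> - x1) (x2 - \<xi>)" using in\<xi> by simp
      show "\<forall>y. \<bar>\<xi> - y\<bar> < min (\<xi> - x1) (x2 - \<xi>) \<longrightarrow> V \<xi> \<le> V y"
      proof (intro allI impI \<xi>(2))
        fix y assume "\<bar>\<xi> - y\<bar> < min (\<xi> - x1) (x2 - \<xi>)"
        then show "y \<in> {x1..x2}" unfolding atLeastAtMost_iff by linarith
      qed
    qed
    moreover have "(W \<xi>)\<^sup>2 / 2 + Gm (V \<xi>) = (W x1)\<^sup>2 / 2 + Gm (V x1)"
    proof (rule minus_energy_const[OF dV _ cV cW])
      show "V z \<in> {0..g \<beta>}" if "z \<in> {x1..\<xi>}" for z
        using between[of z] V0[of z] Vx1 vm_g\<beta> that in\<xi> by (cases "z = x1") auto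
    qed (use between dW in\<xi> in auto)
    ultimately have "Gm (V \<xi>) = 0" using \<open>W x1 = 0\<close> Vx1 Gm_vm by simp
    then show False using Gm_neg[OF V0 V\<xi>] by simp
  qed
  then have "U x \<le> \<beta>" if "x \<notin> {0}" for x using low[of x] that vm_le by force
  then show ?thesis by (intro ground_state_minus_branch[OF gs, of "{0}"]) auto
qed

text \<open>A connected image cannot cross the gap between \<open>\<beta>\<close> and
  \<open>\<gamma>\<close>; its midpoint is the witness.\<close>

lemma branch_selection:
  assumes "connected S" "continuous_on S U" "U ` S \<subseteq> {0..\<beta>} \<union> {\<gamma>..1}" "x \<in> S" "y \<in> S" "U x \<le> \<beta>"
  shows "U y \<le> \<beta>"
proof (rule ccontr)
  assume "\<not> U y \<le> \<beta>"
  then have "\<gamma> \<le> U y" using assms(3,5) by auto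
  moreover have "connected (U ` S)" using assms by (intro connected_continuous_image)
  ultimately have "(\<beta> + \<gamma>) / 2 \<in> U ` S"
    using assms(4-6) \<beta>\<gamma> connectedD_interval[of "U ` S" "U x" "U y" "(\<beta> + \<gamma>) / 2"] by auto
  then have "(\<beta> + \<gamma>) / 2 \<in> {0..\<beta>} \<union> {\<gamma>..1}" using assms(3) by blast
  then show False using \<beta>\<gamma> by (auto simp: field_simps)
qed

text \<open>By symmetry the jumps are at \<open>- p\<close> and \<open>p\<close>, and each of the
  three pieces of the line stays on one branch. Decay puts the outer pieces on the minus branch. If
  the middle does likewise, \<open>U\<close> is \<open>Us\<close>; otherwise the inner and outer
  orbits are identified with those of \<open>v0 = V p\<close>.\<close>

lemma ground_state_two_branch:
  assumes gs: "ground_state f d U" and prof: "two_branch_profile \<beta> \<gamma> U"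
  shows "(AE x in lebesgue. U x = Us x) \<or>
    (\<exists>v0\<in>jump_values g \<beta> \<gamma>. AE x in lebesgue. U x = U_jump g \<beta> \<gamma> v0 x)"
proof -
  obtain M where "bounded_source U M" using ground_state_bounded_source[OF gs] .
  then interpret bounded_source U M .
  have rngU: "U x \<in> {0..\<beta>} \<union> {\<gamma>..1}" for x
    using prof unfolding two_branch_profile_def by blast
  have rngS: "U ` S \<subseteq> {0..\<beta>} \<union> {\<gamma>..1}" for S
    using prof unfolding two_branch_profile_def by blast
  have Uev: "even_fun U" and Ulim: "(U \<longlongrightarrow> 0) at_top" and U0: "\<And>x. 0 < U x"
    using gs unfolding ground_state_def by auto
  obtain p where p: "0 \<le> p" "\<And>x. x \<notin> {-p, p} \<Longrightarrow> isCont U x"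
    using prof even_discontinuities[OF Uev] unfolding two_branch_profile_def by metis
  have out: "U x \<le> \<beta>" if "p < \<bar>x\<bar>" for x
  proof -
    have "\<forall>\<^sub>F y in at_top. U y < \<beta>" using Ulim \<beta>_pos by (rule order_tendstoD)
    then have "\<forall>\<^sub>F y in at_top. U y < \<beta> \<and> p < y"
      using eventually_gt_at_top by (rule eventually_conj)
    then obtain y where y: "U y < \<beta>" "p < y" by (auto simp: eventually_at_top_linorder)
    have "U \<bar>x\<bar> \<le> \<beta>"
    proof (rule branch_selection[of "{p<..}" U y, OF _ _ rngS])
      show "continuous_on {p<..} U" using p by (intro continuous_at_imp_continuous_on ballI p(2)) auto
    qed (use y that in auto)
    then show ?thesis using Uev by (simp add: even_fun_def abs_if split: if_splits)
  qed
  show ?thesis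
  proof (cases "\<exists>y. \<bar>y\<bar> < p \<and> U y \<le> \<beta>")
    case True
    then obtain y where y: "\<bar>y\<bar> < p" "U y \<le> \<beta>" by blast
    have "U x \<le> \<beta>" if "\<bar>x\<bar> < p" for x
    proof (rule branch_selection[of "{-p<..<p}" U y, OF _ _ rngS])
      show "continuous_on {-p<..<p} U" by (intro continuous_at_imp_continuous_on ballI p(2)) auto
    qed (use y that in auto)
    then have "U x \<le> \<beta>" if "x \<notin> {-p, p}" for x
      using that out[of x] by (cases "\<bar>x\<bar>" p rule: linorder_cases) auto
    then show ?thesis using ground_state_minus_branch[OF gs, of "{-p, p}"] by simp
  next
    case False
    show ?thesis
    proof (cases "p = 0")
      case True
      then have "U x \<le> \<beta>" if "x \<notin> {0}" for x using out[of x] that by simp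
      then show ?thesis using ground_state_minus_branch[OF gs, of "{0}"] by simp
    next
      case pn: False
      then have p0: "0 < p" using p(1) by simp
      have inn: "\<gamma> \<le> U x \<and> U x \<le> 1" if "\<bar>x\<bar> < p" for x
        using False that rngU[of x] by force
      define V where "V = conv kernel U"
      define W where "W = conv_deriv U"
      have gU: "V x = g (U x)" for x using ground_state_conv[OF gs] by (simp add: V_def)
      have V0: "0 < V x" for x using ground_state_conv_pos[OF gs] by (simp add: V_def)
      have dV: "(V has_real_derivative W x) (at x)" for x
        unfolding V_def W_def by (rule conv_has_deriv)
      have cV: "continuous_on S V" and cW: "continuous_on S W" for S
        unfolding V_def W_def
        by (auto intro!: continuous_at_imp_continuous_on conv_isCont conv_deriv_isCont)
      have Vev: "V (- x) = V x" and Wodd: "W (- x) = - W x" for x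
        using ground_state_conv_even[OF gs] by (simp_all add: V_def W_def)
      have Vlim: "(V \<longlongrightarrow> 0) at_top" using ground_state_conv_lim[OF gs] by (simp add: V_def)
      have WV: "\<bar>W x\<bar> \<le> V x" for x
        using conv_deriv_le_conv[OF less_imp_le[OF U0]] by (simp add: V_def W_def)
      have Wlim: "(W \<longlongrightarrow> 0) at_top"
        by (rule Lim_null_comparison[OF _ Vlim]) (simp add: WV)
      have dW: "(W has_real_derivative V x - U x) (at x)" if "x \<notin> {-p, p}" for x
        using conv_deriv_has_deriv[OF p(2)[OF that]] by (simp add: V_def W_def)
      have U_out: "U x = hm (V x)" "V x \<le> g \<beta>" if "p < \<bar>x\<bar>" for x
        using out[OF that] U0[of x] gU[of x] hm_g[of "U x"] minus.g_le[of "U x" \<beta>] by auto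
      have U_in: "U x = hp (V x)" "g \<gamma> \<le> V x" "V x \<le> 1" if "\<bar>x\<bar> < p" for x
        using inn[OF that] gU[of x] hp_g[of "U x"] plus.g_le[of \<gamma> "U x"] plus.g_le[of "U x" 1] g1 by auto
      \<comment> \<open>\<open>V\<close> is continuous at \<open>p\<close>, so its value there lies
        in the domains of both branches, as a limit from either side.\<close>
      have Vp: "V p \<le> g \<beta>" "g \<gamma> \<le> V p"
      proof -
        have l: "(V \<longlongrightarrow> V p) (at_left p)" "(V \<longlongrightarrow> V p) (at_right p)"
          using DERIV_isCont[OF dV[of p]] by (simp_all add: isCont_def filterlim_at_split)
        have "\<forall>\<^sub>F x in at_right p. V x \<le> g \<beta>"
          using p0 by (intro eventually_mono[OF eventually_at_right_less[of p]]) (use U_out in auto)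
        with l(2) show "V p \<le> g \<beta>" by (rule tendsto_upperbound) simp
        have "\<forall>\<^sub>F x in at_left p. g \<gamma> \<le> V x"
          by (rule eventually_mono[OF eventually_at_left_real[OF p0]]) (use U_in in auto)
        with l(1) show "g \<gamma> \<le> V p" by (rule tendsto_lowerbound) simp
      qed
      have rng_out: "V x \<in> {0..g \<beta>}" if "p \<le> x" for x
        using that Vp V0[of x] U_out[of x] p0 by (cases "x = p") auto
      have rng_in: "V x \<in> {g \<gamma>..1}" if "x \<in> {0..p}" for x
        using that Vp U_in[of x] g\<beta>_less1 by (cases "x = p") auto
      define v0 where "v0 = V p"
      have const: "(W x)\<^sup>2 / 2 + Gm (V x) = (W p)\<^sup>2 / 2 + Gm v0" if "p \<le> x" for x
        unfolding v0_def
      proof (rule minus_energy_const[OF dV _ cV cW _ that])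
        show "(W has_real_derivative V z - hm (V z)) (at z)" if "z \<in> {p<..<x}" for z
          using dW[of z] U_out[of z] that p0 by auto
      qed (use rng_out in auto)
      have "((\<lambda>x. (W x)\<^sup>2 / 2 + Gm (V x)) \<longlongrightarrow> 0\<^sup>2 / 2 + Gm 0) at_top"
        using rng_out g\<beta>_pos
        by (intro tendsto_intros Wlim continuous_on_tendsto_compose[OF Gm_cont Vlim])
          (auto intro: eventually_mono[OF eventually_ge_at_top[of p]])
      moreover have "((\<lambda>x. (W x)\<^sup>2 / 2 + Gm (V x)) \<longlongrightarrow> (W p)\<^sup>2 / 2 + Gm v0) at_top"
        by (rule tendsto_eventually) (auto intro!: eventually_mono[OF eventually_ge_at_top[of p]] const)
      ultimately have "0\<^sup>2 / 2 + Gm 0 = (W p)\<^sup>2 / 2 + Gm v0"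
        by (rule tendsto_unique[OF trivial_limit_at_top_linorder])
      then have Wp: "(W p)\<^sup>2 / 2 + Gm v0 = 0" using Gm_0 by simp
      have W0: "W 0 = 0" using Wodd[of 0] by simp
      have dW_in: "(W has_real_derivative V z - hp (V z)) (at z)" if "0 < z" "z < p" for z
        using dW[of z] U_in[of z] that by auto
      have en: "(W x)\<^sup>2 / 2 + Gp (V x) = Gp v0 - Gm v0" if x: "x \<in> {0..p}" for x
      proof -
        have "(W p)\<^sup>2 / 2 + Gp (V p) = (W x)\<^sup>2 / 2 + Gp (V x)"
          by (rule plus_energy_const[OF dV dW_in cV cW]) (use rng_in x in auto)
        then show ?thesis using Wp by (simp add: v0_def)
      qed
      have "v0 \<le> vm"
      proof (rule ccontr)
        assume "\<not> v0 \<le> vm"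
        then have "0 < Gm v0" using Gm_pos Vp by (simp add: v0_def)
        then show False using Wp zero_le_power2[of "W p"] by linarith
      qed
      \<comment> \<open>At \<open>vm\<close> the slope at \<open>p\<close> would vanish, as it does
        at 0 by evenness; but \<open>W\<close> is strictly decreasing in between because
        \<open>hp v > v\<close>.\<close>
      moreover have "v0 \<noteq> vm"
      proof
        assume "v0 = vm"
        then have Gm0: "Gm v0 = 0" using Gm_vm by simp
        then have "W p = 0" using Wp by simp
        have "W p < W 0"
        proof (rule DERIV_neg_imp_decreasing_open[OF p0 _ cW])
          fix z assume z: "0 < z" "z < p"
          then have zp: "z \<in> {0..p}" by simp
          have "Gp (V z) \<le> Gp v0"
            using en[OF zp] zero_le_power2[of "W z"] Gm0 by linarith
          then have "V z \<le> v0"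
            using Gp_le_iff[of "V z" v0] rng_in[OF zp] rng_in[of p] p0 by (simp add: v0_def)
          then have "V z < 1" using \<open>v0 = vm\<close> vm_g\<beta> g\<beta>_less1 by simp
          then show "\<exists>D. (W has_real_derivative D) (at z) \<and> D < 0"
            using dW_in[OF z] hp_gt[of "V z"] rng_in[OF zp] by (intro exI[of _ "V z - hp (V z)"]) auto
        qed
        then show False using \<open>W p = 0\<close> W0 by simp
      qed
      ultimately have v0: "v0 < vm" by simp
      interpret J: bistable_jump f g d a \<beta> \<gamma> v0
        by unfold_locales (use v0 V0 Vp in \<open>auto simp: v0_def\<close>)
      have orbit: "p = J.x0" "\<And>x. x \<in> {0..p} \<Longrightarrow> V x = J.Vp x"
        using J.inner_orbit[OF p0 cV cW dV dW_in W0 rng_in _ v0_def[symmetric]] en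
        by (auto simp: inner_energy_def)
      \<comment> \<open>The energy fixes only the square of \<open>W p\<close>. The sign comes from
        the inner side, where the orbit lies above \<open>v0\<close>.\<close>
      have "W p < 0"
      proof (rule ccontr)
        assume "\<not> W p < 0"
        moreover have "W p \<noteq> 0" using Wp J.Gm_v0 by auto
        ultimately have "0 < W p" by simp
        then obtain e where e: "0 < e" "\<And>h. 0 < h \<Longrightarrow> h < e \<Longrightarrow> V (p - h) < V p"
          using DERIV_pos_inc_left[OF dV[of p]] by blast
        define h where "h = min (e / 2) (p / 2)"
        have h: "0 < h" "h < e" "h < p" using e(1) p0 by (auto simp: h_def min_def)
        have "v0 < V (p - h)" using J.Vp_gt[of "p - h"] orbit h by auto
        then show False using e(2)[OF h(1,2)] by (simp add: v0_def)
      qed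
      have V_out: "V x = Vs (x - J.sh)" if "p \<le> x" for x
      proof -
        have "V x = Vs (x - p + mw.T (V p))"
        proof (rule falling_orbit[OF has_field_derivative_at_within[OF dV] cW])
          show "(W z)\<^sup>2 = - 2 * Gm (V z)" if "p \<le> z" for z using const[OF that] Wp by simp
          show "0 \<le> V z" for z using V0[of z] by simp
        qed (use V0 v0 \<open>W p < 0\<close> that in \<open>auto simp: v0_def\<close>)
        then have "V x = Vs (x - p + mw.T v0)" by (simp add: v0_def)
        then show ?thesis using orbit(1) by (simp add: J.sh_def J.c0_def algebra_simps)
      qed
      have "U x = J.Uj x" if x: "x \<notin> {-p, p}" for x
      proof -
        have Vabs: "V x = V \<bar>x\<bar>" using Vev[of x] by (simp add: abs_if)
        consider "\<bar>x\<bar> < p" | "p < \<bar>x\<bar>" using x by (cases "\<bar>x\<bar>" p rule: linorder_cases) auto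
        then show ?thesis
        proof cases
          case 1
          then have "V x = J.Vp \<bar>x\<bar>" using Vabs orbit(2)[of "\<bar>x\<bar>"] by simp
          also have "\<dots> = J.Vp x"
            using J.pw.V_even[OF J.in_X, of x] 1 orbit(1) by (auto simp: abs_if)
          finally show ?thesis using U_in(1)[OF 1] 1 orbit(1) by (simp add: J.Uj_eq)
        next
          case 2
          then show ?thesis
            using U_out(1)[OF 2] Vabs V_out[of "\<bar>x\<bar>"] orbit(1) by (simp add: J.Uj_eq)
        qed
      qed
      then have "AE x in lebesgue. U x = J.Uj x" by (intro AE_off_finite[of "{-p, p}"]) auto
      moreover have "v0 \<in> jump_values g \<beta> \<gamma>"
        using v0 V0 Vp by (simp add: jump_values_def v0_def)
      ultimately show ?thesis by blast
    qed
  qed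
qed

lemma bistable_jumpI: "v0 \<in> jump_values g \<beta> \<gamma> \<Longrightarrow> bistable_jump f g d a \<beta> \<gamma> v0"
  by unfold_locales (auto simp: jump_values_def)

text \<open>The jump set of the profile reveals \<open>x0\<close>, and its value there, the outer
  limit \<open>hm v0\<close>, reveals \<open>v0\<close>.\<close>

lemma U_jump_inj: "inj_on (U_jump g \<beta> \<gamma>) (jump_values g \<beta> \<gamma>)"
proof (rule inj_onI)
  fix v w
  assume vw: "v \<in> jump_values g \<beta> \<gamma>" "w \<in> jump_values g \<beta> \<gamma>" and eq: "U_jump g \<beta> \<gamma> v = U_jump g \<beta> \<gamma> w"
  interpret v: bistable_jump f g d a \<beta> \<gamma> v using vw by (intro bistable_jumpI)
  interpret w: bistable_jump f g d a \<beta> \<gamma> w using vw by (intro bistable_jumpI)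
  have "{- v.x0, v.x0} = {- w.x0, w.x0}" using v.jump_set w.jump_set eq by simp
  then have "v.x0 = w.x0" using v.x0_pos w.x0_pos by (auto simp: doubleton_eq_iff)
  then have "hm v = hm w" using v.Uj_x0 w.Uj_x0 eq by simp
  then have "g (hm v) = g (hm w)" by simp
  then show "v = w"
    using g_hm[of v] g_hm[of w] v.v0_pos v.v0_less w.v0_pos w.v0_less vm_g\<beta> by simp
qed

text \<open>If \<open>g \<gamma> <= 0\<close>, half of \<open>vm\<close> is admissible. Otherwise
  \<open>Gm (g \<gamma>) < 0\<close> places \<open>g \<gamma>\<close> itself below
  \<open>vm\<close>.\<close>

lemma jump_values_nonempty:
  assumes "g \<gamma> \<le> 0 \<or> (g \<gamma> > 0 \<and> Gm (g \<gamma>) < 0)" shows "jump_values g \<beta> \<gamma> \<noteq> {}"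
proof (cases "g \<gamma> \<le> 0")
  case True
  then have "vm / 2 \<in> jump_values g \<beta> \<gamma>" using vm_pos by (simp add: jump_values_def)
  then show ?thesis by auto
next
  case False
  then have "0 < g \<gamma>" "Gm (g \<gamma>) < 0" using assms by auto
  then have "g \<gamma> < vm"
    using Gm_pos[of "g \<gamma>"] g\<gamma>_less Gm_vm by (cases "g \<gamma>" vm rule: linorder_cases) auto
  then have "g \<gamma> \<in> jump_values g \<beta> \<gamma>" using \<open>0 < g \<gamma>\<close> by (simp add: jump_values_def)
  then show ?thesis by auto
qed

end

text \<open>The classification is up to null sets: where \<open>V x\<close> has preimages under
  \<open>g\<close> on two branches, the equation alone does not decide which of them
  \<open>U x\<close> is, and changing \<open>U\<close> at one point leaves its convolution
  unchanged.\<close>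

theorem lemma3p4:
  fixes f g :: "real \<Rightarrow> real" and d a \<beta> \<gamma> :: real
  assumes "d > 0"
    and "smooth_on_open UNIV f"
    and "0 < a" and "a < 1"
    and "f 0 = 0" and "f a = 0" and "f 1 = 0"
    and "\<forall>u\<in>{0<..<a}. f u < 0"
    and "\<forall>u\<in>{a<..<1}. f u > 0"
    and "deriv f 0 < 0" and "deriv f 1 < 0" and "deriv f a > 0"
    and "integral {0..1} f > 0"
    and "\<forall>u. g u = u - f u / d"
    and "0 < \<beta>" and "\<beta> < \<gamma>" and "\<gamma> < 1"
    and "\<forall>u\<in>{0..<\<beta>} \<union> {\<gamma><..1}. deriv g u > 0"
    and "\<forall>u\<in>{\<beta><..<\<gamma>}. deriv g u < 0"
    and "deriv g \<beta> = 0" and "deriv g \<gamma> = 0"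
    and "G_minus g \<beta> (g \<beta>) > 0"
  shows "\<exists>V\<^sub>s U\<^sub>s.
    positive_homoclinic (g_minus_inv g \<beta>) {0..g \<beta>} V\<^sub>s \<and> even_fun V\<^sub>s \<and>
    (\<forall>W. positive_homoclinic (g_minus_inv g \<beta>) {0..g \<beta>} W \<and> even_fun W \<longrightarrow> W = V\<^sub>s) \<and>
    (\<forall>W. positive_homoclinic (g_minus_inv g \<beta>) {0..g \<beta>} W \<longrightarrow> (\<exists>c. \<forall>x. W x = V\<^sub>s (x - c))) \<and>
    (\<forall>x. U\<^sub>s x = g_minus_inv g \<beta> (V\<^sub>s x)) \<and>
    ground_state f d U\<^sub>s \<and> smooth_on_open UNIV U\<^sub>s \<and>
    range U\<^sub>s \<subseteq> {0..g_minus_inv g \<beta> (v_m g \<beta>)} \<and>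
    (g \<gamma> > 0 \<and> G_minus g \<beta> (g \<gamma>) \<ge> 0 \<longrightarrow>
      (\<forall>U. ground_state f d U \<and> (\<forall>x. U x \<le> 1) \<longrightarrow> (AE x in lebesgue. U x = U\<^sub>s x))) \<and>
    (g \<gamma> \<le> 0 \<or> (g \<gamma> > 0 \<and> G_minus g \<beta> (g \<gamma>) < 0) \<longrightarrow>
      jump_values g \<beta> \<gamma> \<noteq> {} \<and>
      inj_on (U_jump g \<beta> \<gamma>) (jump_values g \<beta> \<gamma>) \<and>
      (\<forall>v0\<in>jump_values g \<beta> \<gamma>.
        is_v_star g \<beta> \<gamma> v0 (v_star g \<beta> \<gamma> v0) \<and>
        travel_integrand g \<beta> \<gamma> v0 integrable_on {v0..v_star g \<beta> \<gamma> v0} \<and>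
        jump_point g \<beta> \<gamma> v0 > 0 \<and>
        is_V_plus g \<beta> \<gamma> v0 (V_plus g \<beta> \<gamma> v0) \<and>
        is_V_minus g \<beta> \<gamma> v0 (V_minus g \<beta> \<gamma> v0) \<and>
        ground_state f d (U_jump g \<beta> \<gamma> v0) \<and>
        {p. has_jump_at (U_jump g \<beta> \<gamma> v0) p} = {- jump_point g \<beta> \<gamma> v0, jump_point g \<beta> \<gamma> v0} \<and>
        smooth_on_open (- {- jump_point g \<beta> \<gamma> v0, jump_point g \<beta> \<gamma> v0}) (U_jump g \<beta> \<gamma> v0)) \<and>
      (\<forall>U. ground_state f d U \<and> two_branch_profile \<beta> \<gamma> U \<longrightarrow>
        (AE x in lebesgue. U x = U\<^sub>s x) \<or>
        (\<exists>v0\<in>jump_values g \<beta> \<gamma>. AE x in lebesgue. U x = U_jump g \<beta> \<gamma> v0 x)))"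
proof -
  interpret bistable f g d a \<beta> \<gamma>
    using assms by unfold_locales auto
  have no_jump: "AE x in lebesgue. U x = Us x"
    if "g \<gamma> > 0 \<and> Gm (g \<gamma>) \<ge> 0" "ground_state f d U" "\<forall>x. U x \<le> 1" for U
  proof (rule ground_state_no_jump[OF _ that(2)])
    \<comment> \<open>\<open>Gm\<close> is negative on \<open>(0, vm)\<close>, so its sign at
      \<open>g \<gamma>\<close> decides on which side of \<open>vm\<close> that value lies.\<close>
    show "vm \<le> g \<gamma>" using Gm_neg[of "g \<gamma>"] that(1) by (cases "vm \<le> g \<gamma>") auto
  qed (use that in simp)
  have jump: "\<forall>v0\<in>jump_values g \<beta> \<gamma>.
        is_v_star g \<beta> \<gamma> v0 (v_star g \<beta> \<gamma> v0) \<and>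
        travel_integrand g \<beta> \<gamma> v0 integrable_on {v0..v_star g \<beta> \<gamma> v0} \<and>
        jump_point g \<beta> \<gamma> v0 > 0 \<and>
        is_V_plus g \<beta> \<gamma> v0 (V_plus g \<beta> \<gamma> v0) \<and>
        is_V_minus g \<beta> \<gamma> v0 (V_minus g \<beta> \<gamma> v0) \<and>
        ground_state f d (U_jump g \<beta> \<gamma> v0) \<and>
        {p. has_jump_at (U_jump g \<beta> \<gamma> v0) p} = {- jump_point g \<beta> \<gamma> v0, jump_point g \<beta> \<gamma> v0} \<and>
        smooth_on_open (- {- jump_point g \<beta> \<gamma> v0, jump_point g \<beta> \<gamma> v0}) (U_jump g \<beta> \<gamma> v0)"
  proof
    fix v0 assume "v0 \<in> jump_values g \<beta> \<gamma>"
    then interpret bistable_jump f g d a \<beta> \<gamma> v0 by (rule bistable_jumpI)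
    have "travel_integrand g \<beta> \<gamma> v0 integrable_on {v0..vs}"
      using travel_has_integral by (rule has_integral_integrable)
    then show "is_v_star g \<beta> \<gamma> v0 (v_star g \<beta> \<gamma> v0) \<and>
        travel_integrand g \<beta> \<gamma> v0 integrable_on {v0..v_star g \<beta> \<gamma> v0} \<and>
        jump_point g \<beta> \<gamma> v0 > 0 \<and>
        is_V_plus g \<beta> \<gamma> v0 (V_plus g \<beta> \<gamma> v0) \<and>
        is_V_minus g \<beta> \<gamma> v0 (V_minus g \<beta> \<gamma> v0) \<and>
        ground_state f d (U_jump g \<beta> \<gamma> v0) \<and>
        {p. has_jump_at (U_jump g \<beta> \<gamma> v0) p} = {- jump_point g \<beta> \<gamma> v0, jump_point g \<beta> \<gamma> v0} \<and>
        smooth_on_open (- {- jump_point g \<beta> \<gamma> v0, jump_point g \<beta> \<gamma> v0}) (U_jump g \<beta> \<gamma> v0)"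
      unfolding V_plus_eq V_minus_eq
      by (intro conjI is_vs x0_pos Vplus_is_V_plus Vminus_is_V_minus Uj_ground_state jump_set Uj_smooth)
  qed
  show ?thesis
  proof (rule exI[of _ Vs], rule exI[of _ Us], intro conjI allI impI)
    show "range Us \<subseteq> {0..hm vm}"
      using Us_range(2) less_imp_le[OF Us_range(1)] by (intro image_subsetI) simp
    show "W = Vs" if "positive_homoclinic hm {0..g \<beta>} W \<and> even_fun W" for W
      using that homoclinic_unique_even by blast
    show "\<exists>c. \<forall>x. W x = Vs (x - c)" if "positive_homoclinic hm {0..g \<beta>} W" for W
      using that by (rule homoclinic_unique)
    show "AE x in lebesgue. U x = Us x"
      if "g \<gamma> > 0 \<and> Gm (g \<gamma>) \<ge> 0" "ground_state f d U \<and> (\<forall>x. U x \<le> 1)" for U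
      using no_jump that by blast
    show "(AE x in lebesgue. U x = Us x) \<or>
        (\<exists>v0\<in>jump_values g \<beta> \<gamma>. AE x in lebesgue. U x = U_jump g \<beta> \<gamma> v0 x)"
      if "ground_state f d U \<and> two_branch_profile \<beta> \<gamma> U" for U
      using that ground_state_two_branch by blast
  qed (rule Vs_homoclinic Vs_even_fun Us_def Us_ground_state Us_smooth U_jump_inj jump
      | erule jump_values_nonempty)+
qed

end
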